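(* Let $V$ be a uniquely $2$-divisible $\mathrm{Alt}(5)$-module that either has prime characteristic or is divisible. Assume that, for every nontrivial $g\in\mathrm{Alt}(5)$ such that $V$ is $|g|$-divisible, each element of $N_{\mathrm{Alt}(5)}(\langle g\rangle)\setminus\langle g\rangle$ inverts $\mathrm{tr}_g(V)$. Choose any involution $\alpha\in\mathrm{Alt}(5)$ and either conjugacy class $\mathcal{C}$ of $5$-cycles in $\mathrm{Alt}(5)$. Put $L=\mathrm{tr}_\alpha(V)$, and regard $L$ as a $\mathbb{Z}[\phi]$-module by letting $\phi$ act as the image in $\mathrm{End}(L)$ of $\frac14\sum_{g\in\mathcal{C}}g$ (in particular, this image satisfies $\phi^2=\phi+1$). Then $V\cong\mathrm{Icosa}(L)$ as $\mathrm{Alt}(5)$-modules, where $\mathrm{Icosa}(L)$ is formed with respect to a generating set $\{\alpha,\gamma\}$ of $\mathrm{Alt}(5)$ with $|\gamma|=3$ and $\alpha\gamma\in\mathcal{C}$.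
   Context: A $G$-module is an abelian group $V$ (written additively) on which the group $G$ acts on the left by automorphisms. For $g\in G$ of finite order $m$, $\mathrm{tr}_g=1+g+\cdots+g^{m-1}\in\mathrm{End}(V)$. An element $h$ inverts a subgroup $A\le V$ if $ha=-a$ for all $a\in A$. For an abelian group $V$ and a prime $p$: $V$ has characteristic $p$ if $V$ is an elementary abelian $p$-group, and $V$ has prime characteristic if it has characteristic $p$ for some prime $p$. $V$ is $p$-divisible if for every $v\in V$ there is $w\in V$ with $v=pw$; it is uniquely $p$-divisible if such $w$ is unique for each $v$. $V$ is divisible if it is $p$-divisible for all primes $p$. Unique $2$-divisibility makes multiplication by $\frac14$ meaningful; the sum of the elements of a conjugacy class commutes with the action of $\mathrm{Alt}(5)$, so it preserves $\mathrm{tr}_\alpha(V)$. Icosahedral modules. Let $R=\mathbb{Z}[\phi]$ with $\phi$ satisfying $\phi^2=\phi+1$. Fix a generating set $\{\alpha,\gamma\}$ of $\mathrm{Alt}(5)$ with $|\alpha|=2$, $|\gamma|=3$, $|\alpha\gamma|=5$. Then $\mathrm{Icosa}(R)$ (with respect to $\alpha,\gamma$) is the $R[\mathrm{Alt}(5)]$-module $Re_1\oplus Re_2\oplus Re_3$, free over $R$ on $e_1,e_2,e_3$, with action $\alpha e_1=-e_1+\phi e_3$, $\alpha e_2=-e_2+\phi e_3$, $\alpha e_3=e_3$, $\gamma e_1=e_3$, $\gamma e_2=e_1$, $\gamma e_3=e_2$. For an $R$-module $L$ without $2$-torsion, $\mathrm{Icosa}(L)=\mathrm{Icosa}(R)\otimes_R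 L$ with $\mathrm{Alt}(5)$ acting trivially on $L$. *)

theory Defs
  imports
    "HOL-Algebra.Free_Abelian_Groups"
    "HOL-Algebra.Group_Action"
    "HOL-Algebra.Module"
    "HOL-Algebra.Multiplicative_Group"
    "HOL-Algebra.Sym_Groups"
    "HOL-Computational_Algebra.Primes"
begin

section \<open>Modules over a group\<close>

text \<open>
  An abelian group is the additive part of a ring record (the locale \<open>abelian_group\<close>); its
  multiplicative fields play no role.  As in \<open>group_action\<close>, the permutations \<open>act g\<close> are
  extensional outside the carrier.
\<close>

definition group_module ::
  "('g, 'c) monoid_scheme \<Rightarrow> ('v, 'm) ring_scheme \<Rightarrow> ('g \<Rightarrow> 'v \<Rightarrow> 'v) \<Rightarrow> bool"
  where "group_module G V act \<longleftrightarrow>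
    abelian_group V \<and> group_action G (carrier V) act \<and>
    (\<forall>g \<in> carrier G. act g \<in> hom (add_monoid V) (add_monoid V))"

definition group_module_iso ::
  "('g, 'c) monoid_scheme \<Rightarrow> ('v, 'm) ring_scheme \<Rightarrow> ('g \<Rightarrow> 'v \<Rightarrow> 'v) \<Rightarrow>
   ('w, 'n) ring_scheme \<Rightarrow> ('g \<Rightarrow> 'w \<Rightarrow> 'w) \<Rightarrow> bool"
  where "group_module_iso G V act W act' \<longleftrightarrow>
    (\<exists>f \<in> iso (add_monoid V) (add_monoid W).
       \<forall>g \<in> carrier G. \<forall>v \<in> carrier V. f (act g v) = act' g (f v))"

definition trace_op ::
  "('g, 'c) monoid_scheme \<Rightarrow> ('v, 'm) ring_scheme \<Rightarrow> ('g \<Rightarrow> 'v \<Rightarrow> 'v) \<Rightarrow> 'g \<Rightarrow> 'v \<Rightarrow> 'v"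
  where "trace_op G V act g v =
    finsum V (\<lambda>i. act (g [^]\<^bsub>G\<^esub> i) v) {..<group.ord G g}"

abbreviation trace_image ::
  "('g, 'c) monoid_scheme \<Rightarrow> ('v, 'm) ring_scheme \<Rightarrow> ('g \<Rightarrow> 'v \<Rightarrow> 'v) \<Rightarrow> 'g \<Rightarrow> 'v set"
  where "trace_image G V act g \<equiv> trace_op G V act g ` carrier V"

definition inverts :: "('v, 'm) ring_scheme \<Rightarrow> ('g \<Rightarrow> 'v \<Rightarrow> 'v) \<Rightarrow> 'g \<Rightarrow> 'v set \<Rightarrow> bool"
  where "inverts V act h A \<longleftrightarrow> (\<forall>a \<in> A. act h a = \<ominus>\<^bsub>V\<^esub> a)"


section \<open>Divisibility and characteristic\<close>

definition n_divisible :: "nat \<Rightarrow> ('v, 'm) ring_scheme \<Rightarrow> bool"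
  where "n_divisible n V \<longleftrightarrow> (\<forall>v \<in> carrier V. \<exists>w \<in> carrier V. v = [n] \<cdot>\<^bsub>V\<^esub> w)"

definition uniquely_n_divisible :: "nat \<Rightarrow> ('v, 'm) ring_scheme \<Rightarrow> bool"
  where "uniquely_n_divisible n V \<longleftrightarrow> (\<forall>v \<in> carrier V. \<exists>!w. w \<in> carrier V \<and> v = [n] \<cdot>\<^bsub>V\<^esub> w)"

definition divisible :: "('v, 'm) ring_scheme \<Rightarrow> bool"
  where "divisible V \<longleftrightarrow> (\<forall>p::nat. Factorial_Ring.prime p \<longrightarrow> n_divisible p V)"

definition prime_characteristic :: "('v, 'm) ring_scheme \<Rightarrow> bool"
  where "prime_characteristic V \<longleftrightarrow>
    (\<exists>p::nat. Factorial_Ring.prime p \<and> (\<forall>v \<in> carrier V. [p] \<cdot>\<^bsub>V\<^esub> v = \<zero>\<^bsub>V\<^esub>))"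

text \<open>Meaningful when \<open>V\<close> is uniquely \<open>n\<close>-divisible.\<close>

definition divide_by :: "('v, 'm) ring_scheme \<Rightarrow> nat \<Rightarrow> 'v \<Rightarrow> 'v"
  where "divide_by V n v = (THE w. w \<in> carrier V \<and> v = [n] \<cdot>\<^bsub>V\<^esub> w)"


section \<open>Conjugacy classes of 5-cycles in Alt(5)\<close>

definition conjugacy_class :: "('g, 'c) monoid_scheme \<Rightarrow> 'g \<Rightarrow> 'g set"
  where "conjugacy_class G c = {h \<otimes>\<^bsub>G\<^esub> c \<otimes>\<^bsub>G\<^esub> inv\<^bsub>G\<^esub> h | h. h \<in> carrier G}"

definition five_cycles :: "(nat \<Rightarrow> nat) set"
  where "five_cycles = {cycle_of_list cs | cs. cycle cs \<and> length cs = 5 \<and> set cs \<subseteq> {1..5}}"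

definition five_cycle_class :: "(nat \<Rightarrow> nat) set \<Rightarrow> bool"
  where "five_cycle_class C \<longleftrightarrow> (\<exists>c \<in> five_cycles. C = conjugacy_class (alt_group 5) c)"


section \<open>The ring \<open>\<int>[\<phi>]\<close>\<close>

text \<open>The pair \<open>(a, b)\<close> stands for \<open>a + b \<phi>\<close>, where \<open>\<phi>\<^sup>2 = \<phi> + 1\<close>.\<close>

definition Zphi :: "(int \<times> int) ring"
  where "Zphi = \<lparr>carrier = UNIV,
    monoid.mult = (\<lambda>(a, b) (c, d). (a * c + b * d, a * d + b * c + b * d)),
    monoid.one = (1, 0),
    ring.zero = (0, 0),
    add = (\<lambda>(a, b) (c, d). (a + c, b + d))\<rparr>"

definition phi :: "int \<times> int"
  where "phi = (0, 1)"

lemma Zphi_simps: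
  "carrier Zphi = UNIV"
  "(a, b) \<otimes>\<^bsub>Zphi\<^esub> (c, d) = (a * c + b * d, a * d + b * c + b * d)"
  "\<one>\<^bsub>Zphi\<^esub> = (1, 0)"
  "\<zero>\<^bsub>Zphi\<^esub> = (0, 0)"
  "(a, b) \<oplus>\<^bsub>Zphi\<^esub> (c, d) = (a + c, b + d)"
  by (simp_all add: Zphi_def)

lemma cring_Zphi: "cring Zphi"
proof (rule cringI)
  show "abelian_group Zphi"
  proof (rule abelian_groupI)
    fix x assume "x \<in> carrier Zphi"
    show "\<exists>y \<in> carrier Zphi. y \<oplus>\<^bsub>Zphi\<^esub> x = \<zero>\<^bsub>Zphi\<^esub>"
      by (rule bexI[where x = "(- fst x, - snd x)"]; cases x; simp add: Zphi_simps)
  qed (auto simp: Zphi_simps)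
  show "comm_monoid Zphi"
    by (rule comm_monoidI) (auto simp: Zphi_simps algebra_simps)
qed (auto simp: Zphi_simps algebra_simps)

lemma phi_squared: "phi \<otimes>\<^bsub>Zphi\<^esub> phi = phi \<oplus>\<^bsub>Zphi\<^esub> \<one>\<^bsub>Zphi\<^esub>"
  by (simp add: phi_def Zphi_simps)

text \<open>
  The \<open>\<int>[\<phi>]\<close>-module structure on a subgroup \<open>L\<close> of \<open>V\<close> in which \<open>\<phi>\<close> acts as \<open>f\<close>.
\<close>

definition Zphi_module ::
  "('v, 'm) ring_scheme \<Rightarrow> 'v set \<Rightarrow> ('v \<Rightarrow> 'v) \<Rightarrow> (int \<times> int, 'v) module"
  where "Zphi_module V L f = \<lparr>carrier = L,
    monoid.mult = (\<lambda>_ _. undefined),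
    monoid.one = undefined,
    ring.zero = \<zero>\<^bsub>V\<^esub>,
    add = (\<oplus>\<^bsub>V\<^esub>),
    smult = (\<lambda>(a, b) l. [a] \<cdot>\<^bsub>V\<^esub> l \<oplus>\<^bsub>V\<^esub> [b] \<cdot>\<^bsub>V\<^esub> f l)\<rparr>"


section \<open>Tensor products over a commutative ring\<close>

definition tensor_relations ::
  "('r, 'k) ring_scheme \<Rightarrow> ('r, 'a, 'm) module_scheme \<Rightarrow> ('r, 'b, 'n) module_scheme \<Rightarrow>
   ('a \<times> 'b \<Rightarrow>\<^sub>0 int) set"
  where "tensor_relations R M N =
    {frag_of (x \<oplus>\<^bsub>M\<^esub> x', y) - frag_of (x, y) - frag_of (x', y) | x x' y.
       x \<in> carrier M \<and> x' \<in> carrier M \<and> y \<in> carrier N} \<union>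
    {frag_of (x, y \<oplus>\<^bsub>N\<^esub> y') - frag_of (x, y) - frag_of (x, y') | x y y'.
       x \<in> carrier M \<and> y \<in> carrier N \<and> y' \<in> carrier N} \<union>
    {frag_of (r \<odot>\<^bsub>M\<^esub> x, y) - frag_of (x, r \<odot>\<^bsub>N\<^esub> y) | r x y.
       r \<in> carrier R \<and> x \<in> carrier M \<and> y \<in> carrier N}"

abbreviation tensor_free ::
  "('r, 'a, 'm) module_scheme \<Rightarrow> ('r, 'b, 'n) module_scheme \<Rightarrow> ('a \<times> 'b \<Rightarrow>\<^sub>0 int) monoid"
  where "tensor_free M N \<equiv> free_Abelian_group (carrier M \<times> carrier N)"

definition tensor_kernel ::
  "('r, 'k) ring_scheme \<Rightarrow> ('r, 'a, 'm) module_scheme \<Rightarrow> ('r, 'b, 'n) module_scheme \<Rightarrow>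
   ('a \<times> 'b \<Rightarrow>\<^sub>0 int) set"
  where "tensor_kernel R M N = generate (tensor_free M N) (tensor_relations R M N)"

text \<open>The quotient is a multiplicatively written group record; it is renamed to an additive one.\<close>

definition tensor ::
  "('r, 'k) ring_scheme \<Rightarrow> ('r, 'a, 'm) module_scheme \<Rightarrow> ('r, 'b, 'n) module_scheme \<Rightarrow>
   ('a \<times> 'b \<Rightarrow>\<^sub>0 int) set ring"
  where "tensor R M N =
    (let Q = tensor_free M N Mod tensor_kernel R M N in
     \<lparr>carrier = carrier Q,
      monoid.mult = (\<lambda>_ _. undefined),
      monoid.one = undefined,
      ring.zero = \<one>\<^bsub>Q\<^esub>,
      add = (\<otimes>\<^bsub>Q\<^esub>)\<rparr>)"

text \<open>
  For an \<open>R\<close>-linear \<open>h\<close>, the endomorphism \<open>h \<otimes> id\<close> of the tensor product.  The image of a coset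
  under the map on the free group lies in a single coset, and adding the kernel fills it up.
\<close>

definition tensor_map_left ::
  "('r, 'k) ring_scheme \<Rightarrow> ('r, 'a, 'm) module_scheme \<Rightarrow> ('r, 'b, 'n) module_scheme \<Rightarrow>
   ('a \<Rightarrow> 'a) \<Rightarrow> ('a \<times> 'b \<Rightarrow>\<^sub>0 int) set \<Rightarrow> ('a \<times> 'b \<Rightarrow>\<^sub>0 int) set"
  where "tensor_map_left R M N h =
    (\<lambda>X \<in> carrier (tensor R M N).
       tensor_kernel R M N <#>\<^bsub>tensor_free M N\<^esub>
         frag_extend (\<lambda>(x, y). frag_of (h x, y)) ` X)"


section \<open>Icosahedral modules\<close>

definition free3 :: "('r, 'k) ring_scheme \<Rightarrow> ('r, 'r \<times> 'r \<times> 'r) module"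
  where "free3 R = \<lparr>carrier = carrier R \<times> carrier R \<times> carrier R,
    monoid.mult = (\<lambda>_ _. undefined),
    monoid.one = undefined,
    ring.zero = (\<zero>\<^bsub>R\<^esub>, \<zero>\<^bsub>R\<^esub>, \<zero>\<^bsub>R\<^esub>),
    add = (\<lambda>(x, y, z) (x', y', z'). (x \<oplus>\<^bsub>R\<^esub> x', y \<oplus>\<^bsub>R\<^esub> y', z \<oplus>\<^bsub>R\<^esub> z')),
    smult = (\<lambda>r (x, y, z). (r \<otimes>\<^bsub>R\<^esub> x, r \<otimes>\<^bsub>R\<^esub> y, r \<otimes>\<^bsub>R\<^esub> z))\<rparr>"

abbreviation Icosa_R :: "(int \<times> int, (int \<times> int) \<times> (int \<times> int) \<times> (int \<times> int)) module"
  where "Icosa_R \<equiv> free3 Zphi"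

definition e1 :: "(int \<times> int) \<times> (int \<times> int) \<times> (int \<times> int)"
  where "e1 = (\<one>\<^bsub>Zphi\<^esub>, \<zero>\<^bsub>Zphi\<^esub>, \<zero>\<^bsub>Zphi\<^esub>)"

definition e2 :: "(int \<times> int) \<times> (int \<times> int) \<times> (int \<times> int)"
  where "e2 = (\<zero>\<^bsub>Zphi\<^esub>, \<one>\<^bsub>Zphi\<^esub>, \<zero>\<^bsub>Zphi\<^esub>)"

definition e3 :: "(int \<times> int) \<times> (int \<times> int) \<times> (int \<times> int)"
  where "e3 = (\<zero>\<^bsub>Zphi\<^esub>, \<zero>\<^bsub>Zphi\<^esub>, \<one>\<^bsub>Zphi\<^esub>)"

definition icosa_generators :: "(nat \<Rightarrow> nat) \<Rightarrow> (nat \<Rightarrow> nat) \<Rightarrow> bool"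
  where "icosa_generators \<alpha> \<gamma> \<longleftrightarrow>
    \<alpha> \<in> carrier (alt_group 5) \<and> \<gamma> \<in> carrier (alt_group 5) \<and>
    generate (alt_group 5) {\<alpha>, \<gamma>} = carrier (alt_group 5) \<and>
    group.ord (alt_group 5) \<alpha> = 2 \<and> group.ord (alt_group 5) \<gamma> = 3 \<and>
    group.ord (alt_group 5) (\<alpha> \<otimes>\<^bsub>alt_group 5\<^esub> \<gamma>) = 5"

text \<open>
  The action on \<open>Icosa(R)\<close> is prescribed on \<open>\<alpha>\<close> and \<open>\<gamma>\<close> only.  Since these generate the group,
  at most one \<open>R\<close>-linear action has the prescribed values; there is one because
  \<open>\<alpha>\<^sup>2 = \<gamma>\<^sup>3 = (\<alpha>\<gamma>)\<^sup>5 = 1\<close> is a presentation of \<open>Alt(5)\<close> and the matrices satisfy it.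
\<close>

definition is_icosa_action ::
  "(nat \<Rightarrow> nat) \<Rightarrow> (nat \<Rightarrow> nat) \<Rightarrow>
   ((nat \<Rightarrow> nat) \<Rightarrow> (int \<times> int) \<times> (int \<times> int) \<times> (int \<times> int)
      \<Rightarrow> (int \<times> int) \<times> (int \<times> int) \<times> (int \<times> int)) \<Rightarrow> bool"
  where "is_icosa_action \<alpha> \<gamma> \<rho> \<longleftrightarrow>
    \<rho> \<in> extensional (carrier (alt_group 5)) \<and>
    group_module (alt_group 5) Icosa_R \<rho> \<and>
    (\<forall>g \<in> carrier (alt_group 5). \<forall>r \<in> carrier Zphi. \<forall>x \<in> carrier Icosa_R.
       \<rho> g (r \<odot>\<^bsub>Icosa_R\<^esub> x) = r \<odot>\<^bsub>Icosa_R\<^esub> \<rho> g x) \<and>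
    \<rho> \<alpha> e1 = \<ominus>\<^bsub>Icosa_R\<^esub> e1 \<oplus>\<^bsub>Icosa_R\<^esub> phi \<odot>\<^bsub>Icosa_R\<^esub> e3 \<and>
    \<rho> \<alpha> e2 = \<ominus>\<^bsub>Icosa_R\<^esub> e2 \<oplus>\<^bsub>Icosa_R\<^esub> phi \<odot>\<^bsub>Icosa_R\<^esub> e3 \<and>
    \<rho> \<alpha> e3 = e3 \<and>
    \<rho> \<gamma> e1 = e3 \<and>
    \<rho> \<gamma> e2 = e1 \<and>
    \<rho> \<gamma> e3 = e2"

definition icosa_action ::
  "(nat \<Rightarrow> nat) \<Rightarrow> (nat \<Rightarrow> nat) \<Rightarrow> (nat \<Rightarrow> nat)
   \<Rightarrow> (int \<times> int) \<times> (int \<times> int) \<times> (int \<times> int) \<Rightarrow> (int \<times> int) \<times> (int \<times> int) \<times> (int \<times> int)"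
  where "icosa_action \<alpha> \<gamma> = (THE \<rho>. is_icosa_action \<alpha> \<gamma> \<rho>)"

definition Icosa ::
  "(int \<times> int, 'v, 'n) module_scheme
   \<Rightarrow> (((int \<times> int) \<times> (int \<times> int) \<times> (int \<times> int)) \<times> 'v \<Rightarrow>\<^sub>0 int) set ring"
  where "Icosa L = tensor Zphi Icosa_R L"

definition Icosa_act ::
  "(nat \<Rightarrow> nat) \<Rightarrow> (nat \<Rightarrow> nat) \<Rightarrow> (int \<times> int, 'v, 'n) module_scheme \<Rightarrow> (nat \<Rightarrow> nat)
   \<Rightarrow> (((int \<times> int) \<times> (int \<times> int) \<times> (int \<times> int)) \<times> 'v \<Rightarrow>\<^sub>0 int) set
   \<Rightarrow> (((int \<times> int) \<times> (int \<times> int) \<times> (int \<times> int)) \<times> 'v \<Rightarrow>\<^sub>0 int) set"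
  where "Icosa_act \<alpha> \<gamma> L g = tensor_map_left Zphi Icosa_R L (icosa_action \<alpha> \<gamma> g)"


section \<open>The \<open>\<int>[\<phi>]\<close>-module attached to an involution and a class of 5-cycles\<close>

definition phi_op ::
  "('v, 'm) ring_scheme \<Rightarrow> ((nat \<Rightarrow> nat) \<Rightarrow> 'v \<Rightarrow> 'v) \<Rightarrow> (nat \<Rightarrow> nat) set \<Rightarrow> 'v \<Rightarrow> 'v"
  where "phi_op V act C v = divide_by V 4 (finsum V (\<lambda>g. act g v) C)"

definition L_module ::
  "('v, 'm) ring_scheme \<Rightarrow> ((nat \<Rightarrow> nat) \<Rightarrow> 'v \<Rightarrow> 'v) \<Rightarrow> (nat \<Rightarrow> nat) \<Rightarrow> (nat \<Rightarrow> nat) set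
   \<Rightarrow> (int \<times> int, 'v) module"
  where "L_module V act \<alpha> C =
    Zphi_module V (trace_image (alt_group 5) V act \<alpha>) (phi_op V act C)"

end

theory Submission
  imports Defs
begin

text \<open>
  Points can be labelled \<open>i, j, k, m, n\<close> so that \<open>\<alpha> = (i m)(j n)\<close> and \<open>\<gamma> = (i j k)\<close>; every generating pair
  as in the statement has this shape.  Then \<open>\<beta> = (i j)(m n)\<close> commutes with \<open>\<alpha>\<close> and inverts \<open>\<gamma>\<close>.
  Since \<open>V\<close> is uniquely 2-divisible, \<open>L = tr\<^sub>\<alpha>(V)\<close> consists of the fixed points of \<open>\<alpha>\<close>, and the
  hypothesis on \<open>\<alpha>\<close> says that \<open>\<beta>\<close> acts on \<open>L\<close> as \<open>-1\<close>.

  Put \<open>\<psi> l = \<gamma>l + \<alpha>\<gamma>l\<close>, an endomorphism of \<open>L\<close>.  Conjugating by \<open>\<beta>\<close> turns this into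
  \<open>\<psi> l = \<gamma>\<^sup>2l + \<alpha>\<gamma>\<^sup>2l\<close>, so \<open>\<alpha>\<close> and \<open>\<gamma>\<close> act on the sums \<open>\<gamma>\<^sup>2l\<^sub>1 + \<gamma>l\<^sub>2 + l\<^sub>3\<close> by the matrices that define
  \<open>Icosa(R)\<close>, with \<open>\<psi>\<close> in place of \<open>\<phi>\<close>.  The relation \<open>(\<alpha>\<gamma>)\<^sup>5 = 1\<close>, evaluated at \<open>\<gamma>\<^sup>2l\<close>, shows
  that \<open>\<theta> = \<psi>\<^sup>2l - \<psi>l - l\<close> is fixed by \<open>\<gamma>\<close>.  As it is also fixed by \<open>\<alpha>\<close>, the whole group fixes it,
  while \<open>\<beta>\<close> inverts it; so \<open>2\<theta> = 0\<close> and \<open>\<theta> = 0\<close>, that is \<open>\<psi>\<^sup>2 = \<psi> + 1\<close> (\<open>\<psi>_squared\<close>).  The class of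
  \<open>\<alpha>\<gamma>\<close> consists of twelve short words in \<open>\<alpha>\<close> and \<open>\<gamma>\<close>, and on \<open>L\<close> they add up to \<open>4\<psi>\<close>
  (\<open>sum_over_five_cycles\<close>).  Hence \<open>\<psi>\<close> is the operator by which \<open>\<phi>\<close> is to act.

  It remains to see that \<open>(l\<^sub>1, l\<^sub>2, l\<^sub>3) \<mapsto> \<gamma>\<^sup>2l\<^sub>1 + \<gamma>l\<^sub>2 + l\<^sub>3\<close> is a bijection from \<open>L\<^sup>3\<close> to \<open>V\<close>.  Applying
  \<open>(1 + \<alpha>)\<gamma>\<close>, \<open>(1 + \<alpha>)\<gamma>\<^sup>2\<close> and \<open>1 + \<alpha>\<close> to such a sum amounts to applying the matrix with \<open>2\<close> on the
  diagonal and \<open>\<phi>\<close> elsewhere to \<open>(l\<^sub>1, l\<^sub>2, l\<^sub>3)\<close>.  Its determinant \<open>2(2 - \<phi>)\<^sup>2(1 + \<phi>)\<close> is invertible on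
  \<open>L\<close>, as \<open>(2 - \<phi>)(1 + \<phi>) = 1\<close> and \<open>L\<close> is uniquely 2-divisible.  So the map is injective (\<open>combine_eq_zero\<close>), and every \<open>v\<close> differs
  from a value of it by a vector that the three operators kill.  For such a vector \<open>(\<alpha>\<gamma>)\<^sup>5 = 1\<close>
  forces \<open>\<gamma>w = -w\<close>, and then \<open>\<gamma>\<^sup>3 = 1\<close> forces \<open>w = 0\<close> (\<open>antifixed_eq_zero\<close>, \<open>combine_surj\<close>).

  The tensor product is reached through a universal property (locale \<open>icosa_bilinear\<close>).  That the
  action on \<open>Icosa(R)\<close> exists at all is shown by embedding \<open>R\<^sup>3\<close> equivariantly into the alternating
  integer functions on pairs of points, where the action of \<open>Alt(5)\<close> is evident.
\<close>

section \<open>The generators of Alt(5) as permutations of five labelled points\<close>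

abbreviation A5 :: "(nat \<Rightarrow> nat) monoid"
  where "A5 \<equiv> alt_group 5"

lemma group_A5: "group A5"
  by (rule alt_group_is_group)

interpretation A5: group A5
  by (rule group_A5)

lemma finite_A5: "finite (carrier A5)"
  by (rule finite_subset[of _ "{p. p permutes {1..5}}"]) (auto simp: alt_group_carrier finite_permutations)

text \<open>
  The labels \<open>i, j, k\<close> are the points moved by \<open>\<gamma>\<close>, in the order of the cycle; \<open>\<alpha>\<close> joins \<open>i\<close> to \<open>m\<close> and
  \<open>j\<close> to \<open>n\<close>.  All identities between permutations below are then checked point by point.
\<close>

locale five_points =
  fixes i j k m n :: nat
  assumes distinct_points: "distinct [i, j, k, m, n]"
    and points: "{i, j, k, m, n} = {1..5}"
begin

definition alpha :: "nat \<Rightarrow> nat"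
  where "alpha = transpose i m \<circ> transpose j n"

definition gamma :: "nat \<Rightarrow> nat"
  where "gamma = transpose i j \<circ> transpose j k"

definition beta :: "nat \<Rightarrow> nat"
  where "beta = transpose i j \<circ> transpose m n"

lemma distinctness:
  "i \<noteq> j" "i \<noteq> k" "i \<noteq> m" "i \<noteq> n" "j \<noteq> k" "j \<noteq> m" "j \<noteq> n" "k \<noteq> m" "k \<noteq> n" "m \<noteq> n"
  "j \<noteq> i" "k \<noteq> i" "m \<noteq> i" "n \<noteq> i" "k \<noteq> j" "m \<noteq> j" "n \<noteq> j" "m \<noteq> k" "n \<noteq> k" "n \<noteq> m"
  using distinct_points by auto

lemma alpha_simps [simp]:
  "alpha i = m" "alpha j = n" "alpha k = k" "alpha m = i" "alpha n = j"
  "x \<notin> {i, j, k, m, n} \<Longrightarrow> alpha x = x"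
  using distinctness by (auto simp: alpha_def transpose_def)

lemma gamma_simps [simp]:
  "gamma i = j" "gamma j = k" "gamma k = i" "gamma m = m" "gamma n = n"
  "x \<notin> {i, j, k, m, n} \<Longrightarrow> gamma x = x"
  using distinctness by (auto simp: gamma_def transpose_def)

lemma beta_simps [simp]:
  "beta i = j" "beta j = i" "beta k = k" "beta m = n" "beta n = m"
  "x \<notin> {i, j, k, m, n} \<Longrightarrow> beta x = x"
  using distinctness by (auto simp: beta_def transpose_def)

lemma five_points_cases:
  obtains "x = i" | "x = j" | "x = k" | "x = m" | "x = n" | "x \<notin> {i, j, k, m, n}"
  by auto

lemma perm_eqI:
  assumes "f i = g i" "f j = g j" "f k = g k" "f m = g m" "f n = g n"
    and "\<And>x. x \<notin> {i, j, k, m, n} \<Longrightarrow> f x = g x"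
  shows "f = g"
  using assms by (metis (full_types) ext five_points_cases)

lemma two_transpositions_in_A5:
  assumes "{w, x, y, z} \<subseteq> {i, j, k, m, n}" "w \<noteq> x" "y \<noteq> z"
  shows "transpose w x \<circ> transpose y z \<in> carrier A5"
proof -
  have "transpose w x permutes {1..5}" "transpose y z permutes {1..5}"
    using assms(1) unfolding points by (auto intro!: permutes_swap_id)
  then show ?thesis
    using assms by (auto simp: alt_group_carrier permutes_compose evenperm_comp evenperm_swap permutation_swap_id)
qed

lemma alpha_closed [simp]: "alpha \<in> carrier A5"
  unfolding alpha_def by (rule two_transpositions_in_A5) (use distinctness in auto)

lemma beta_closed [simp]: "beta \<in> carrier A5"
  unfolding beta_def by (rule two_transpositions_in_A5) (use distinctness in auto)

lemma gamma_closed [simp]: "gamma \<in> carrier A5"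
  unfolding gamma_def by (rule two_transpositions_in_A5) (use distinctness in auto)

lemma alpha_squared: "alpha \<circ> alpha = id"
  by (rule perm_eqI) auto

lemma beta_squared: "beta \<circ> beta = id"
  by (rule perm_eqI) auto

lemma gamma_cubed: "gamma \<circ> (gamma \<circ> gamma) = id"
  by (rule perm_eqI) auto

lemma alpha_beta_commute: "alpha \<circ> beta = beta \<circ> alpha"
  by (rule perm_eqI) auto

lemma beta_inverts_gamma: "beta \<circ> gamma = gamma \<circ> gamma \<circ> beta"
  by (rule perm_eqI) auto

text \<open>
  This is \<open>(\<alpha>\<gamma>)\<^sup>5 = 1\<close> in the form \<open>(\<alpha>\<gamma>)\<^sup>3 = (\<alpha>\<gamma>)\<^sup>-\<^sup>2\<close>, which keeps both sides short when they are
  applied to a vector.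
\<close>

lemma alpha_gamma_relation:
  "alpha \<circ> gamma \<circ> alpha \<circ> gamma \<circ> alpha \<circ> gamma =
   gamma \<circ> gamma \<circ> alpha \<circ> gamma \<circ> gamma \<circ> alpha"
  by (rule perm_eqI) auto

lemma inv_alpha: "inv\<^bsub>A5\<^esub> alpha = alpha"
  using alpha_squared by (intro A5.inv_equality) (auto simp: alt_group_mult alt_group_one)

lemma inv_beta: "inv\<^bsub>A5\<^esub> beta = beta"
  using beta_squared by (intro A5.inv_equality) (auto simp: alt_group_mult alt_group_one)

lemma inv_gamma: "inv\<^bsub>A5\<^esub> gamma = gamma \<circ> gamma"
  using gamma_cubed A5.m_closed[OF gamma_closed gamma_closed]
  by (intro A5.inv_equality) (simp_all add: alt_group_mult alt_group_one o_assoc)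

text \<open>
  The conjugacy class of \<open>\<alpha>\<gamma>\<close>, in terms of \<open>\<alpha>\<close> and \<open>\<gamma>\<close>.  Words 1-4, 5-8 and 9-12 are the orbits under
  conjugation by the four-group \<open>{1, \<alpha>, \<beta>, \<alpha>\<beta>}\<close>; the last four are commutators of \<open>\<alpha>\<close> with \<open>\<gamma>\<close> or its inverse.
\<close>

definition five_cycle_words :: "(nat \<Rightarrow> nat) list"
  where "five_cycle_words =
   [alpha \<circ> gamma, gamma \<circ> alpha,
    alpha \<circ> gamma \<circ> gamma, gamma \<circ> gamma \<circ> alpha,
    gamma \<circ> alpha \<circ> gamma, alpha \<circ> gamma \<circ> alpha \<circ> gamma \<circ> alpha,
    gamma \<circ> gamma \<circ> alpha \<circ> gamma \<circ> gamma, alpha \<circ> gamma \<circ> gamma \<circ> alpha \<circ> gamma \<circ> gamma \<circ> alpha,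
    alpha \<circ> gamma \<circ> gamma \<circ> alpha \<circ> gamma, gamma \<circ> gamma \<circ> alpha \<circ> gamma \<circ> alpha,
    alpha \<circ> gamma \<circ> alpha \<circ> gamma \<circ> gamma, gamma \<circ> alpha \<circ> gamma \<circ> gamma \<circ> alpha]"

lemma distinct_five_cycle_words: "distinct five_cycle_words"
proof -
  \<comment> \<open>Two points would not do: the first and the sixth word agree on \<open>i\<close> and \<open>j\<close>.\<close>
  have "distinct (map (\<lambda>p. (p i, p j, p k)) five_cycle_words)"
    using distinctness by (simp add: five_cycle_words_def)
  then show ?thesis
    by (simp add: distinct_map)
qed

text \<open>
  Conjugation by \<open>\<gamma>\<close> and by \<open>\<alpha>\<close> permutes the twelve words, and the two permutations together act
  transitively on them.
\<close>

lemma gamma_conjugates: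
  "gamma \<circ> (alpha \<circ> gamma) \<circ> (gamma \<circ> gamma) = gamma \<circ> alpha"
  "gamma \<circ> (gamma \<circ> alpha) \<circ> (gamma \<circ> gamma) = gamma \<circ> gamma \<circ> alpha \<circ> gamma \<circ> gamma"
  "gamma \<circ> (gamma \<circ> gamma \<circ> alpha \<circ> gamma \<circ> gamma) \<circ> (gamma \<circ> gamma) = alpha \<circ> gamma"
  "gamma \<circ> (alpha \<circ> gamma \<circ> gamma) \<circ> (gamma \<circ> gamma) = gamma \<circ> alpha \<circ> gamma"
  "gamma \<circ> (gamma \<circ> alpha \<circ> gamma) \<circ> (gamma \<circ> gamma) = gamma \<circ> gamma \<circ> alpha"
  "gamma \<circ> (gamma \<circ> gamma \<circ> alpha) \<circ> (gamma \<circ> gamma) = alpha \<circ> gamma \<circ> gamma"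
  "gamma \<circ> (alpha \<circ> gamma \<circ> alpha \<circ> gamma \<circ> alpha) \<circ> (gamma \<circ> gamma) =
     alpha \<circ> gamma \<circ> gamma \<circ> alpha \<circ> gamma"
  "gamma \<circ> (alpha \<circ> gamma \<circ> gamma \<circ> alpha \<circ> gamma) \<circ> (gamma \<circ> gamma) =
     gamma \<circ> alpha \<circ> gamma \<circ> gamma \<circ> alpha"
  "gamma \<circ> (gamma \<circ> alpha \<circ> gamma \<circ> gamma \<circ> alpha) \<circ> (gamma \<circ> gamma) =
     alpha \<circ> gamma \<circ> alpha \<circ> gamma \<circ> alpha"
  "gamma \<circ> (alpha \<circ> gamma \<circ> gamma \<circ> alpha \<circ> gamma \<circ> gamma \<circ> alpha) \<circ> (gamma \<circ> gamma) =
     gamma \<circ> gamma \<circ> alpha \<circ> gamma \<circ> alpha"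
  "gamma \<circ> (gamma \<circ> gamma \<circ> alpha \<circ> gamma \<circ> alpha) \<circ> (gamma \<circ> gamma) =
     alpha \<circ> gamma \<circ> alpha \<circ> gamma \<circ> gamma"
  "gamma \<circ> (alpha \<circ> gamma \<circ> alpha \<circ> gamma \<circ> gamma) \<circ> (gamma \<circ> gamma) =
     alpha \<circ> gamma \<circ> gamma \<circ> alpha \<circ> gamma \<circ> gamma \<circ> alpha"
  by (rule perm_eqI; simp)+

lemma alpha_conjugates:
  "alpha \<circ> (alpha \<circ> gamma) \<circ> alpha = gamma \<circ> alpha"
  "alpha \<circ> (alpha \<circ> gamma \<circ> gamma) \<circ> alpha = gamma \<circ> gamma \<circ> alpha"
  "alpha \<circ> (gamma \<circ> alpha \<circ> gamma) \<circ> alpha = alpha \<circ> gamma \<circ> alpha \<circ> gamma \<circ> alpha"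
  "alpha \<circ> (gamma \<circ> gamma \<circ> alpha \<circ> gamma \<circ> gamma) \<circ> alpha =
     alpha \<circ> gamma \<circ> gamma \<circ> alpha \<circ> gamma \<circ> gamma \<circ> alpha"
  "alpha \<circ> (alpha \<circ> gamma \<circ> gamma \<circ> alpha \<circ> gamma) \<circ> alpha =
     gamma \<circ> gamma \<circ> alpha \<circ> gamma \<circ> alpha"
  "alpha \<circ> (alpha \<circ> gamma \<circ> alpha \<circ> gamma \<circ> gamma) \<circ> alpha =
     gamma \<circ> alpha \<circ> gamma \<circ> gamma \<circ> alpha"
  "alpha \<circ> (gamma \<circ> alpha) \<circ> alpha = alpha \<circ> gamma"
  "alpha \<circ> (gamma \<circ> gamma \<circ> alpha) \<circ> alpha = alpha \<circ> gamma \<circ> gamma"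
  "alpha \<circ> (alpha \<circ> gamma \<circ> alpha \<circ> gamma \<circ> alpha) \<circ> alpha = gamma \<circ> alpha \<circ> gamma"
  "alpha \<circ> (alpha \<circ> gamma \<circ> gamma \<circ> alpha \<circ> gamma \<circ> gamma \<circ> alpha) \<circ> alpha =
     gamma \<circ> gamma \<circ> alpha \<circ> gamma \<circ> gamma"
  "alpha \<circ> (gamma \<circ> gamma \<circ> alpha \<circ> gamma \<circ> alpha) \<circ> alpha =
     alpha \<circ> gamma \<circ> gamma \<circ> alpha \<circ> gamma"
  "alpha \<circ> (gamma \<circ> alpha \<circ> gamma \<circ> gamma \<circ> alpha) \<circ> alpha =
     alpha \<circ> gamma \<circ> alpha \<circ> gamma \<circ> gamma"
  by (rule perm_eqI; simp)+

lemma conjugates_in_words: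
  assumes "p \<in> set five_cycle_words"
  shows "gamma \<circ> p \<circ> (gamma \<circ> gamma) \<in> set five_cycle_words"
    and "alpha \<circ> p \<circ> alpha \<in> set five_cycle_words"
  using assms by (simp_all only: five_cycle_words_def list.set insert_iff empty_iff)
    (elim disjE; simp only: gamma_conjugates alpha_conjugates simp_thms)+

lemma generate_closed:
  assumes "p \<in> generate A5 {alpha, gamma}" "q \<in> generate A5 {alpha, gamma}"
  shows "p \<circ> q \<in> generate A5 {alpha, gamma}"
  using generate.eng[OF assms] by (simp add: alt_group_mult)

lemma beta_word:
  "beta = gamma \<circ> alpha \<circ> gamma \<circ> gamma \<circ> alpha \<circ> gamma \<circ> alpha \<circ> gamma \<circ> gamma \<circ> alpha \<circ> gamma \<circ> alpha"
  by (rule perm_eqI) auto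

lemma beta_in_generate: "beta \<in> generate A5 {alpha, gamma}"
proof -
  have "alpha \<in> generate A5 {alpha, gamma}" "gamma \<in> generate A5 {alpha, gamma}"
    by (auto intro: generate.incl)
  then show ?thesis
    unfolding beta_word by (intro generate_closed)
qed

lemma ord_alpha: "A5.ord alpha = 2"
proof -
  have "alpha \<noteq> id"
    using alpha_simps(1) distinctness(3) by (metis id_apply)
  then have "A5.ord alpha \<noteq> 1"
    using A5.ord_eq_1[OF alpha_closed] by (simp add: alt_group_one)
  moreover have "A5.ord alpha dvd 2"
    using alpha_squared A5.pow_eq_id[OF alpha_closed, of 2]
    by (simp add: numeral_2_eq_2 alt_group_mult alt_group_one)
  ultimately show ?thesis
    using two_is_prime_nat by (metis prime_nat_iff)
qed

lemma ord_gamma: "A5.ord gamma = 3"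
proof -
  have "gamma \<noteq> id"
    using gamma_simps(1) distinctness(1) by (metis id_apply)
  then have "A5.ord gamma \<noteq> 1"
    using A5.ord_eq_1[OF gamma_closed] by (simp add: alt_group_one)
  moreover have "A5.ord gamma dvd 3"
    using gamma_cubed A5.pow_eq_id[OF gamma_closed, of 3]
    by (simp add: numeral_3_eq_3 alt_group_mult alt_group_one o_assoc)
  moreover have "Factorial_Ring.prime (3::nat)"
    by simp
  ultimately show ?thesis
    by (metis prime_nat_iff)
qed

lemma ord_alpha_gamma: "A5.ord (alpha \<circ> gamma) = 5"
proof -
  have closed: "alpha \<circ> gamma \<in> carrier A5"
    using A5.m_closed[OF alpha_closed gamma_closed] by (simp add: alt_group_mult)
  have "(alpha \<circ> gamma) i \<noteq> i"
    using distinctness by simp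
  then have "alpha \<circ> gamma \<noteq> id"
    by (metis id_apply)
  then have "A5.ord (alpha \<circ> gamma) \<noteq> 1"
    using A5.ord_eq_1[OF closed] by (simp add: alt_group_one)
  moreover have "(alpha \<circ> gamma) \<circ> (alpha \<circ> gamma) \<circ> (alpha \<circ> gamma) \<circ> (alpha \<circ> gamma) \<circ> (alpha \<circ> gamma) = id"
    by (rule perm_eqI) auto
  then have "A5.ord (alpha \<circ> gamma) dvd 5"
    using A5.pow_eq_id[OF closed, of 5]
    by (simp add: eval_nat_numeral alt_group_mult alt_group_one o_assoc)
  moreover have "Factorial_Ring.prime (5::nat)"
    by simp
  ultimately show ?thesis
    by (metis prime_nat_iff)
qed

text \<open>
  By Lagrange's theorem: the subgroup generated by \<open>\<alpha>\<close> and \<open>\<gamma>\<close> has elements of order 3 and 5 and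
  contains the four-group \<open>{1, \<alpha>, \<beta>, \<alpha>\<beta>}\<close>, so its order is divisible by 60.
\<close>

lemma generate_alpha_gamma: "generate A5 {alpha, gamma} = carrier A5"
proof -
  let ?H = "generate A5 {alpha, gamma}"
  have subset: "?H \<subseteq> carrier A5"
    by (rule A5.generate_incl) simp
  interpret H: subgroup ?H A5
    by (rule A5.generate_is_subgroup) simp
  have H: "group (A5\<lparr>carrier := ?H\<rparr>)"
    by (rule A5.subgroup_imp_group[OF H.subgroup_axioms])
  have gens: "alpha \<in> ?H" "gamma \<in> ?H"
    by (auto intro: generate.incl)
  have card_dvd: "card S dvd card ?H" if "subgroup S A5" "S \<subseteq> ?H" for S
    using group.lagrange[OF H A5.subgroup_incl[OF that(1) H.subgroup_axioms that(2)]]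
    by (auto simp: order_def intro: dvdI[OF sym] simp: mult.commute)
  have ord_dvd: "A5.ord x dvd card ?H" if "x \<in> ?H" for x
  proof -
    have x: "x \<in> carrier A5"
      using that subset by auto
    have "generate A5 {x} \<subseteq> ?H"
      by (rule A5.generate_subgroup_incl[OF _ H.subgroup_axioms]) (use that in auto)
    from card_dvd[OF A5.generate_is_subgroup this] x show ?thesis
      using A5.generate_pow_card[OF x] by simp
  qed
  have three: "3 dvd card ?H" and five: "5 dvd card ?H"
    using ord_dvd[OF gens(2)] ord_dvd[OF generate_closed[OF gens]]
    by (simp_all add: ord_gamma ord_alpha_gamma)
  let ?K = "{id, alpha, beta, alpha \<circ> beta}"
  have K: "subgroup ?K A5"
  proof (rule A5.subgroupI)
    have rels: "beta \<circ> alpha = alpha \<circ> beta" "alpha \<circ> (alpha \<circ> f) = f" "beta \<circ> (alpha \<circ> f) = alpha \<circ> (beta \<circ> f)"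
      "beta \<circ> (beta \<circ> f) = f" for f :: "nat \<Rightarrow> nat"
      by (simp_all only: o_assoc alpha_squared beta_squared alpha_beta_commute id_o)
    have closed: "alpha \<circ> beta \<in> carrier A5"
      using A5.m_closed[OF alpha_closed beta_closed] by (simp add: alt_group_mult)
    show "?K \<subseteq> carrier A5"
      using closed A5.one_closed by (simp add: alt_group_one)
    show mult: "p \<otimes>\<^bsub>A5\<^esub> q \<in> ?K" if "p \<in> ?K" "q \<in> ?K" for p q
      using that by (simp only: alt_group_mult insert_iff empty_iff)
        (elim disjE; simp add: rels alpha_squared beta_squared comp_assoc)
    show "inv\<^bsub>A5\<^esub> p \<in> ?K" if "p \<in> ?K" for p
    proof -
      have "p \<circ> p = id"
        using that by (simp only: insert_iff empty_iff)
          (elim disjE; simp add: rels alpha_squared beta_squared comp_assoc)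
      then have "inv\<^bsub>A5\<^esub> p = p"
        using that \<open>?K \<subseteq> carrier A5\<close>
        by (intro A5.inv_equality) (auto simp: alt_group_mult alt_group_one)
      then show ?thesis
        using that by simp
    qed
  qed auto
  have "distinct (map (\<lambda>p. (p i, p j)) [id, alpha, beta, alpha \<circ> beta])"
    using distinctness by simp
  then have "distinct [id, alpha, beta, alpha \<circ> beta]"
    unfolding distinct_map by blast
  from distinct_card[OF this] have "card ?K = 4"
    by (simp only: list.set list.size)
  moreover have "?K \<subseteq> ?H"
    using gens beta_in_generate generate_closed[OF gens(1) beta_in_generate]
      generate.one[of A5 "{alpha, gamma}"] by (simp add: alt_group_one)
  ultimately have four: "4 dvd card ?H"
    using card_dvd[OF K] by simp
  have "60 dvd card ?H"
    using three four five by presburger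
  moreover have card_A5: "card (carrier A5) = 60"
    using alt_group_card_carrier[of 5] by (simp add: fact_numeral)
  moreover have "card ?H > 0"
    using finite_subset[OF subset finite_A5] gens(1) by (auto simp: card_gt_0_iff)
  ultimately have "card ?H \<ge> card (carrier A5)"
    by (simp add: dvd_imp_le)
  then show ?thesis
    using card_seteq[OF finite_A5 subset] by simp
qed

lemma icosa_generators_alpha_gamma: "icosa_generators alpha gamma"
  using generate_alpha_gamma ord_alpha ord_gamma ord_alpha_gamma
  by (simp add: icosa_generators_def alt_group_mult)

text \<open>
  Since \<open>\<alpha>\<close> and \<open>\<gamma>\<close> have finite order, every element is a product of them without inverses.
\<close>

lemma A5_induct [consumes 1, case_names id alpha gamma]:
  assumes "h \<in> carrier A5"
    and "P id"
    and alpha: "\<And>p. \<lbrakk>p \<in> carrier A5; P p\<rbrakk> \<Longrightarrow> P (alpha \<circ> p)"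
    and gamma: "\<And>p. \<lbrakk>p \<in> carrier A5; P p\<rbrakk> \<Longrightarrow> P (gamma \<circ> p)"
  shows "P h"
proof -
  have closed: "p \<circ> q \<in> carrier A5" if "p \<in> carrier A5" "q \<in> carrier A5" for p q
    using A5.m_closed[OF that] by (simp add: alt_group_mult)
  have "h \<in> generate A5 {alpha, gamma}"
    using assms(1) generate_alpha_gamma by simp
  then have "h \<in> carrier A5 \<and> (\<forall>p \<in> carrier A5. P p \<longrightarrow> P (h \<circ> p))"
  proof induction
    case one
    then show ?case
      using A5.one_closed unfolding alt_group_one id_o by blast
  next
    case (incl h)
    then show ?case
      using alpha gamma alpha_closed gamma_closed by blast
  next
    case (inv h)
    have "P (gamma \<circ> (gamma \<circ> p))" if "p \<in> carrier A5" "P p" for p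
      using that gamma closed by auto
    moreover have "gamma \<circ> gamma \<in> carrier A5"
      using closed by auto
    ultimately have "\<forall>p \<in> carrier A5. P p \<longrightarrow> P (gamma \<circ> gamma \<circ> p)"
      unfolding comp_assoc by blast
    then show ?case
      using inv alpha alpha_closed \<open>gamma \<circ> gamma \<in> carrier A5\<close>
      by (elim insertE emptyE) (simp_all only: inv_alpha inv_gamma, blast+)
  next
    case (eng h1 h2)
    then show ?case
      unfolding alt_group_mult comp_assoc using closed by blast
  qed
  then have "P (h \<circ> id)"
    using A5.one_closed \<open>P id\<close> by (metis alt_group_one)
  then show ?thesis
    by simp
qed

text \<open>
  The twelve words are closed under conjugation by the generators, hence under conjugation by the
  whole group; conversely, repeated conjugation of \<open>\<alpha>\<gamma>\<close> by the generators reaches all of them.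
\<close>

lemma conjugacy_class_alpha_gamma:
  "conjugacy_class A5 (alpha \<circ> gamma) = set five_cycle_words"
proof
  let ?C = "conjugacy_class A5 (alpha \<circ> gamma)"
  have in_carrier: "alpha \<circ> gamma \<in> carrier A5"
    using A5.m_closed[OF alpha_closed gamma_closed] by (simp add: alt_group_mult)
  have conj_step: "h \<otimes>\<^bsub>A5\<^esub> p \<otimes>\<^bsub>A5\<^esub> inv\<^bsub>A5\<^esub> h \<in> ?C" if "h \<in> carrier A5" "p \<in> ?C" for h p
  proof -
    from that(2) obtain g where g: "g \<in> carrier A5" "p = g \<otimes>\<^bsub>A5\<^esub> (alpha \<circ> gamma) \<otimes>\<^bsub>A5\<^esub> inv\<^bsub>A5\<^esub> g"
      by (auto simp: conjugacy_class_def)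
    then have "h \<otimes>\<^bsub>A5\<^esub> p \<otimes>\<^bsub>A5\<^esub> inv\<^bsub>A5\<^esub> h =
        (h \<otimes>\<^bsub>A5\<^esub> g) \<otimes>\<^bsub>A5\<^esub> (alpha \<circ> gamma) \<otimes>\<^bsub>A5\<^esub> inv\<^bsub>A5\<^esub> (h \<otimes>\<^bsub>A5\<^esub> g)"
      using that in_carrier by (simp add: A5.inv_mult_group A5.m_assoc)
    then show ?thesis
      using that g A5.m_closed by (auto simp: conjugacy_class_def)
  qed
  have alpha_step: "alpha \<circ> p \<circ> alpha \<in> ?C" if "p \<in> ?C" for p
    using conj_step[OF alpha_closed that] by (simp add: inv_alpha alt_group_mult)
  have gamma_step: "gamma \<circ> p \<circ> (gamma \<circ> gamma) \<in> ?C" if "p \<in> ?C" for p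
    using conj_step[OF gamma_closed that] by (simp add: inv_gamma alt_group_mult)
  have 1: "alpha \<circ> gamma \<in> ?C"
    unfolding conjugacy_class_def using A5.one_closed in_carrier
    by (intro CollectI exI[of _ "\<one>\<^bsub>A5\<^esub>"]) simp
  have 2: "gamma \<circ> alpha \<in> ?C"
    using gamma_step[OF 1] by (simp only: gamma_conjugates)
  have 3: "gamma \<circ> gamma \<circ> alpha \<circ> gamma \<circ> gamma \<in> ?C"
    using gamma_step[OF 2] by (simp only: gamma_conjugates)
  have 4: "alpha \<circ> gamma \<circ> gamma \<circ> alpha \<circ> gamma \<circ> gamma \<circ> alpha \<in> ?C"
    using alpha_step[OF 3] by (simp only: alpha_conjugates)
  have 5: "gamma \<circ> gamma \<circ> alpha \<circ> gamma \<circ> alpha \<in> ?C"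
    using gamma_step[OF 4] by (simp only: gamma_conjugates)
  have 6: "alpha \<circ> gamma \<circ> alpha \<circ> gamma \<circ> gamma \<in> ?C"
    using gamma_step[OF 5] by (simp only: gamma_conjugates)
  have 7: "alpha \<circ> gamma \<circ> gamma \<circ> alpha \<circ> gamma \<in> ?C"
    using alpha_step[OF 5] by (simp only: alpha_conjugates)
  have 8: "gamma \<circ> alpha \<circ> gamma \<circ> gamma \<circ> alpha \<in> ?C"
    using gamma_step[OF 7] by (simp only: gamma_conjugates)
  have 9: "alpha \<circ> gamma \<circ> alpha \<circ> gamma \<circ> alpha \<in> ?C"
    using gamma_step[OF 8] by (simp only: gamma_conjugates)
  have 10: "gamma \<circ> alpha \<circ> gamma \<in> ?C"
    using alpha_step[OF 9] by (simp only: alpha_conjugates)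
  have 11: "gamma \<circ> gamma \<circ> alpha \<in> ?C"
    using gamma_step[OF 10] by (simp only: gamma_conjugates)
  have 12: "alpha \<circ> gamma \<circ> gamma \<in> ?C"
    using gamma_step[OF 11] by (simp only: gamma_conjugates)
  show "set five_cycle_words \<subseteq> ?C"
    using 1 2 3 4 5 6 7 8 9 10 11 12 by (simp add: five_cycle_words_def)
  show "?C \<subseteq> set five_cycle_words"
  proof
    fix p assume "p \<in> ?C"
    then obtain h where h: "h \<in> carrier A5" "p = h \<otimes>\<^bsub>A5\<^esub> (alpha \<circ> gamma) \<otimes>\<^bsub>A5\<^esub> inv\<^bsub>A5\<^esub> h"
      by (auto simp: conjugacy_class_def)
    from h(1) have "h \<otimes>\<^bsub>A5\<^esub> (alpha \<circ> gamma) \<otimes>\<^bsub>A5\<^esub> inv\<^bsub>A5\<^esub> h \<in> set five_cycle_words"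
    proof (induction rule: A5_induct)
      case id
      show ?case
        using A5.inv_one
        by (simp only: alt_group_one alt_group_mult id_o o_id five_cycle_words_def list.set insert_iff simp_thms)
    next
      case (alpha h)
      have "(alpha \<otimes>\<^bsub>A5\<^esub> h) \<otimes>\<^bsub>A5\<^esub> (alpha \<circ> gamma) \<otimes>\<^bsub>A5\<^esub> inv\<^bsub>A5\<^esub> (alpha \<otimes>\<^bsub>A5\<^esub> h) =
          alpha \<otimes>\<^bsub>A5\<^esub> (h \<otimes>\<^bsub>A5\<^esub> (alpha \<circ> gamma) \<otimes>\<^bsub>A5\<^esub> inv\<^bsub>A5\<^esub> h) \<otimes>\<^bsub>A5\<^esub> inv\<^bsub>A5\<^esub> alpha"
        using alpha(1) in_carrier by (simp add: A5.inv_mult_group A5.m_assoc)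
      then show ?case
        using conjugates_in_words(2)[OF alpha(2)] by (simp only: inv_alpha alt_group_mult)
    next
      case (gamma h)
      have "(gamma \<otimes>\<^bsub>A5\<^esub> h) \<otimes>\<^bsub>A5\<^esub> (alpha \<circ> gamma) \<otimes>\<^bsub>A5\<^esub> inv\<^bsub>A5\<^esub> (gamma \<otimes>\<^bsub>A5\<^esub> h) =
          gamma \<otimes>\<^bsub>A5\<^esub> (h \<otimes>\<^bsub>A5\<^esub> (alpha \<circ> gamma) \<otimes>\<^bsub>A5\<^esub> inv\<^bsub>A5\<^esub> h) \<otimes>\<^bsub>A5\<^esub> inv\<^bsub>A5\<^esub> gamma"
        using gamma(1) in_carrier by (simp add: A5.inv_mult_group A5.m_assoc)
      then show ?case
        using conjugates_in_words(1)[OF gamma(2)] by (simp only: inv_gamma alt_group_mult)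
    qed
    then show "p \<in> set five_cycle_words"
      using h by simp
  qed
qed

end

section \<open>Labelling arbitrary generators\<close>

lemma A5_permutes: "p \<in> carrier A5 \<Longrightarrow> p permutes {1..5}"
  by (simp add: alt_group_carrier)

lemma A5_transitive:
  assumes "x \<in> {1..5}" "y \<in> {1..5}"
  obtains p where "p \<in> carrier A5" "p x = y"
proof (cases "x = y")
  case True
  then show ?thesis
    using that[of id] A5.one_closed by (simp add: alt_group_one)
next
  case False
  have "card ({1..5} - {x, y}) = 3"
    using assms False by (simp add: card_Diff_subset)
  then have "{1..5} - {x, y} \<noteq> {}"
    by (metis card.empty zero_neq_numeral)
  then obtain z where z: "z \<in> {1..5} - {x, y}"
    by blast
  have "transpose x y permutes {1..5}" "transpose y z permutes {1..5}"
    using assms z by (auto intro!: permutes_swap_id)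
  then have "transpose x y \<circ> transpose y z \<in> carrier A5"
    using False z by (auto simp: alt_group_carrier permutes_compose evenperm_comp evenperm_swap permutation_swap_id)
  then show ?thesis
    using that[of "transpose x y \<circ> transpose y z"] False z by (auto simp: transpose_def)
qed

text \<open>
  Because \<open>Alt(5)\<close> is transitive on the five points.
\<close>

lemma no_proper_invariant_subset:
  assumes gen: "generate A5 {a, c} = carrier A5"
    and S: "S \<subseteq> {1..5}" "x \<in> S"
    and inv: "a ` S \<subseteq> S" "c ` S \<subseteq> S"
  shows "S = {1..5}"
proof -
  have "{a, c} \<subseteq> carrier A5"
    using gen generate.incl by (metis subsetI)
  have "p ` S \<subseteq> S" if "p \<in> generate A5 {a, c}" for p
    using that
  proof induction
    case one
    then show ?case
      by (simp add: alt_group_one)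
  next
    case (incl h)
    then show ?case
      using inv by auto
  next
    case (inv h)
    then have h: "h \<in> carrier A5" "h ` S \<subseteq> S"
      using assms \<open>{a, c} \<subseteq> carrier A5\<close> by auto
    have "inj h"
      using A5_permutes[OF h(1)] by (rule permutes_inj)
    then have "h ` S = S"
      using h(2) S(1) finite_subset by (metis endo_inj_surj finite_atLeastAtMost inj_on_subset subset_UNIV)
    then have "inv' h ` S = S"
      using \<open>inj h\<close> by (metis image_inv_f_f)
    then show ?case
      using alt_group_inv_equality[OF h(1)] by simp
  next
    case (eng h1 h2)
    then show ?case
      by (auto simp: alt_group_mult)
  qed
  then have invariant: "p ` S \<subseteq> S" if "p \<in> carrier A5" for p
    using that gen by simp
  have "y \<in> S" if y: "y \<in> {1..5}" for y
  proof -
    obtain p where "p \<in> carrier A5" "p x = y"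
      using A5_transitive[of x y] y S by blast
    then show ?thesis
      using invariant S(2) by blast
  qed
  then show ?thesis
    using S(1) by blast
qed

text \<open>
  An element \<open>\<gamma>\<close> of order 3 is a 3-cycle \<open>(p q r)\<close> with two fixed points \<open>s, t\<close>.  By transitivity the
  involution can fix neither of them nor interchange them, so it sends them to different points of
  the cycle.  These two are adjacent in the cyclic order, and the names can be chosen accordingly.
\<close>

lemma icosa_generators_labels:
  assumes "icosa_generators a c"
  obtains i j k m n where "five_points i j k m n"
    "a = five_points.alpha i j m n" "c = five_points.gamma i j k"
proof -
  have a: "a \<in> carrier A5" and c: "c \<in> carrier A5"
    and gen: "generate A5 {a, c} = carrier A5"
    and ord: "A5.ord a = 2" "A5.ord c = 3"
    using assms by (auto simp: icosa_generators_def)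
  have "a \<circ> a = id"
    using A5.pow_ord_eq_1[OF a] ord by (simp add: numeral_2_eq_2 alt_group_mult alt_group_one)
  then have aa: "a (a x) = x" for x
    by (simp add: fun_eq_iff)
  have "c \<circ> c \<circ> c = id"
    using A5.pow_ord_eq_1[OF c] ord by (simp add: numeral_3_eq_3 alt_group_mult alt_group_one)
  then have ccc: "c (c (c x)) = x" for x
    by (simp add: fun_eq_iff)
  have "c \<noteq> id"
    using ord A5.ord_eq_1[OF c] by (auto simp: alt_group_one)
  then obtain p where p: "c p \<noteq> p"
    by (auto simp: fun_eq_iff)
  note perms = A5_permutes[OF a] A5_permutes[OF c]
  define q where "q = c p"
  define r where "r = c q"
  have cyc: "c p = q" "c q = r" "c r = p"
    using ccc by (auto simp: q_def r_def)
  have dist: "p \<noteq> q" "q \<noteq> r" "p \<noteq> r"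
    using p cyc ccc[of p] by auto
  have "p \<in> {1..5}"
    using p permutes_not_in[OF perms(2), of p] by auto
  then have pqr: "{p, q, r} \<subseteq> {1..5}"
    using perms(2) by (auto simp: q_def r_def permutes_in_image simp del: atLeastAtMost_iff)
  then have "card ({1..5} - {p, q, r}) = 2"
    using dist by (subst card_Diff_subset) auto
  then obtain s t where st: "{1..5} - {p, q, r} = {s, t}" "s \<noteq> t"
    by (auto simp: card_2_iff)
  have all: "{p, q, r, s, t} = {1..5}"
    using st pqr by blast
  have dist': "s \<notin> {p, q, r}" "t \<notin> {p, q, r}"
    using st by auto
  have c_inj: "x = y" if "c x = c y" for x y
    using that ccc by metis
  have c_st: "c x \<in> {s, t}" if "x \<in> {s, t}" for x
  proof -
    have "c x \<in> {1..5}"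
      using that st(1) permutes_in_image[OF perms(2)] by blast
    moreover have "c x \<notin> {p, q, r}"
      using that dist' cyc c_inj[of x r] c_inj[of x p] c_inj[of x q] by auto
    ultimately show ?thesis
      using st by blast
  qed
  have fixed: "c s = s" "c t = t"
    using c_st[of s] c_st[of t] ccc[of s] ccc[of t] st(2) by auto
  have st_in: "s \<in> {1..5}" "t \<in> {1..5}"
    using st(1) by blast+
  have small: "S \<noteq> {1..5}" if "card S \<le> 2" for S :: "nat set"
    using that by auto
  have "a s \<noteq> s"
  proof
    assume "a s = s"
    with no_proper_invariant_subset[OF gen, of "{s}" s] fixed(1) st_in have "{s} = {1..5}"
      by simp
    moreover have "{s} \<noteq> {1..5}"
      by (rule small) simp
    ultimately show False
      by blast
  qed
  moreover have "a t \<noteq> t"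
  proof
    assume "a t = t"
    with no_proper_invariant_subset[OF gen, of "{t}" t] fixed(2) st_in have "{t} = {1..5}"
      by simp
    moreover have "{t} \<noteq> {1..5}"
      by (rule small) simp
    ultimately show False
      by blast
  qed
  moreover have "a s \<noteq> t"
  proof
    assume "a s = t"
    then have "a t = s"
      using aa[of s] by simp
    with \<open>a s = t\<close> no_proper_invariant_subset[OF gen, of "{s, t}" s] fixed st_in have "{s, t} = {1..5}"
      by simp
    moreover have "{s, t} \<noteq> {1..5}"
      by (rule small) (simp add: card_insert_if)
    ultimately show False
      by blast
  qed
  moreover have "a s \<in> {p, q, r, s, t}" "a t \<in> {p, q, r, s, t}"
    unfolding all using permutes_in_image[OF perms(1)] st_in by blast+
  moreover have "a t \<noteq> s"
    using aa[of t] \<open>a s \<noteq> t\<close> by metis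
  moreover have "a s \<noteq> a t"
    using aa st(2) by metis
  ultimately have st': "a s \<in> {p, q, r}" "a t \<in> {p, q, r}" "a s \<noteq> a t"
    by blast+
  note conclude = that
  have label: thesis
    if d: "distinct [i, j, k, m, n]" "{i, j, k, m, n} = {1..5}"
      and *: "c i = j" "c j = k" "c k = i" "c m = m" "c n = n" "a m = i" "a n = j" for i j k m n
  proof (rule conclude)
    show five: "five_points i j k m n"
      using d by unfold_locales
    interpret five_points i j k m n
      by (fact five)
    have out: "a x = x" "c x = x" if "x \<notin> {i, j, k, m, n}" for x
      using that perms points by (auto simp: permutes_not_in)
    have ai: "a i = m" and aj: "a j = n"
      using aa[of m] aa[of n] by (simp_all add: *)
    moreover have "a k \<in> {i, j, k, m, n}"
      unfolding points using permutes_in_image[OF perms(1), of k] points by blast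
    then have "a k = k"
      using *(6,7) ai aj aa[of k] distinctness by (metis insertE singletonD)
    ultimately show "a = alpha"
      using * out by (intro perm_eqI) auto
    show "c = gamma"
      using * out by (intro perm_eqI) auto
  qed
  have sets: "{p, q, r, s, t} = {1..5}" "{q, r, p, s, t} = {1..5}" "{r, p, q, s, t} = {1..5}"
    "{p, q, r, t, s} = {1..5}" "{q, r, p, t, s} = {1..5}" "{r, p, q, t, s} = {1..5}"
    using all by (simp_all only: insert_commute)
  have dists: "distinct [p, q, r, s, t]" "distinct [q, r, p, s, t]" "distinct [r, p, q, s, t]"
    "distinct [p, q, r, t, s]" "distinct [q, r, p, t, s]" "distinct [r, p, q, t, s]"
    using dist dist' st(2) by auto
  consider "a s = p" "a t = q" | "a s = q" "a t = r" | "a s = r" "a t = p"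
    | "a s = q" "a t = p" | "a s = r" "a t = q" | "a s = p" "a t = r"
    using st' by auto
  then show thesis
  proof cases
    case 1
    then show thesis
      by (intro label[of p q r s t] dists sets cyc fixed)
  next
    case 2
    then show thesis
      by (intro label[of q r p s t] dists sets cyc fixed)
  next
    case 3
    then show thesis
      by (intro label[of r p q s t] dists sets cyc fixed)
  next
    case 4
    then show thesis
      by (intro label[of p q r t s] dists sets cyc fixed)
  next
    case 5
    then show thesis
      by (intro label[of q r p t s] dists sets cyc fixed)
  next
    case 6
    then show thesis
      by (intro label[of r p q t s] dists sets cyc fixed)
  qed
qed

text \<open>
  An even permutation of order 2 moves a second pair of points besides \<open>i\<close> and its image, and by
  counting it fixes the remaining one.
\<close>

lemma involution_labels:
  assumes a: "a \<in> carrier A5" and ord: "A5.ord a = 2"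
  obtains i j k m n where "five_points i j k m n" "a = five_points.alpha i j m n"
proof -
  have "a \<circ> a = id"
    using A5.pow_ord_eq_1[OF a] ord by (simp add: numeral_2_eq_2 alt_group_mult alt_group_one)
  then have aa: "a (a x) = x" for x
    by (simp add: fun_eq_iff)
  have "a \<noteq> id"
    using ord A5.ord_eq_1[OF a] by (auto simp: alt_group_one)
  then obtain i where i: "a i \<noteq> i"
    by (auto simp: fun_eq_iff)
  have perm: "a permutes {1..5}" and even: "evenperm a"
    using a by (auto simp: alt_group_carrier)
  have "a \<noteq> transpose i (a i)"
    using even i evenperm_swap by metis
  then obtain j where "a j \<noteq> transpose i (a i) j"
    by blast
  then have j: "j \<noteq> i" "j \<noteq> a i" "a j \<noteq> j"
    using aa by (auto simp: transpose_def split: if_splits)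
  have four: "{i, j, a i, a j} \<subseteq> {1..5}"
  proof -
    have "i \<in> {1..5}" "j \<in> {1..5}"
      using i j permutes_not_in[OF perm, of i] permutes_not_in[OF perm, of j] by auto
    then show ?thesis
      using permutes_in_image[OF perm] by blast
  qed
  have d4: "a i \<noteq> a j" "i \<noteq> a j"
    using i j aa[of i] aa[of j] by auto
  then have "card ({1..5} - {i, j, a i, a j}) = 1"
    using four i j by (subst card_Diff_subset) auto
  then obtain k where k: "{1..5} - {i, j, a i, a j} = {k}"
    by (auto simp: card_1_singleton_iff)
  have all: "{i, j, k, a i, a j} = {1..5}" and "i \<noteq> k" "j \<noteq> k" "k \<noteq> a i" "k \<noteq> a j"
    using k four by blast+
  show thesis
  proof (rule that)
    show five: "five_points i j k (a i) (a j)"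
      using all \<open>i \<noteq> k\<close> \<open>j \<noteq> k\<close> \<open>k \<noteq> a i\<close> \<open>k \<noteq> a j\<close> i j d4 by unfold_locales simp_all
    interpret five_points i j k "a i" "a j"
      by (fact five)
    have out: "a x = x" if "x \<notin> {i, j, k, a i, a j}" for x
      using that perm points by (auto simp: permutes_not_in)
    have "a k \<in> {i, j, k, a i, a j}"
      unfolding points using permutes_in_image[OF perm, of k] points by blast
    then have "a k = k"
      using aa[of i] aa[of j] aa[of k] distinctness by auto
    show "a = alpha"
    proof (rule perm_eqI)
      show "a x = alpha x" if "x \<notin> {i, j, k, a i, a j}" for x
        using out[OF that] alpha_simps(6)[OF that] by (rule trans[OF _ sym])
    qed (simp_all add: aa \<open>a k = k\<close>)
  qed
qed

lemma (in group) conjugacy_class_eq: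
  assumes "c \<in> carrier G" "x \<in> conjugacy_class G c"
  shows "conjugacy_class G x = conjugacy_class G c"
proof -
  obtain h where h: "h \<in> carrier G" "x = h \<otimes> c \<otimes> inv h"
    using assms(2) by (auto simp: conjugacy_class_def)
  have cancel: "inv h \<otimes> (h \<otimes> y) = y" if "y \<in> carrier G" for y
    using that h(1) by (simp add: m_assoc[symmetric])
  have "g \<otimes> x \<otimes> inv g = (g \<otimes> h) \<otimes> c \<otimes> inv (g \<otimes> h)" if "g \<in> carrier G" for g
    using that h assms(1) by (simp add: inv_mult_group m_assoc)
  then have "conjugacy_class G x \<subseteq> conjugacy_class G c"
    using h(1) m_closed unfolding conjugacy_class_def by blast
  moreover have "g \<otimes> c \<otimes> inv g = (g \<otimes> inv h) \<otimes> x \<otimes> inv (g \<otimes> inv h)" if "g \<in> carrier G" for g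
    using that h assms(1) by (simp add: inv_mult_group m_assoc cancel)
  then have "conjugacy_class G c \<subseteq> conjugacy_class G x"
    using h(1) m_closed inv_closed unfolding conjugacy_class_def by blast
  ultimately show ?thesis
    by blast
qed

context five_points begin

lemma alpha_gamma_cycle: "alpha \<circ> gamma = cycle_of_list [i, n, j, k, m]"
  by (rule perm_eqI) (use distinctness in \<open>auto simp: transpose_def\<close>)

lemma exists_relabelling:
  assumes "distinct [v, w, x, y, z]" "{v, w, x, y, z} = {1..5}"
  obtains \<sigma> where "\<sigma> permutes {1..5}" "map \<sigma> [i, n, j, k, m] = [v, w, x, y, z]"
proof -
  define \<sigma> where "\<sigma> = (\<lambda>u. if u = i then v else if u = n then w else if u = j then x
    else if u = k then y else if u = m then z else u)"
  have map: "map \<sigma> [i, n, j, k, m] = [v, w, x, y, z]"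
    using distinctness by (simp add: \<sigma>_def)
  have image: "\<sigma> ` {1..5} = {1..5}"
    using map assms(2) unfolding points[symmetric] by auto
  moreover have "\<sigma> u = u" if "u \<notin> {1..5}" for u
    using that unfolding points[symmetric] by (simp add: \<sigma>_def)
  moreover have "inj_on \<sigma> {1..5}"
    by (rule eq_card_imp_inj_on) (simp_all only: image finite_atLeastAtMost)
  ultimately have "\<sigma> permutes {1..5}"
    by (intro bij_imp_permutes bij_betw_imageI image)
  then show thesis
    using map by (rule that)
qed

text \<open>
  The labellings \<open>i, j, k, m, n\<close> and \<open>i, n, k, m, j\<close> give the same \<open>\<alpha>\<close>, but the two products \<open>\<alpha>\<gamma>\<close> are
  conjugate to each other by the odd permutation \<open>(j n)\<close>.  Any 5-cycle is conjugate in \<open>Sym(5)\<close> to the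
  first product; if the conjugating permutation is odd, composing it with \<open>(j n)\<close> makes it even and
  replaces the first product by the second.
\<close>

lemma five_cycle_class_cases:
  assumes "five_cycle_class C"
  shows "alpha \<circ> gamma \<in> C \<or> alpha \<circ> five_points.gamma i n k \<in> C"
proof -
  interpret other: five_points i n k m j
    using distinctness points by unfold_locales auto
  obtain cs where cs: "C = conjugacy_class A5 (cycle_of_list cs)" "distinct cs" "length cs = 5"
      "set cs \<subseteq> {1..5}"
    using assms by (auto simp: five_cycle_class_def five_cycles_def)
  have set_cs: "set cs = {1..5}"
    using cs distinct_card[OF cs(2)] by (intro card_subset_eq) auto
  obtain v w x y z where vw: "cs = [v, w, x, y, z]"
    using cs(3) by (auto simp: length_Suc_conv eval_nat_numeral)
  obtain \<sigma> where \<sigma>: "\<sigma> permutes {1..5}" "map \<sigma> [i, n, j, k, m] = [v, w, x, y, z]"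
    using exists_relabelling[of v w x y z] cs(2) set_cs vw by auto
  have in_class: "p \<in> C" if \<tau>: "\<tau> \<in> carrier A5" "\<tau> \<circ> p \<circ> inv' \<tau> = cycle_of_list cs" for \<tau> p
  proof -
    note bij = permutes_bij[OF A5_permutes[OF \<tau>(1)]]
    have inv_eq: "inv\<^bsub>A5\<^esub> \<tau> = inv' \<tau>"
      by (rule alt_group_inv_equality[OF \<tau>(1)])
    have "inv' \<tau> \<circ> (\<tau> \<circ> p \<circ> inv' \<tau>) \<circ> \<tau> = p"
      using bij by (auto simp: fun_eq_iff bij_is_inj)
    then show ?thesis
      unfolding cs(1) conjugacy_class_def
      using A5.inv_closed[OF \<tau>(1)] A5.inv_inv[OF \<tau>(1)] \<tau>(2)
      by (intro CollectI exI[of _ "inv\<^bsub>A5\<^esub> \<tau>"]) (simp add: inv_eq alt_group_mult)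
  qed
  show ?thesis
  proof (cases "evenperm \<sigma>")
    case True
    have "\<sigma> \<circ> (alpha \<circ> gamma) \<circ> inv' \<sigma> = cycle_of_list cs"
      unfolding alpha_gamma_cycle vw \<sigma>(2)[symmetric]
      by (rule conjugation_of_cycle) (use distinctness permutes_bij[OF \<sigma>(1)] in auto)
    then show ?thesis
      using in_class[of \<sigma>] True \<sigma>(1) by (simp add: alt_group_carrier)
  next
    case False
    define \<tau> where "\<tau> = \<sigma> \<circ> transpose n j"
    have swap: "transpose n j permutes {1..5}"
      using points by (intro permutes_swap_id) auto
    have \<tau>: "\<tau> permutes {1..5}"
      unfolding \<tau>_def by (rule permutes_compose[OF swap \<sigma>(1)])
    have "evenperm \<tau>"
      using False distinctness permutes_imp_permutation[OF _ \<sigma>(1)]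
      by (simp add: \<tau>_def evenperm_comp evenperm_swap permutation_swap_id)
    moreover have "map \<tau> [i, j, n, k, m] = [v, w, x, y, z]"
      using \<sigma>(2) distinctness by (simp add: \<tau>_def)
    then have "\<tau> \<circ> (other.alpha \<circ> other.gamma) \<circ> inv' \<tau> = cycle_of_list cs"
      unfolding other.alpha_gamma_cycle vw
      using conjugation_of_cycle[of "[i, j, n, k, m]" \<tau>] distinctness permutes_bij[OF \<tau>] by auto
    moreover have "other.alpha = alpha"
      by (simp add: alpha_def other.alpha_def transpose_commute)
    ultimately show ?thesis
      using in_class[of \<tau>] \<tau> by (simp add: alt_group_carrier)
  qed
qed

end

section \<open>The icosahedral representation over \<open>\<int>[\<phi>]\<close>\<close>

type_synonym icosa_vec = "(int \<times> int) \<times> (int \<times> int) \<times> (int \<times> int)"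

lemma Icosa_R_simps:
  "carrier Icosa_R = UNIV"
  "((p1, q1), (p2, q2), (p3, q3)) \<oplus>\<^bsub>Icosa_R\<^esub> ((p1', q1'), (p2', q2'), (p3', q3')) =
   ((p1 + p1', q1 + q1'), (p2 + p2', q2 + q2'), (p3 + p3', q3 + q3'))"
  "r \<odot>\<^bsub>Icosa_R\<^esub> (x, y, z) = (r \<otimes>\<^bsub>Zphi\<^esub> x, r \<otimes>\<^bsub>Zphi\<^esub> y, r \<otimes>\<^bsub>Zphi\<^esub> z)"
  "\<zero>\<^bsub>Icosa_R\<^esub> = ((0, 0), (0, 0), (0, 0))"
  by (simp_all add: free3_def Zphi_simps)

lemma icosa_vec_cases:
  obtains p1 q1 p2 q2 p3 q3 where "v = ((p1, q1), (p2, q2), (p3, q3) :: int \<times> int)"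
  by (metis surj_pair)

lemma abelian_group_Icosa_R: "abelian_group Icosa_R"
proof (rule abelian_groupI)
  fix u v w :: icosa_vec
  show "u \<oplus>\<^bsub>Icosa_R\<^esub> v \<oplus>\<^bsub>Icosa_R\<^esub> w = u \<oplus>\<^bsub>Icosa_R\<^esub> (v \<oplus>\<^bsub>Icosa_R\<^esub> w)"
    by (cases u rule: icosa_vec_cases; cases v rule: icosa_vec_cases; cases w rule: icosa_vec_cases)
      (simp add: Icosa_R_simps)
  show "u \<oplus>\<^bsub>Icosa_R\<^esub> v = v \<oplus>\<^bsub>Icosa_R\<^esub> u"
    by (cases u rule: icosa_vec_cases; cases v rule: icosa_vec_cases) (simp add: Icosa_R_simps)
  show "\<zero>\<^bsub>Icosa_R\<^esub> \<oplus>\<^bsub>Icosa_R\<^esub> u = u"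
    by (cases u rule: icosa_vec_cases) (simp add: Icosa_R_simps)
  show "\<exists>y \<in> carrier Icosa_R. y \<oplus>\<^bsub>Icosa_R\<^esub> u = \<zero>\<^bsub>Icosa_R\<^esub>"
  proof (cases u rule: icosa_vec_cases)
    case (1 p1 q1 p2 q2 p3 q3)
    then show ?thesis
      by (intro bexI[of _ "((- p1, - q1), (- p2, - q2), (- p3, - q3))"]) (simp_all add: Icosa_R_simps)
  qed
qed (simp_all add: Icosa_R_simps)

lemma Icosa_R_minus:
  "\<ominus>\<^bsub>Icosa_R\<^esub> ((p1, q1), (p2, q2), (p3, q3)) = ((- p1, - q1), (- p2, - q2), (- p3, - q3))"
  by (rule abelian_group.minus_equality[OF abelian_group_Icosa_R]) (simp_all add: Icosa_R_simps)

lemma icosa_basis: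
  "v = fst v \<odot>\<^bsub>Icosa_R\<^esub> e1 \<oplus>\<^bsub>Icosa_R\<^esub> fst (snd v) \<odot>\<^bsub>Icosa_R\<^esub> e2
     \<oplus>\<^bsub>Icosa_R\<^esub> snd (snd v) \<odot>\<^bsub>Icosa_R\<^esub> e3"
  by (cases v rule: icosa_vec_cases) (simp add: e1_def e2_def e3_def Icosa_R_simps Zphi_simps)

definition alpha_matrix :: "icosa_vec \<Rightarrow> icosa_vec"
  where "alpha_matrix = (\<lambda>((p1, q1), (p2, q2), (p3, q3)).
    ((- p1, - q1), (- p2, - q2), (q1 + q2 + p3, p1 + q1 + p2 + q2 + q3)))"

definition gamma_matrix :: "icosa_vec \<Rightarrow> icosa_vec"
  where "gamma_matrix = (\<lambda>(x1, x2, x3). (x2, x3, x1))"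

lemma matrices_linear:
  "alpha_matrix (v \<oplus>\<^bsub>Icosa_R\<^esub> w) = alpha_matrix v \<oplus>\<^bsub>Icosa_R\<^esub> alpha_matrix w"
  "gamma_matrix (v \<oplus>\<^bsub>Icosa_R\<^esub> w) = gamma_matrix v \<oplus>\<^bsub>Icosa_R\<^esub> gamma_matrix w"
  "alpha_matrix (r \<odot>\<^bsub>Icosa_R\<^esub> v) = r \<odot>\<^bsub>Icosa_R\<^esub> alpha_matrix v"
  "gamma_matrix (r \<odot>\<^bsub>Icosa_R\<^esub> v) = r \<odot>\<^bsub>Icosa_R\<^esub> gamma_matrix v"
  by (cases v rule: icosa_vec_cases; cases w rule: icosa_vec_cases; cases r;
      simp add: alpha_matrix_def gamma_matrix_def Icosa_R_simps Zphi_simps algebra_simps)+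

context five_points begin

text \<open>
  The ordered pairs of distinct points correspond to the 20 vertices of a dodecahedron, with \<open>(x, y)\<close>
  and \<open>(y, x)\<close> antipodal.  The linear form \<open>x\<^sub>1 + x\<^sub>2 + x\<^sub>3\<close> on \<open>R\<^sup>3\<close> is fixed by \<open>\<gamma>\<close> and belongs to the
  vertex \<open>(m, n)\<close>; equivariance determines the forms of the other vertices.  The values below are
  the coefficients of \<open>\<phi>\<close> in these forms, where \<open>x\<^sub>r = p\<^sub>r + q\<^sub>r \<phi>\<close>, for one vertex from each antipodal
  pair.
\<close>

definition half_vertex_form :: "icosa_vec \<Rightarrow> nat \<Rightarrow> nat \<Rightarrow> int"
  where "half_vertex_form = (\<lambda>((p1, q1), (p2, q2), (p3, q3)) x y.
     if (x, y) = (m, n) then q1 + q2 + q3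
     else if (x, y) = (i, j) then p1 + p2 + q3
     else if (x, y) = (j, k) then p3 + p1 + q2
     else if (x, y) = (k, i) then p2 + p3 + q1
     else if (x, y) = (n, k) then q1 - p1 + p3
     else if (x, y) = (n, i) then q3 - p3 + p2
     else if (x, y) = (n, j) then q2 - p2 + p1
     else if (x, y) = (k, m) then q2 - p2 + p3
     else if (x, y) = (i, m) then q1 - p1 + p2
     else if (x, y) = (j, m) then q3 - p3 + p1
     else 0)"

definition vertex_form :: "icosa_vec \<Rightarrow> nat \<Rightarrow> nat \<Rightarrow> int"
  where "vertex_form v x y = half_vertex_form v x y - half_vertex_form v y x"

lemma vertex_form_table [simp]:
  "vertex_form ((p1, q1), (p2, q2), (p3, q3)) m n = q1 + q2 + q3"
  "vertex_form ((p1, q1), (p2, q2), (p3, q3)) i j = p1 + p2 + q3"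
  "vertex_form ((p1, q1), (p2, q2), (p3, q3)) j k = p3 + p1 + q2"
  "vertex_form ((p1, q1), (p2, q2), (p3, q3)) k i = p2 + p3 + q1"
  "vertex_form ((p1, q1), (p2, q2), (p3, q3)) n k = q1 - p1 + p3"
  "vertex_form ((p1, q1), (p2, q2), (p3, q3)) n i = q3 - p3 + p2"
  "vertex_form ((p1, q1), (p2, q2), (p3, q3)) n j = q2 - p2 + p1"
  "vertex_form ((p1, q1), (p2, q2), (p3, q3)) k m = q2 - p2 + p3"
  "vertex_form ((p1, q1), (p2, q2), (p3, q3)) i m = q1 - p1 + p2"
  "vertex_form ((p1, q1), (p2, q2), (p3, q3)) j m = q3 - p3 + p1"
  by (use distinctness in \<open>simp add: vertex_form_def half_vertex_form_def\<close>)+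

lemma vertex_form_antisym: "vertex_form v y x = - vertex_form v x y"
  by (simp add: vertex_form_def)

lemma vertex_form_table' [simp]:
  "vertex_form ((p1, q1), (p2, q2), (p3, q3)) n m = - (q1 + q2 + q3)"
  "vertex_form ((p1, q1), (p2, q2), (p3, q3)) j i = - (p1 + p2 + q3)"
  "vertex_form ((p1, q1), (p2, q2), (p3, q3)) k j = - (p3 + p1 + q2)"
  "vertex_form ((p1, q1), (p2, q2), (p3, q3)) i k = - (p2 + p3 + q1)"
  "vertex_form ((p1, q1), (p2, q2), (p3, q3)) k n = - (q1 - p1 + p3)"
  "vertex_form ((p1, q1), (p2, q2), (p3, q3)) i n = - (q3 - p3 + p2)"
  "vertex_form ((p1, q1), (p2, q2), (p3, q3)) j n = - (q2 - p2 + p1)"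
  "vertex_form ((p1, q1), (p2, q2), (p3, q3)) m k = - (q2 - p2 + p3)"
  "vertex_form ((p1, q1), (p2, q2), (p3, q3)) m i = - (q1 - p1 + p2)"
  "vertex_form ((p1, q1), (p2, q2), (p3, q3)) m j = - (q3 - p3 + p1)"
  by (subst vertex_form_antisym, simp)+

lemma vertex_form_zero [simp]:
  "vertex_form v x x = 0"
  "x \<notin> {i, j, k, m, n} \<Longrightarrow> vertex_form v x y = 0"
  "y \<notin> {i, j, k, m, n} \<Longrightarrow> vertex_form v x y = 0"
  by (cases v rule: icosa_vec_cases; simp add: vertex_form_def half_vertex_form_def)+

lemma vertex_form_alpha: "vertex_form (alpha_matrix v) (alpha x) (alpha y) = vertex_form v x y"
  by (cases v rule: icosa_vec_cases; cases x rule: five_points_cases; cases y rule: five_points_cases)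
    (simp_all add: alpha_matrix_def)

lemma vertex_form_gamma: "vertex_form (gamma_matrix v) (gamma x) (gamma y) = vertex_form v x y"
  by (cases v rule: icosa_vec_cases; cases x rule: five_points_cases; cases y rule: five_points_cases)
    (simp_all add: gamma_matrix_def)

text \<open>
  Eight of the ten antipodal pairs are enough to recover the six integer coordinates.
\<close>

lemma vertex_form_inject:
  assumes "\<And>x y. vertex_form v x y = vertex_form w x y"
  shows "v = w"
proof -
  obtain p1 q1 p2 q2 p3 q3 where v: "v = ((p1, q1), (p2, q2), (p3, q3))"
    by (rule icosa_vec_cases)
  obtain p1' q1' p2' q2' p3' q3' where w: "w = ((p1', q1'), (p2', q2'), (p3', q3'))"
    by (rule icosa_vec_cases)
  have "q1 + q2 + q3 = q1' + q2' + q3'" "p1 + p2 + q3 = p1' + p2' + q3'"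
    "p3 + p1 + q2 = p3' + p1' + q2'" "p2 + p3 + q1 = p2' + p3' + q1'"
    "q1 - p1 + p3 = q1' - p1' + p3'" "q3 - p3 + p2 = q3' - p3' + p2'"
    "q2 - p2 + p1 = q2' - p2' + p1'" "q2 - p2 + p3 = q2' - p2' + p3'"
    using assms[of m n] assms[of i j] assms[of j k] assms[of k i] assms[of n k] assms[of n i]
      assms[of n j] assms[of k m]
    by (simp_all only: v w vertex_form_table)
  then have "p1 = p1'" "p2 = p2'" "p3 = p3'" "q1 = q1'" "q2 = q2'" "q3 = q3'"
    by linarith+
  then show ?thesis
    by (simp add: v w)
qed

text \<open>
  The action on functions of pairs of points, pulled back along the injection \<open>vertex_form\<close>.
\<close>

definition icosa_rep :: "(nat \<Rightarrow> nat) \<Rightarrow> icosa_vec \<Rightarrow> icosa_vec"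
  where "icosa_rep g v = (THE w. \<forall>x y. vertex_form w (g x) (g y) = vertex_form v x y)"

lemma icosa_repI:
  assumes "g \<in> carrier A5" "\<And>x y. vertex_form w (g x) (g y) = vertex_form v x y"
  shows "icosa_rep g v = w"
  unfolding icosa_rep_def
proof (rule the_equality)
  show "\<forall>x y. vertex_form w (g x) (g y) = vertex_form v x y"
    using assms(2) by blast
  fix w' assume w': "\<forall>x y. vertex_form w' (g x) (g y) = vertex_form v x y"
  have "surj g"
    using A5_permutes[OF assms(1)] by (rule permutes_surj)
  then have "vertex_form w' x y = vertex_form w x y" for x y
    using w' assms(2) by (metis surj_f_inv_f)
  then show "w' = w"
    by (rule vertex_form_inject)
qed

text \<open>
  The image of \<open>vertex_form\<close> is stable under the generators, hence under the group.
\<close>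

lemma vertex_form_icosa_rep:
  assumes "g \<in> carrier A5"
  shows "vertex_form (icosa_rep g v) (g x) (g y) = vertex_form v x y"
proof -
  have "\<exists>w. \<forall>x y. vertex_form w (g x) (g y) = vertex_form v x y"
    using assms
  proof (induction rule: A5_induct)
    case id
    show ?case
      by (intro exI[of _ v]) simp
  next
    case (alpha p)
    then obtain w where "\<forall>x y. vertex_form w (p x) (p y) = vertex_form v x y"
      by blast
    then show ?case
      by (intro exI[of _ "alpha_matrix w"]) (simp add: vertex_form_alpha)
  next
    case (gamma p)
    then obtain w where "\<forall>x y. vertex_form w (p x) (p y) = vertex_form v x y"
      by blast
    then show ?case
      by (intro exI[of _ "gamma_matrix w"]) (simp add: vertex_form_gamma)
  qed
  then obtain w where w: "\<And>x y. vertex_form w (g x) (g y) = vertex_form v x y"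
    by blast
  then show ?thesis
    using icosa_repI[OF assms w] by simp
qed

lemma icosa_rep_id [simp]: "icosa_rep id v = v"
  using A5.one_closed by (intro icosa_repI) (simp_all add: alt_group_one)

lemma icosa_rep_alpha [simp]: "icosa_rep alpha = alpha_matrix"
  by (rule ext, rule icosa_repI) (simp_all add: vertex_form_alpha)

lemma icosa_rep_gamma [simp]: "icosa_rep gamma = gamma_matrix"
  by (rule ext, rule icosa_repI) (simp_all add: vertex_form_gamma)

lemma icosa_rep_comp:
  assumes "g \<in> carrier A5" "h \<in> carrier A5"
  shows "icosa_rep (g \<circ> h) v = icosa_rep g (icosa_rep h v)"
  using assms A5.m_closed[OF assms]
  by (intro icosa_repI) (simp_all add: vertex_form_icosa_rep alt_group_mult)

lemma icosa_rep_linear: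
  assumes "g \<in> carrier A5"
  shows "icosa_rep g (v \<oplus>\<^bsub>Icosa_R\<^esub> w) = icosa_rep g v \<oplus>\<^bsub>Icosa_R\<^esub> icosa_rep g w"
    and "icosa_rep g (r \<odot>\<^bsub>Icosa_R\<^esub> v) = r \<odot>\<^bsub>Icosa_R\<^esub> icosa_rep g v"
  using assms by (induction rule: A5_induct) (simp_all add: icosa_rep_comp matrices_linear)

text \<open>
  A linear action is determined by the images of the basis vectors under the generators.
\<close>

lemma icosa_action_unique:
  assumes "is_icosa_action alpha gamma \<rho>" "g \<in> carrier A5"
  shows "\<rho> g v = icosa_rep g v"
proof -
  interpret group_action A5 "carrier Icosa_R" \<rho>
    using assms(1) by (auto simp: is_icosa_action_def group_module_def)
  have add: "\<rho> g (v \<oplus>\<^bsub>Icosa_R\<^esub> w) = \<rho> g v \<oplus>\<^bsub>Icosa_R\<^esub> \<rho> g w" if "g \<in> carrier A5" for g v w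
  proof -
    have "\<rho> g \<in> hom (add_monoid Icosa_R) (add_monoid Icosa_R)"
      using assms(1) that unfolding is_icosa_action_def group_module_def by blast
    from hom_mult[OF this, of v w] show ?thesis
      by (simp add: Icosa_R_simps(1))
  qed
  have smult: "\<rho> g (r \<odot>\<^bsub>Icosa_R\<^esub> v) = r \<odot>\<^bsub>Icosa_R\<^esub> \<rho> g v" if "g \<in> carrier A5" for g r v
    using assms(1) that
    by (cases r; cases v rule: icosa_vec_cases) (simp add: is_icosa_action_def Icosa_R_simps(1) Zphi_simps(1))
  have expand: "\<rho> g v = fst v \<odot>\<^bsub>Icosa_R\<^esub> \<rho> g e1 \<oplus>\<^bsub>Icosa_R\<^esub> fst (snd v) \<odot>\<^bsub>Icosa_R\<^esub> \<rho> g e2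
      \<oplus>\<^bsub>Icosa_R\<^esub> snd (snd v) \<odot>\<^bsub>Icosa_R\<^esub> \<rho> g e3" if "g \<in> carrier A5" for g v
    by (subst icosa_basis) (simp only: add[OF that] smult[OF that])
  have \<alpha>: "\<rho> alpha v = alpha_matrix v" for v
    using assms(1)
    by (subst expand, simp, cases v rule: icosa_vec_cases)
      (simp add: is_icosa_action_def alpha_matrix_def e1_def e2_def e3_def phi_def
        Icosa_R_simps Icosa_R_minus Zphi_simps)
  have \<gamma>: "\<rho> gamma v = gamma_matrix v" for v
    using assms(1)
    by (subst expand, simp, cases v rule: icosa_vec_cases)
      (simp add: is_icosa_action_def gamma_matrix_def e1_def e2_def e3_def Icosa_R_simps Zphi_simps)
  have comp: "\<rho> (g \<circ> h) v = \<rho> g (\<rho> h v)" if "g \<in> carrier A5" "h \<in> carrier A5" for g h v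
    using composition_rule[of v g h] that by (simp add: Icosa_R_simps(1) alt_group_mult)
  show ?thesis
    using assms(2)
  proof (induction rule: A5_induct)
    case id
    have "v = \<rho> id v"
      using fun_cong[OF id_eq_one, of v] by (simp add: Icosa_R_simps(1) alt_group_one)
    then show ?case
      by (rule trans[OF sym icosa_rep_id[symmetric]])
  next
    case (alpha p)
    then show "\<rho> (alpha \<circ> p) v = icosa_rep (alpha \<circ> p) v"
      using comp[OF alpha_closed alpha(1), of v] icosa_rep_comp[OF alpha_closed alpha(1), of v] \<alpha>
      by simp
  next
    case (gamma p)
    then show "\<rho> (gamma \<circ> p) v = icosa_rep (gamma \<circ> p) v"
      using comp[OF gamma_closed gamma(1), of v] icosa_rep_comp[OF gamma_closed gamma(1), of v] \<gamma>
      by simp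
  qed
qed

lemma is_icosa_action_icosa_rep:
  "is_icosa_action alpha gamma (restrict icosa_rep (carrier A5))" (is "is_icosa_action _ _ ?\<rho>")
proof -
  have bij: "icosa_rep g \<in> Bij UNIV" if g: "g \<in> carrier A5" for g
  proof -
    have inv: "inv\<^bsub>A5\<^esub> g \<in> carrier A5" "inv\<^bsub>A5\<^esub> g \<circ> g = id" "g \<circ> inv\<^bsub>A5\<^esub> g = id"
      using A5.inv_closed[OF g] A5.l_inv[OF g] A5.r_inv[OF g] by (simp_all add: alt_group_mult alt_group_one)
    have "icosa_rep (inv\<^bsub>A5\<^esub> g) (icosa_rep g v) = v" "icosa_rep g (icosa_rep (inv\<^bsub>A5\<^esub> g) v) = v" for v
      using icosa_rep_comp[OF inv(1) g, of v] icosa_rep_comp[OF g inv(1), of v]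
      by (simp_all only: inv icosa_rep_id)
    then have "bij (icosa_rep g)"
      by (metis bijI injI surjI)
    then show ?thesis
      by (simp add: Bij_def)
  qed
  have "group_hom A5 (BijGroup UNIV) ?\<rho>"
  proof (intro group_hom.intro group_hom_axioms.intro group_A5 group_BijGroup homI)
    show "?\<rho> g \<in> carrier (BijGroup UNIV)" if "g \<in> carrier A5" for g
      using that bij by (simp add: BijGroup_def)
    show "?\<rho> (g \<otimes>\<^bsub>A5\<^esub> h) = ?\<rho> g \<otimes>\<^bsub>BijGroup UNIV\<^esub> ?\<rho> h" if "g \<in> carrier A5" "h \<in> carrier A5" for g h
      using that bij A5.m_closed[OF that] icosa_rep_comp[OF that]
      by (simp add: BijGroup_def compose_def alt_group_mult fun_eq_iff)
  qed
  then have "group_module A5 Icosa_R ?\<rho>"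
    by (auto simp: group_module_def group_action_def abelian_group_Icosa_R Icosa_R_simps(1)
        hom_def icosa_rep_linear)
  then show ?thesis
    by (simp add: is_icosa_action_def icosa_rep_linear alpha_matrix_def gamma_matrix_def
        e1_def e2_def e3_def phi_def Icosa_R_simps Icosa_R_minus Zphi_simps)
qed

lemma icosa_action_eq:
  assumes "g \<in> carrier A5"
  shows "icosa_action alpha gamma g = icosa_rep g"
proof -
  have "is_icosa_action alpha gamma (icosa_action alpha gamma)"
    unfolding icosa_action_def
  proof (rule theI[where P = "is_icosa_action alpha gamma", OF is_icosa_action_icosa_rep])
    fix \<rho> assume \<rho>: "is_icosa_action alpha gamma \<rho>"
    then have "\<rho> \<in> extensional (carrier A5)"
      by (simp add: is_icosa_action_def)
    then show "\<rho> = restrict icosa_rep (carrier A5)"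
      using icosa_action_unique[OF \<rho>] by (auto simp: fun_eq_iff extensional_def restrict_def)
  qed
  then show ?thesis
    using icosa_action_unique assms by blast
qed

end

section \<open>Modules on which the Klein four-groups act without fixed points\<close>

lemma (in abelian_monoid) finsum_distinct_list:
  assumes "distinct xs" "f \<in> set xs \<rightarrow> carrier G"
  shows "finsum G f (set xs) = foldr (\<lambda>x s. f x \<oplus> s) xs \<zero>"
  using assms by (induction xs) auto

text \<open>
  Words in given elements of an abelian group are images of words in the generators of a free abelian
  group.  An identity that holds in the free group, where ordinary additive arithmetic applies, can
  thus be transferred to the given elements.
\<close>

lemma (in abelian_group) integer_coordinates:
  assumes "set xs \<subseteq> carrier G"
  shows "\<exists>h :: (nat \<Rightarrow>\<^sub>0 int) \<Rightarrow> 'a. (\<forall>f g. h (f + g) = h f \<oplus> h g) \<and> (\<forall>f. h (- f) = \<ominus> h f) \<and>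
    (\<forall>r < length xs. h (frag_of r) = xs ! r)"
proof -
  interpret add: comm_group "add_monoid G"
    by (rule a_comm_group)
  let ?x = "\<lambda>r. if r < length xs then xs ! r else \<zero>"
  have "range ?x \<subseteq> carrier G"
    using assms nth_mem by force
  then obtain h where h: "h \<in> hom (free_Abelian_group UNIV) (add_monoid G)"
      "\<And>r. r \<in> UNIV \<Longrightarrow> h (frag_of r) = ?x r"
    by (rule add.free_Abelian_group_universal[of ?x UNIV]) (rule that)
  have closed: "h f \<in> carrier G" for f
    using h(1) by (auto simp: hom_def)
  have add: "h (f + g) = h f \<oplus> h g" for f g
    using hom_mult[OF h(1), of f g] by simp
  have "h 0 = \<zero>"
    using add[of 0 0] closed[of 0] by (metis add.l_cancel_one' add_0)
  then have "h (- f) = \<ominus> h f" for f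
    using add[of "- f" f] closed minus_equality[of "h (- f)" "h f"] by simp
  with add h(2) show ?thesis
    by (intro exI[of _ h]) simp
qed

context abelian_group
begin

text \<open>
  The identities in the rest of this block are the additive bookkeeping of later proofs, stated for
  arbitrary elements.  The present two serve the proof that \<open>\<psi>\<^sup>2 = \<psi> + 1\<close>.
\<close>

lemma cancellation_identities:
  assumes "l \<in> carrier G" "p \<in> carrier G" "q \<in> carrier G" "s \<in> carrier G" "t \<in> carrier G" "u \<in> carrier G"
    "v \<in> carrier G"
  shows "q \<oplus> \<ominus> (p \<oplus> l) = (s \<oplus> \<ominus> p \<oplus> \<ominus> t \<oplus> q) \<oplus> (t \<oplus> \<ominus> s \<oplus> \<ominus> l)"
    and "(l \<oplus> \<ominus> u \<oplus> \<ominus> t \<oplus> v) \<oplus> (t \<oplus> \<ominus> s \<oplus> \<ominus> l) = v \<oplus> \<ominus> (u \<oplus> s)"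
proof -
  have "set [l, p, q, s, t, u, v] \<subseteq> carrier G"
    using assms by simp
  then obtain h :: "(nat \<Rightarrow>\<^sub>0 int) \<Rightarrow> 'a" where h: "\<And>f g. h (f + g) = h f \<oplus> h g" "\<And>f. h (- f) = \<ominus> h f"
    and atoms: "\<forall>r < length [l, p, q, s, t, u, v]. h (frag_of r) = [l, p, q, s, t, u, v] ! r"
    using integer_coordinates[of "[l, p, q, s, t, u, v]"] by metis
  have x: "l = h (frag_of 0)" "p = h (frag_of 1)" "q = h (frag_of 2)" "s = h (frag_of 3)" "t = h (frag_of 4)"
    "u = h (frag_of 5)" "v = h (frag_of 6)"
    using atoms by (simp_all add: eval_nat_numeral All_less_Suc)
  show "q \<oplus> \<ominus> (p \<oplus> l) = (s \<oplus> \<ominus> p \<oplus> \<ominus> t \<oplus> q) \<oplus> (t \<oplus> \<ominus> s \<oplus> \<ominus> l)"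
    and "(l \<oplus> \<ominus> u \<oplus> \<ominus> t \<oplus> v) \<oplus> (t \<oplus> \<ominus> s \<oplus> \<ominus> l) = v \<oplus> \<ominus> (u \<oplus> s)"
    unfolding x h[symmetric] by (rule arg_cong[of _ _ h], simp)+
qed

text \<open>
  The left-hand side lists the images of \<open>l\<close> under the twelve words in the class of \<open>\<alpha>\<gamma>\<close>, where \<open>p\<close>
  stands for \<open>\<psi>l\<close>, \<open>g\<close> and \<open>gg\<close> for \<open>\<gamma>l\<close> and \<open>\<gamma>\<^sup>2l\<close>, and \<open>gp\<close> and \<open>ggp\<close> for \<open>\<gamma>\<psi>l\<close> and \<open>\<gamma>\<^sup>2\<psi>l\<close>.
\<close>

lemma class_sum_identity:
  assumes "l \<in> carrier G" "p \<in> carrier G" "g \<in> carrier G" "gg \<in> carrier G" "gp \<in> carrier G" "ggp \<in> carrier G"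
  shows "(\<ominus> g \<oplus> p) \<oplus> (g \<oplus> ((\<ominus> gg \<oplus> p) \<oplus> (gg \<oplus> ((\<ominus> gg \<oplus> gp) \<oplus>
     ((\<ominus> (\<ominus> gg \<oplus> p) \<oplus> (\<ominus> gp \<oplus> (p \<oplus> l))) \<oplus> ((\<ominus> g \<oplus> ggp) \<oplus>
     ((\<ominus> (\<ominus> g \<oplus> p) \<oplus> (\<ominus> ggp \<oplus> (p \<oplus> l))) \<oplus> ((\<ominus> l \<oplus> (\<ominus> ggp \<oplus> (p \<oplus> l))) \<oplus>
     ((\<ominus> l \<oplus> ggp) \<oplus> ((\<ominus> l \<oplus> (\<ominus> gp \<oplus> (p \<oplus> l))) \<oplus> (\<ominus> l \<oplus> gp))))))))))) = p \<oplus> p \<oplus> p \<oplus> p"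
proof -
  have "set [l, p, g, gg, gp, ggp] \<subseteq> carrier G"
    using assms by simp
  then obtain h :: "(nat \<Rightarrow>\<^sub>0 int) \<Rightarrow> 'a" where h: "\<And>f g. h (f + g) = h f \<oplus> h g" "\<And>f. h (- f) = \<ominus> h f"
    and atoms: "\<forall>r < length [l, p, g, gg, gp, ggp]. h (frag_of r) = [l, p, g, gg, gp, ggp] ! r"
    using integer_coordinates[of "[l, p, g, gg, gp, ggp]"] by metis
  have x: "l = h (frag_of 0)" "p = h (frag_of 1)" "g = h (frag_of 2)" "gg = h (frag_of 3)" "gp = h (frag_of 4)"
    "ggp = h (frag_of 5)"
    using atoms by (simp_all add: eval_nat_numeral All_less_Suc)
  show ?thesis
    unfolding x h[symmetric] by (rule arg_cong[of _ _ h]) simp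
qed

lemma gram_sum_identity:
  assumes "l1 \<in> carrier G" "l2 \<in> carrier G" "l3 \<in> carrier G" "p1 \<in> carrier G" "p2 \<in> carrier G" "p3 \<in> carrier G"
  shows "((l1 \<oplus> l2 \<oplus> l3) \<oplus> (p1 \<oplus> p2 \<oplus> p3)) \<oplus> ((l1 \<oplus> l2 \<oplus> l3) \<oplus> (p1 \<oplus> p2 \<oplus> p3)) = (p1 \<oplus> p2 \<oplus> l3 \<oplus> l3) \<oplus> ((p2 \<oplus> p3 \<oplus> l1 \<oplus> l1) \<oplus> (p1 \<oplus> p3 \<oplus> l2 \<oplus> l2))"
    and "l3 \<oplus> l3 = (p1 \<oplus> p2 \<oplus> l3 \<oplus> l3) \<oplus> \<ominus> (p1 \<oplus> p2 \<oplus> p3) \<oplus> p3"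
    and "l1 \<oplus> l1 = (p2 \<oplus> p3 \<oplus> l1 \<oplus> l1) \<oplus> \<ominus> (p1 \<oplus> p2 \<oplus> p3) \<oplus> p1"
    and "l2 \<oplus> l2 = (p1 \<oplus> p3 \<oplus> l2 \<oplus> l2) \<oplus> \<ominus> (p1 \<oplus> p2 \<oplus> p3) \<oplus> p2"
proof -
  have "set [l1, l2, l3, p1, p2, p3] \<subseteq> carrier G"
    using assms by simp
  then obtain h :: "(nat \<Rightarrow>\<^sub>0 int) \<Rightarrow> 'a" where h: "\<And>f g. h (f + g) = h f \<oplus> h g" "\<And>f. h (- f) = \<ominus> h f"
    and atoms: "\<forall>r < length [l1, l2, l3, p1, p2, p3]. h (frag_of r) = [l1, l2, l3, p1, p2, p3] ! r"
    using integer_coordinates[of "[l1, l2, l3, p1, p2, p3]"] by metis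
  have x: "l1 = h (frag_of 0)" "l2 = h (frag_of 1)" "l3 = h (frag_of 2)" "p1 = h (frag_of 3)" "p2 = h (frag_of 4)" "p3 = h (frag_of 5)"
    using atoms by (simp_all add: eval_nat_numeral All_less_Suc)
  show "((l1 \<oplus> l2 \<oplus> l3) \<oplus> (p1 \<oplus> p2 \<oplus> p3)) \<oplus> ((l1 \<oplus> l2 \<oplus> l3) \<oplus> (p1 \<oplus> p2 \<oplus> p3)) = (p1 \<oplus> p2 \<oplus> l3 \<oplus> l3) \<oplus> ((p2 \<oplus> p3 \<oplus> l1 \<oplus> l1) \<oplus> (p1 \<oplus> p3 \<oplus> l2 \<oplus> l2))"
    and "l3 \<oplus> l3 = (p1 \<oplus> p2 \<oplus> l3 \<oplus> l3) \<oplus> \<ominus> (p1 \<oplus> p2 \<oplus> p3) \<oplus> p3"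
    and "l1 \<oplus> l1 = (p2 \<oplus> p3 \<oplus> l1 \<oplus> l1) \<oplus> \<ominus> (p1 \<oplus> p2 \<oplus> p3) \<oplus> p1"
    and "l2 \<oplus> l2 = (p1 \<oplus> p3 \<oplus> l2 \<oplus> l2) \<oplus> \<ominus> (p1 \<oplus> p2 \<oplus> p3) \<oplus> p2"
    unfolding x h[symmetric] by (rule arg_cong[of _ _ h], simp)+
qed

text \<open>
  With \<open>pa = \<psi>a\<close>, \<open>pb = \<psi>b\<close>, \<open>pc = \<psi>c\<close> and \<open>u = \<psi>t\<close>, the left-hand side is a row of the matrix with \<open>2\<close> on
  the diagonal and \<open>\<psi>\<close> elsewhere, applied to the candidates for its inverse image.
\<close>

lemma gram_inverse_identity:
  assumes "a \<in> carrier G" "b \<in> carrier G" "c \<in> carrier G" "pa \<in> carrier G" "pb \<in> carrier G" "pc \<in> carrier G" "t \<in> carrier G" "u \<in> carrier G"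
  shows "(pa \<oplus> (pa \<oplus> a) \<oplus> \<ominus> ((u \<oplus> t) \<oplus> (u \<oplus> t) \<oplus> u)) \<oplus> (pb \<oplus> (pb \<oplus> b) \<oplus> \<ominus> ((u \<oplus> t) \<oplus> (u \<oplus> t) \<oplus> u)) \<oplus> (c \<oplus> pc \<oplus> \<ominus> (u \<oplus> u \<oplus> t)) \<oplus> (c \<oplus> pc \<oplus> \<ominus> (u \<oplus> u \<oplus> t)) = c \<oplus> ((a \<oplus> b \<oplus> c) \<oplus> (pa \<oplus> pb \<oplus> pc) \<oplus> (pa \<oplus> pb \<oplus> pc)) \<oplus> \<ominus> (((t \<oplus> t) \<oplus> (u \<oplus> u)) \<oplus> ((u \<oplus> u) \<oplus> ((u \<oplus> t) \<oplus> (u \<oplus> t))) \<oplus> ((u \<oplus> u) \<oplus> ((u \<oplus> t) \<oplus> (u \<oplus> t))))"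
proof -
  have "set [a, b, c, pa, pb, pc, t, u] \<subseteq> carrier G"
    using assms by simp
  then obtain h :: "(nat \<Rightarrow>\<^sub>0 int) \<Rightarrow> 'a" where h: "\<And>f g. h (f + g) = h f \<oplus> h g" "\<And>f. h (- f) = \<ominus> h f"
    and atoms: "\<forall>r < length [a, b, c, pa, pb, pc, t, u]. h (frag_of r) = [a, b, c, pa, pb, pc, t, u] ! r"
    using integer_coordinates[of "[a, b, c, pa, pb, pc, t, u]"] by metis
  have x: "a = h (frag_of 0)" "b = h (frag_of 1)" "c = h (frag_of 2)" "pa = h (frag_of 3)" "pb = h (frag_of 4)" "pc = h (frag_of 5)" "t = h (frag_of 6)" "u = h (frag_of 7)"
    using atoms by (simp_all add: eval_nat_numeral All_less_Suc)
  show "(pa \<oplus> (pa \<oplus> a) \<oplus> \<ominus> ((u \<oplus> t) \<oplus> (u \<oplus> t) \<oplus> u)) \<oplus> (pb \<oplus> (pb \<oplus> b) \<oplus> \<ominus> ((u \<oplus> t) \<oplus> (u \<oplus> t) \<oplus> u)) \<oplus> (c \<oplus> pc \<oplus> \<ominus> (u \<oplus> u \<oplus> t)) \<oplus> (c \<oplus> pc \<oplus> \<ominus> (u \<oplus> u \<oplus> t)) = c \<oplus> ((a \<oplus> b \<oplus> c) \<oplus> (pa \<oplus> pb \<oplus> pc) \<oplus> (pa \<oplus> pb \<oplus> pc)) \<oplus> \<ominus> (((t \<oplus> t) \<oplus> (u \<oplus> u)) \<oplus> ((u \<oplus> u) \<oplus> ((u \<oplus> t) \<oplus> (u \<oplus>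 t))) \<oplus> ((u \<oplus> u) \<oplus> ((u \<oplus> t) \<oplus> (u \<oplus> t))))"
    unfolding x h[symmetric] by (rule arg_cong[of _ _ h], simp)+
qed

lemma sigma_identity:
  assumes "q \<in> carrier G" "s \<in> carrier G"
  shows "(s \<oplus> s \<oplus> \<ominus> q) \<oplus> (q \<oplus> q \<oplus> \<ominus> (q \<oplus> s)) = s"
proof -
  have "set [q, s] \<subseteq> carrier G"
    using assms by simp
  then obtain h :: "(nat \<Rightarrow>\<^sub>0 int) \<Rightarrow> 'a" where h: "\<And>f g. h (f + g) = h f \<oplus> h g" "\<And>f. h (- f) = \<ominus> h f"
    and atoms: "\<forall>r < length [q, s]. h (frag_of r) = [q, s] ! r"
    using integer_coordinates[of "[q, s]"] by metis
  have x: "q = h (frag_of 0)" "s = h (frag_of 1)"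
    using atoms by (simp_all add: eval_nat_numeral All_less_Suc)
  show "(s \<oplus> s \<oplus> \<ominus> q) \<oplus> (q \<oplus> q \<oplus> \<ominus> (q \<oplus> s)) = s"
    unfolding x h[symmetric] by (rule arg_cong[of _ _ h], simp)+
qed

end

locale A5_module = five_points i j k m n + abelian_group V
  for i j k m n :: nat and V :: "('v, 'm) ring_scheme" (structure) +
  fixes act :: "(nat \<Rightarrow> nat) \<Rightarrow> 'v \<Rightarrow> 'v"
  assumes group_module: "group_module A5 V act"
    and uniquely_2_divisible: "uniquely_n_divisible 2 V"
begin

lemma act_closed [simp]: "\<lbrakk>g \<in> carrier A5; v \<in> carrier V\<rbrakk> \<Longrightarrow> act g v \<in> carrier V"
  using group_module by (auto simp: group_module_def hom_def)

lemma act_add: "\<lbrakk>g \<in> carrier A5; v \<in> carrier V; w \<in> carrier V\<rbrakk> \<Longrightarrow> act g (v \<oplus> w) = act g v \<oplus> act g w"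
  using group_module by (auto simp: group_module_def hom_def)

lemma act_comp: "\<lbrakk>g \<in> carrier A5; h \<in> carrier A5; v \<in> carrier V\<rbrakk> \<Longrightarrow> act (g \<circ> h) v = act g (act h v)"
  using group_action.composition_rule[of A5 "carrier V" act v g h] group_module
  by (simp add: group_module_def alt_group_mult)

lemma act_id: "v \<in> carrier V \<Longrightarrow> act id v = v"
  using group_action.id_eq_one[of A5 "carrier V" act] group_module
  by (simp add: group_module_def alt_group_one) (metis restrict_apply')

lemma act_zero: "g \<in> carrier A5 \<Longrightarrow> act g \<zero> = \<zero>"
  using act_add[of g \<zero> \<zero>] by (metis act_closed add.l_cancel_one' l_zero zero_closed)

lemma act_minus: "\<lbrakk>g \<in> carrier A5; v \<in> carrier V\<rbrakk> \<Longrightarrow> act g (\<ominus> v) = \<ominus> act g v"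
  using act_add[of g "\<ominus> v" v] act_zero[of g]
  by (metis a_inv_closed act_closed l_neg minus_equality)

abbreviation A :: "'v \<Rightarrow> 'v"
  where "A \<equiv> act alpha"

abbreviation B :: "'v \<Rightarrow> 'v"
  where "B \<equiv> act beta"

abbreviation \<Gamma> :: "'v \<Rightarrow> 'v"
  where "\<Gamma> \<equiv> act gamma"

lemmas linear [simp] = act_add act_minus act_zero

lemma comp_closed: "\<lbrakk>g \<in> carrier A5; h \<in> carrier A5\<rbrakk> \<Longrightarrow> g \<circ> h \<in> carrier A5"
  using A5.m_closed[of g h] by (simp add: alt_group_mult)

lemma relations:
  assumes "v \<in> carrier V"
  shows "A (A v) = v" "\<Gamma> (\<Gamma> (\<Gamma> v)) = v"
    and "A (B v) = B (A v)" "B (\<Gamma> v) = \<Gamma> (\<Gamma> (B v))"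
    and "A (\<Gamma> (A (\<Gamma> (A (\<Gamma> v))))) = \<Gamma> (\<Gamma> (A (\<Gamma> (\<Gamma> (A v)))))"
proof -
  show "A (A v) = v"
    using act_comp[of alpha alpha v] act_id assms by (simp add: alpha_squared)
  show "\<Gamma> (\<Gamma> (\<Gamma> v)) = v"
    using arg_cong[OF gamma_cubed, of "\<lambda>p. act p v"] assms by (simp add: act_comp act_id comp_closed del: o_apply)
  show "A (B v) = B (A v)"
    using arg_cong[OF alpha_beta_commute, of "\<lambda>p. act p v"] assms by (simp add: act_comp)
  show "B (\<Gamma> v) = \<Gamma> (\<Gamma> (B v))"
    using arg_cong[OF beta_inverts_gamma, of "\<lambda>p. act p v"] assms by (simp add: act_comp comp_closed)
  show "A (\<Gamma> (A (\<Gamma> (A (\<Gamma> v))))) = \<Gamma> (\<Gamma> (A (\<Gamma> (\<Gamma> (A v)))))"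
    using arg_cong[OF alpha_gamma_relation, of "\<lambda>p. act p v"] assms by (simp add: act_comp comp_closed)
qed

declare relations(1,2) [simp]

lemma fixed_by_A5:
  assumes "v \<in> carrier V" "A v = v" "\<Gamma> v = v" "g \<in> carrier A5"
  shows "act g v = v"
  using assms(4,1-3) by (induction rule: A5_induct) (simp_all add: act_comp act_id)

lemma nat_2_times: "v \<in> carrier V \<Longrightarrow> [(2::nat)] \<cdot> v = v \<oplus> v"
  by (simp add: numeral_2_eq_2)

lemma halve:
  assumes "v \<in> carrier V"
  obtains w where "w \<in> carrier V" "v = w \<oplus> w"
  using assms uniquely_2_divisible nat_2_times unfolding uniquely_n_divisible_def by metis

lemma double_inject:
  assumes "v \<in> carrier V" "w \<in> carrier V" "v \<oplus> v = w \<oplus> w"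
  shows "v = w"
proof -
  have "v \<oplus> v \<in> carrier V"
    using assms by simp
  then show ?thesis
    using assms uniquely_2_divisible nat_2_times unfolding uniquely_n_divisible_def by metis
qed

lemma double_eq_zero: "\<lbrakk>v \<in> carrier V; v \<oplus> v = \<zero>\<rbrakk> \<Longrightarrow> v = \<zero>"
  using double_inject[of v \<zero>] by simp

definition L :: "'v set"
  where "L = {v \<in> carrier V. A v = v}"

lemma L_iff: "l \<in> L \<longleftrightarrow> l \<in> carrier V \<and> A l = l"
  by (simp add: L_def)

text \<open>
  A fixed point \<open>l\<close> is the trace of its half, since the half is fixed as well.
\<close>

lemma trace_image_alpha: "trace_image A5 V act alpha = L"
proof -
  have trace: "trace_op A5 V act alpha v = v \<oplus> A v" if "v \<in> carrier V" for v
  proof -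
    have "{..<A5.ord alpha} = {0, 1}"
      unfolding ord_alpha by auto
    moreover have "alpha [^]\<^bsub>A5\<^esub> (0::nat) = id" "alpha [^]\<^bsub>A5\<^esub> (1::nat) = alpha"
      by (simp_all add: alt_group_one alt_group_mult)
    ultimately show ?thesis
      using that by (simp add: trace_op_def act_id a_comm)
  qed
  have "v \<oplus> A v \<in> L" if "v \<in> carrier V" for v
    using that by (simp add: L_def a_comm)
  moreover have "l \<in> (\<lambda>v. v \<oplus> A v) ` carrier V" if "l \<in> L" for l
  proof -
    have l: "l \<in> carrier V" "A l = l"
      using that by (simp_all add: L_iff)
    obtain w where w: "w \<in> carrier V" "l = w \<oplus> w"
      using halve[OF l(1)] by blast
    have "A w = w"
      by (rule double_inject) (use w l(2) in simp_all)
    then show ?thesis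
      using w by force
  qed
  ultimately show ?thesis
    using trace by force
qed

end

text \<open>
  The added condition is the hypothesis that elements normalizing \<open>\<langle>\<alpha>\<rangle>\<close> outside it invert \<open>tr\<^sub>\<alpha>(V)\<close>, for the
  element \<open>\<beta>\<close>.  It amounts to saying that the four-group \<open>{1, \<alpha>, \<beta>, \<alpha>\<beta>}\<close> has no fixed points.
\<close>

locale icosahedral_module = A5_module i j k m n V act
  for i j k m n :: nat and V :: "('v, 'm) ring_scheme" (structure) and act +
  assumes beta_inverts: "\<lbrakk>v \<in> carrier V; act alpha v = v\<rbrakk> \<Longrightarrow> act beta v = \<ominus> v"
begin

definition \<psi> :: "'v \<Rightarrow> 'v"
  where "\<psi> v = \<Gamma> v \<oplus> A (\<Gamma> v)"

lemma \<psi>_closed [simp]: "v \<in> carrier V \<Longrightarrow> \<psi> v \<in> carrier V"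
  by (simp add: \<psi>_def)

lemma A_\<psi> [simp]: "v \<in> carrier V \<Longrightarrow> A (\<psi> v) = \<psi> v"
  by (simp add: \<psi>_def a_comm)

lemma \<psi>_linear [simp]:
  assumes "v \<in> carrier V" "w \<in> carrier V"
  shows "\<psi> (v \<oplus> w) = \<psi> v \<oplus> \<psi> w" "\<psi> (\<ominus> v) = \<ominus> \<psi> v"
  using assms by (simp_all add: \<psi>_def a_ac minus_add)

lemma \<psi>_zero [simp]: "\<psi> \<zero> = \<zero>"
  by (simp add: \<psi>_def)

lemma A_\<Gamma>:
  assumes "v \<in> carrier V" "A v = v"
  shows "A (\<Gamma> v) = \<ominus> \<Gamma> v \<oplus> \<psi> v"
  using assms by (simp add: \<psi>_def r_neg1)

text \<open>
  Apply \<open>\<beta>\<close> to the definition of \<open>\<psi>l\<close>: it negates \<open>l\<close> and \<open>\<psi>l\<close> and inverts \<open>\<gamma>\<close>.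
\<close>

lemma A_\<Gamma>\<Gamma>:
  assumes l: "l \<in> carrier V" "A l = l"
  shows "A (\<Gamma> (\<Gamma> l)) = \<ominus> \<Gamma> (\<Gamma> l) \<oplus> \<psi> l"
proof -
  have Bl: "B l = \<ominus> l" and B\<psi>: "B (\<psi> l) = \<ominus> \<psi> l"
    using l by (simp_all add: beta_inverts)
  have "\<ominus> \<psi> l = B (\<Gamma> l) \<oplus> A (B (\<Gamma> l))"
    unfolding B\<psi>[symmetric] using l by (simp add: \<psi>_def relations(3))
  also have "\<dots> = \<ominus> (\<Gamma> (\<Gamma> l) \<oplus> A (\<Gamma> (\<Gamma> l)))"
    using l by (simp add: relations(4) Bl minus_add)
  finally have "\<ominus> (\<ominus> \<psi> l) = \<ominus> (\<ominus> (\<Gamma> (\<Gamma> l) \<oplus> A (\<Gamma> (\<Gamma> l))))"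
    by simp
  then have "\<psi> l = \<Gamma> (\<Gamma> l) \<oplus> A (\<Gamma> (\<Gamma> l))"
    using l by (simp del: minus_add)
  then show ?thesis
    using l by (simp add: r_neg1)
qed

text \<open>
  Evaluating \<open>(\<alpha>\<gamma>)\<^sup>3 = (\<alpha>\<gamma>)\<^sup>-\<^sup>2\<close> at \<open>\<gamma>\<^sup>2l\<close> gives \<open>\<gamma>\<^sup>2\<theta> = \<theta>\<close> for the defect \<open>\<theta> = \<psi>\<^sup>2l - \<psi>l - l\<close>.  So \<open>\<theta>\<close> is
  fixed by the generators, hence by \<open>\<beta>\<close>, which also inverts it.
\<close>

lemma \<psi>_squared:
  assumes l: "l \<in> carrier V" "A l = l"
  shows "\<psi> (\<psi> l) = \<psi> l \<oplus> l"
proof -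
  define \<theta> where "\<theta> = \<psi> (\<psi> l) \<oplus> \<ominus> (\<psi> l \<oplus> l)"
  have \<theta>: "\<theta> \<in> carrier V" "A \<theta> = \<theta>"
    using l by (simp_all add: \<theta>_def)
  have "A (\<Gamma> (A (\<Gamma> (A (\<Gamma> (\<Gamma> (\<Gamma> l))))))) = \<Gamma> (\<Gamma> l) \<oplus> \<ominus> \<psi> l \<oplus> \<ominus> \<Gamma> (\<psi> l) \<oplus> \<psi> (\<psi> l)"
    using l by (simp add: A_\<Gamma> A_\<Gamma>\<Gamma> minus_add a_ac)
  moreover have "\<Gamma> (\<Gamma> (A (\<Gamma> (\<Gamma> (A (\<Gamma> (\<Gamma> l))))))) =
      l \<oplus> \<ominus> \<Gamma> (\<Gamma> (\<psi> l)) \<oplus> \<ominus> \<Gamma> (\<psi> l) \<oplus> \<Gamma> (\<Gamma> (\<psi> (\<psi> l)))"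
    using l by (simp add: A_\<Gamma> A_\<Gamma>\<Gamma> minus_add a_ac)
  ultimately have eq: "\<Gamma> (\<Gamma> l) \<oplus> \<ominus> \<psi> l \<oplus> \<ominus> \<Gamma> (\<psi> l) \<oplus> \<psi> (\<psi> l) =
      l \<oplus> \<ominus> \<Gamma> (\<Gamma> (\<psi> l)) \<oplus> \<ominus> \<Gamma> (\<psi> l) \<oplus> \<Gamma> (\<Gamma> (\<psi> (\<psi> l)))"
    using relations(5)[of "\<Gamma> (\<Gamma> l)"] l by simp
  have closed: "\<psi> l \<in> carrier V" "\<psi> (\<psi> l) \<in> carrier V" "\<Gamma> (\<Gamma> l) \<in> carrier V" "\<Gamma> (\<psi> l) \<in> carrier V"
    "\<Gamma> (\<Gamma> (\<psi> l)) \<in> carrier V" "\<Gamma> (\<Gamma> (\<psi> (\<psi> l))) \<in> carrier V"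
    using l by simp_all
  have "\<theta> = (\<Gamma> (\<Gamma> l) \<oplus> \<ominus> \<psi> l \<oplus> \<ominus> \<Gamma> (\<psi> l) \<oplus> \<psi> (\<psi> l)) \<oplus> (\<Gamma> (\<psi> l) \<oplus> \<ominus> \<Gamma> (\<Gamma> l) \<oplus> \<ominus> l)"
    unfolding \<theta>_def using l(1) closed by (intro cancellation_identities)
  also have "\<dots> = \<Gamma> (\<Gamma> (\<psi> (\<psi> l))) \<oplus> \<ominus> (\<Gamma> (\<Gamma> (\<psi> l)) \<oplus> \<Gamma> (\<Gamma> l))"
    unfolding eq using l(1) closed by (intro cancellation_identities)
  also have "\<dots> = \<Gamma> (\<Gamma> \<theta>)"
    unfolding \<theta>_def using l by simp
  finally have \<Gamma>\<Gamma>: "\<Gamma> (\<Gamma> \<theta>) = \<theta>"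
    by simp
  then have "\<Gamma> \<theta> = \<theta>"
    using relations(2)[of \<theta>] \<theta>(1) by simp
  then have "B \<theta> = \<theta>"
    using \<theta> by (metis fixed_by_A5 beta_closed)
  moreover have "B \<theta> = \<ominus> \<theta>"
    using \<theta> by (rule beta_inverts)
  ultimately have "\<theta> \<oplus> \<theta> = \<zero>"
    using r_neg[OF \<theta>(1)] by simp
  then have "\<theta> = \<zero>"
    by (rule double_eq_zero[OF \<theta>(1)])
  then have "\<psi> (\<psi> l) = \<ominus> (\<ominus> (\<psi> l \<oplus> l))"
    unfolding \<theta>_def using l by (intro minus_equality[symmetric]) simp_all
  then show ?thesis
    using l by simp
qed

text \<open>
  The three orbits of words contribute \<open>2\<psi>l\<close>, \<open>2l\<close> and \<open>2\<psi>l - 2l\<close>: in each orbit the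
  components of the images outside \<open>L\<close> cancel.
\<close>

lemma sum_over_five_cycles:
  assumes l: "l \<in> carrier V" "A l = l"
  shows "finsum V (\<lambda>g. act g l) (set five_cycle_words) = [(4::nat)] \<cdot> \<psi> l"
proof -
  have closed: "(\<lambda>g. act g l) \<in> set five_cycle_words \<rightarrow> carrier V"
    using l by (auto simp: five_cycle_words_def comp_closed)
  have "finsum V (\<lambda>g. act g l) (set five_cycle_words) = \<psi> l \<oplus> \<psi> l \<oplus> \<psi> l \<oplus> \<psi> l"
    unfolding finsum_distinct_list[OF distinct_five_cycle_words closed]
    using l by (simp add: five_cycle_words_def act_comp comp_closed A_\<Gamma> A_\<Gamma>\<Gamma> \<psi>_squared)
       (rule class_sum_identity; simp)
  then show ?thesis
    using l by (simp add: eval_nat_numeral)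
qed

text \<open>
  The vector with coordinates \<open>l\<^sub>1, l\<^sub>2, l\<^sub>3\<close> in the icosahedral basis: \<open>e\<^sub>3\<close> is fixed by \<open>\<alpha>\<close>, \<open>e\<^sub>2 = \<gamma>e\<^sub>3\<close> and
  \<open>e\<^sub>1 = \<gamma>\<^sup>2e\<^sub>3\<close>.
\<close>

definition combine :: "'v \<Rightarrow> 'v \<Rightarrow> 'v \<Rightarrow> 'v"
  where "combine l1 l2 l3 = \<Gamma> (\<Gamma> l1) \<oplus> \<Gamma> l2 \<oplus> l3"

text \<open>
  The right-hand sides are the rows of the matrix with \<open>2\<close> on the diagonal and \<open>\<psi>\<close> elsewhere, applied
  to \<open>(l\<^sub>1, l\<^sub>2, l\<^sub>3)\<close>.
\<close>

lemma combine_traces: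
  assumes l1: "l1 \<in> carrier V" "A l1 = l1" and l2: "l2 \<in> carrier V" "A l2 = l2"
    and l3: "l3 \<in> carrier V" "A l3 = l3"
  defines "v \<equiv> combine l1 l2 l3"
  shows "v \<oplus> A v = \<psi> l1 \<oplus> \<psi> l2 \<oplus> l3 \<oplus> l3"
    and "\<Gamma> v \<oplus> A (\<Gamma> v) = \<psi> l2 \<oplus> \<psi> l3 \<oplus> l1 \<oplus> l1"
    and "\<Gamma> (\<Gamma> v) \<oplus> A (\<Gamma> (\<Gamma> v)) = \<psi> l1 \<oplus> \<psi> l3 \<oplus> l2 \<oplus> l2"
  using assms(1-6) by (simp_all add: v_def combine_def A_\<Gamma> A_\<Gamma>\<Gamma> a_ac r_neg r_neg1 r_neg2)

lemma combine_closed [simp]: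
  "\<lbrakk>l1 \<in> carrier V; l2 \<in> carrier V; l3 \<in> carrier V\<rbrakk> \<Longrightarrow> combine l1 l2 l3 \<in> carrier V"
  by (simp add: combine_def)

text \<open>
  Because \<open>(2 - \<psi>)(1 + \<psi>) = 1\<close>.
\<close>

lemma \<psi>_not_two:
  assumes l: "l \<in> carrier V" "A l = l" and "l \<oplus> l = \<psi> l"
  shows "l = \<zero>"
proof -
  have "\<psi> l \<oplus> l = \<psi> l \<oplus> \<psi> l"
    using \<psi>_squared[OF l] arg_cong[OF assms(3), of \<psi>] l(1) by simp
  then have "l = \<psi> l"
    using l(1) add.right_cancel[of "\<psi> l" l "\<psi> l"] by (simp add: a_comm)
  then show ?thesis
    using assms(3) l(1) by (metis add.l_cancel_one')
qed

text \<open>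
  For \<open>\<sigma> = l\<^sub>1 + l\<^sub>2 + l\<^sub>3\<close>, the sum of the three rows is \<open>2(1 + \<psi>)\<sigma> = 0\<close>, whence \<open>\<sigma> = 0\<close>.  Each row then
  reduces to \<open>(2 - \<psi>)l = 0\<close>.
\<close>

lemma combine_eq_zero:
  assumes l1: "l1 \<in> carrier V" "A l1 = l1" and l2: "l2 \<in> carrier V" "A l2 = l2"
    and l3: "l3 \<in> carrier V" "A l3 = l3"
    and zero: "combine l1 l2 l3 = \<zero>"
  shows "l1 = \<zero>" "l2 = \<zero>" "l3 = \<zero>"
proof -
  have eqs: "\<psi> l1 \<oplus> \<psi> l2 \<oplus> l3 \<oplus> l3 = \<zero>" "\<psi> l2 \<oplus> \<psi> l3 \<oplus> l1 \<oplus> l1 = \<zero>"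
    "\<psi> l1 \<oplus> \<psi> l3 \<oplus> l2 \<oplus> l2 = \<zero>"
    unfolding combine_traces[OF l1 l2 l3, symmetric] zero by simp_all
  let ?\<sigma> = "l1 \<oplus> l2 \<oplus> l3"
  have \<sigma>: "?\<sigma> \<in> carrier V" "A ?\<sigma> = ?\<sigma>"
    using assms by simp_all
  have \<psi>\<sigma>: "\<psi> ?\<sigma> = \<psi> l1 \<oplus> \<psi> l2 \<oplus> \<psi> l3"
    using assms by simp
  have closed: "\<psi> l1 \<in> carrier V" "\<psi> l2 \<in> carrier V" "\<psi> l3 \<in> carrier V"
    using assms by simp_all
  note identities = gram_sum_identity[OF l1(1) l2(1) l3(1) closed]
  have "?\<sigma> \<oplus> \<psi> ?\<sigma> = \<zero>"
  proof (rule double_eq_zero)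
    show "(?\<sigma> \<oplus> \<psi> ?\<sigma>) \<oplus> (?\<sigma> \<oplus> \<psi> ?\<sigma>) = \<zero>"
      unfolding \<psi>\<sigma> identities(1) eqs by simp
  qed (use \<sigma> in simp)
  moreover have "\<psi> (?\<sigma> \<oplus> \<psi> ?\<sigma>) = \<psi> ?\<sigma> \<oplus> (\<psi> ?\<sigma> \<oplus> ?\<sigma>)"
    using \<psi>_squared[OF \<sigma>] \<sigma>(1) by (simp only: \<psi>_linear \<psi>_closed)
  ultimately have "\<psi> ?\<sigma> = \<zero>"
    using \<sigma>(1) by (metis a_comm \<psi>_closed \<psi>_zero r_zero)
  then have zero': "\<psi> l1 \<oplus> \<psi> l2 \<oplus> \<psi> l3 = \<zero>"
    by (simp only: \<psi>\<sigma>)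
  show "l1 = \<zero>" "l2 = \<zero>" "l3 = \<zero>"
    using identities(2-4) eqs zero' closed l1 l2 l3 by (intro \<psi>_not_two; simp)+
qed

text \<open>
  On such a vector \<open>(\<alpha>\<gamma>)\<^sup>3\<close> is \<open>-1\<close> and \<open>(\<alpha>\<gamma>)\<^sup>-\<^sup>2\<close> is \<open>\<gamma>\<close>, so \<open>\<gamma>w = -w\<close>.  Then \<open>\<gamma>\<^sup>3 = 1\<close>
  gives \<open>w = -w\<close>.
\<close>

lemma antifixed_eq_zero:
  assumes w: "w \<in> carrier V" and anti: "A w = \<ominus> w" "A (\<Gamma> w) = \<ominus> \<Gamma> w" "A (\<Gamma> (\<Gamma> w)) = \<ominus> \<Gamma> (\<Gamma> w)"
  shows "w = \<zero>"
proof -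
  have "\<Gamma> w = \<ominus> w"
    using relations(5)[OF w] w by (simp add: anti)
  then have "\<Gamma> (\<Gamma> (\<Gamma> w)) = \<ominus> w"
    using w by simp
  then have "w = \<ominus> w"
    using w by simp
  then have "w \<oplus> w = \<zero>"
    using r_neg[OF w] by simp
  then show ?thesis
    by (rule double_eq_zero[OF w])
qed

text \<open>
  Solve the linear system for the three traces of \<open>v\<close>.  The sum \<open>t\<close> of the unknowns satisfies
  \<open>2(1 + \<psi>)t = \<Sigma>\<close>, where \<open>\<Sigma>\<close> is the sum of the traces, so \<open>2t = (2 - \<psi>)\<Sigma>\<close>; the row of the unknown \<open>x\<close> with
  trace \<open>s\<close> then reads \<open>(2 - \<psi>)x = s - \<psi>t\<close>, so \<open>x = (1 + \<psi>)(s - \<psi>t)\<close>.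
\<close>

lemma combine_surj:
  assumes v: "v \<in> carrier V"
  obtains l1 l2 l3 where "l1 \<in> L" "l2 \<in> L" "l3 \<in> L" "v = combine l1 l2 l3"
proof -
  define s1 where "s1 = \<Gamma> v \<oplus> A (\<Gamma> v)"
  define s2 where "s2 = \<Gamma> (\<Gamma> v) \<oplus> A (\<Gamma> (\<Gamma> v))"
  define s3 where "s3 = v \<oplus> A v"
  define \<Sigma> where "\<Sigma> = s1 \<oplus> s2 \<oplus> s3"
  have s: "s1 \<in> carrier V" "s2 \<in> carrier V" "s3 \<in> carrier V" "A s1 = s1" "A s2 = s2" "A s3 = s3"
    using v unfolding s1_def s2_def s3_def by (simp_all add: a_comm)
  have \<Sigma>: "\<Sigma> \<in> carrier V" "A \<Sigma> = \<Sigma>"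
    using s by (simp_all add: \<Sigma>_def)
  obtain t where t: "t \<in> carrier V" "\<Sigma> \<oplus> \<Sigma> \<oplus> \<ominus> \<psi> \<Sigma> = t \<oplus> t"
    using \<Sigma> halve[of "\<Sigma> \<oplus> \<Sigma> \<oplus> \<ominus> \<psi> \<Sigma>"] by auto
  have "A t = t"
  proof (rule double_inject)
    have "A t \<oplus> A t = A (t \<oplus> t)"
      using t(1) by simp
    also have "\<dots> = t \<oplus> t"
      unfolding t(2)[symmetric] using \<Sigma> by simp
    finally show "A t \<oplus> A t = t \<oplus> t" .
  qed (use t(1) in simp_all)
  have \<Sigma>_t: "\<Sigma> = (t \<oplus> t) \<oplus> (\<psi> t \<oplus> \<psi> t)"
  proof -
    have "\<psi> t \<oplus> \<psi> t = \<psi> (\<Sigma> \<oplus> \<Sigma> \<oplus> \<ominus> \<psi> \<Sigma>)"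
      unfolding t(2) using t(1) by simp
    also have "\<dots> = \<psi> \<Sigma> \<oplus> \<psi> \<Sigma> \<oplus> \<ominus> (\<psi> \<Sigma> \<oplus> \<Sigma>)"
      using \<Sigma> by (simp add: \<psi>_squared)
    finally show ?thesis
      using sigma_identity[of "\<psi> \<Sigma>" \<Sigma>] \<Sigma>(1) t(2) by simp
  qed
  have \<psi>\<Sigma>_t: "\<psi> \<Sigma> = (\<psi> t \<oplus> \<psi> t) \<oplus> ((\<psi> t \<oplus> t) \<oplus> (\<psi> t \<oplus> t))"
    unfolding \<Sigma>_t using t(1) \<open>A t = t\<close> by (simp add: \<psi>_squared)
  \<comment> \<open>This is \<open>(1 + \<psi>)(s - \<psi>t)\<close>, simplified by \<open>\<psi>\<^sup>2 = \<psi> + 1\<close>.\<close>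
  define solution where "solution s = s \<oplus> \<psi> s \<oplus> \<ominus> (\<psi> t \<oplus> \<psi> t \<oplus> t)" for s
  have solution: "solution s \<in> carrier V" "A (solution s) = solution s"
    "\<psi> (solution s) = \<psi> s \<oplus> (\<psi> s \<oplus> s) \<oplus> \<ominus> ((\<psi> t \<oplus> t) \<oplus> (\<psi> t \<oplus> t) \<oplus> \<psi> t)"
    if "s \<in> carrier V" "A s = s" for s
    using that t(1) \<open>A t = t\<close> by (simp_all add: solution_def \<psi>_squared)
  have gram: "\<psi> (solution a) \<oplus> \<psi> (solution b) \<oplus> solution c \<oplus> solution c = c"
    if abc: "a \<in> carrier V" "A a = a" "b \<in> carrier V" "A b = b" "c \<in> carrier V" "A c = c"
      and sum: "a \<oplus> b \<oplus> c = \<Sigma>" for a b c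
  proof -
    have closed: "\<psi> a \<in> carrier V" "\<psi> b \<in> carrier V" "\<psi> c \<in> carrier V" "\<psi> t \<in> carrier V"
      using abc t(1) by simp_all
    have \<psi>sum: "\<psi> a \<oplus> \<psi> b \<oplus> \<psi> c = \<psi> \<Sigma>"
      unfolding sum[symmetric] using abc by simp
    have "\<psi> (solution a) \<oplus> \<psi> (solution b) \<oplus> solution c \<oplus> solution c =
        c \<oplus> (\<Sigma> \<oplus> \<psi> \<Sigma> \<oplus> \<psi> \<Sigma>) \<oplus> \<ominus> (\<Sigma> \<oplus> \<psi> \<Sigma> \<oplus> \<psi> \<Sigma>)"
      unfolding solution(3)[OF abc(1,2)] solution(3)[OF abc(3,4)]
      unfolding solution_def
        gram_inverse_identity[OF abc(1,3,5) closed(1-3) t(1) closed(4)] sum \<psi>sum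
        \<psi>\<Sigma>_t[symmetric] \<Sigma>_t[symmetric] ..
    then show ?thesis
      using \<Sigma> abc(5) by (simp add: a_assoc r_neg)
  qed
  let ?c = "combine (solution s1) (solution s2) (solution s3)"
  define w where "w = v \<oplus> \<ominus> ?c"
  note sol = solution(1,2)[OF s(1,4)] solution(1,2)[OF s(2,5)] solution(1,2)[OF s(3,6)]
  have c: "?c \<in> carrier V"
    using sol by simp
  have sums: "s1 \<oplus> s2 \<oplus> s3 = \<Sigma>" "s2 \<oplus> s3 \<oplus> s1 = \<Sigma>" "s1 \<oplus> s3 \<oplus> s2 = \<Sigma>"
    using s by (simp_all add: \<Sigma>_def a_ac)
  have traces: "?c \<oplus> A ?c = v \<oplus> A v" "\<Gamma> ?c \<oplus> A (\<Gamma> ?c) = \<Gamma> v \<oplus> A (\<Gamma> v)"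
    "\<Gamma> (\<Gamma> ?c) \<oplus> A (\<Gamma> (\<Gamma> ?c)) = \<Gamma> (\<Gamma> v) \<oplus> A (\<Gamma> (\<Gamma> v))"
    unfolding combine_traces[OF sol] s1_def[symmetric] s2_def[symmetric] s3_def[symmetric]
    using s sums by (auto intro!: gram)
  have anti: "A (x \<oplus> \<ominus> y) = \<ominus> (x \<oplus> \<ominus> y)"
    if "x \<in> carrier V" "y \<in> carrier V" "y \<oplus> A y = x \<oplus> A x" for x y
  proof (rule minus_equality[symmetric])
    have "A (x \<oplus> \<ominus> y) \<oplus> (x \<oplus> \<ominus> y) = (x \<oplus> A x) \<oplus> \<ominus> (y \<oplus> A y)"
      using that(1,2) by (simp add: minus_add a_ac)
    then show "A (x \<oplus> \<ominus> y) \<oplus> (x \<oplus> \<ominus> y) = \<zero>"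
      unfolding that(3) using that(1) by (simp add: r_neg)
  qed (use that in simp_all)
  have "w = \<zero>"
  proof (rule antifixed_eq_zero)
    show "A w = \<ominus> w"
      unfolding w_def by (rule anti[OF v c traces(1)])
    show "A (\<Gamma> w) = \<ominus> \<Gamma> w"
      using anti[OF _ _ traces(2)] v c by (simp add: w_def)
    show "A (\<Gamma> (\<Gamma> w)) = \<ominus> \<Gamma> (\<Gamma> w)"
      using anti[OF _ _ traces(3)] v c by (simp add: w_def)
  qed (use v c in \<open>simp add: w_def\<close>)
  then have "v = ?c"
    using v c minus_equality[of v "\<ominus> ?c"] by (simp add: w_def)
  then show thesis
    using that[of "solution s1" "solution s2" "solution s3"] sol by (simp add: L_iff)
qed

end

section \<open>A universal property of \<open>Icosa(L)\<close>\<close>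

text \<open>
  A balanced biadditive map out of \<open>Icosa(R) \<times> N\<close> for which every vector is a unique combination of
  the values at the three basis vectors.  Such a map induces an isomorphism from the tensor
  product.  By additivity, uniqueness at zero suffices.
\<close>

locale icosa_bilinear = N: module Zphi N + V: abelian_group V
  for N :: "(int \<times> int, 'l, 'n) module_scheme" and V :: "('v, 'm) ring_scheme" +
  fixes b :: "icosa_vec \<Rightarrow> 'l \<Rightarrow> 'v"
  assumes b_closed: "l \<in> carrier N \<Longrightarrow> b x l \<in> carrier V"
    and b_add_left: "l \<in> carrier N \<Longrightarrow> b (x \<oplus>\<^bsub>Icosa_R\<^esub> y) l = b x l \<oplus>\<^bsub>V\<^esub> b y l"
    and b_add_right: "\<lbrakk>l \<in> carrier N; l' \<in> carrier N\<rbrakk> \<Longrightarrow> b x (l \<oplus>\<^bsub>N\<^esub> l') = b x l \<oplus>\<^bsub>V\<^esub> b x l'"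
    and b_balanced: "l \<in> carrier N \<Longrightarrow> b (r \<odot>\<^bsub>Icosa_R\<^esub> x) l = b x (r \<odot>\<^bsub>N\<^esub> l)"
    and b_surj: "v \<in> carrier V \<Longrightarrow> \<exists>l1 \<in> carrier N. \<exists>l2 \<in> carrier N. \<exists>l3 \<in> carrier N.
      v = b e1 l1 \<oplus>\<^bsub>V\<^esub> b e2 l2 \<oplus>\<^bsub>V\<^esub> b e3 l3"
    and b_inj: "\<lbrakk>l1 \<in> carrier N; l2 \<in> carrier N; l3 \<in> carrier N;
      b e1 l1 \<oplus>\<^bsub>V\<^esub> b e2 l2 \<oplus>\<^bsub>V\<^esub> b e3 l3 = \<zero>\<^bsub>V\<^esub>\<rbrakk> \<Longrightarrow> l1 = \<zero>\<^bsub>N\<^esub> \<and> l2 = \<zero>\<^bsub>N\<^esub> \<and> l3 = \<zero>\<^bsub>N\<^esub>"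
begin

abbreviation F :: "(icosa_vec \<times> 'l \<Rightarrow>\<^sub>0 int) monoid"
  where "F \<equiv> tensor_free Icosa_R N"

abbreviation K :: "(icosa_vec \<times> 'l \<Rightarrow>\<^sub>0 int) set"
  where "K \<equiv> tensor_kernel Zphi Icosa_R N"

lemma vec_in_Icosa_R: "x \<in> carrier Icosa_R"
  by (simp add: Icosa_R_simps(1))

lemma F_carrier: "x \<in> carrier F \<longleftrightarrow> Poly_Mapping.keys x \<subseteq> carrier Icosa_R \<times> carrier N"
  by simp

lemma frag_in_F: "l \<in> carrier N \<Longrightarrow> frag_of (x, l) \<in> carrier F"
  using vec_in_Icosa_R by simp

lemma F_add: "\<lbrakk>x \<in> carrier F; y \<in> carrier F\<rbrakk> \<Longrightarrow> x + y \<in> carrier F"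
  using monoid.m_closed[OF group.is_monoid[OF group_free_Abelian_group], of x "carrier Icosa_R \<times> carrier N" y]
  by (simp only: mult_free_Abelian_group)

lemma F_diff: "\<lbrakk>x \<in> carrier F; y \<in> carrier F\<rbrakk> \<Longrightarrow> x - y \<in> carrier F"
  unfolding F_carrier using keys_diff[of x y] by blast

lemma tensor_relations_cases:
  assumes "z \<in> tensor_relations Zphi Icosa_R N"
  obtains (add_left) x y l where "l \<in> carrier N"
      "z = frag_of (x \<oplus>\<^bsub>Icosa_R\<^esub> y, l) - frag_of (x, l) - frag_of (y, l)"
    | (add_right) x l l' where "l \<in> carrier N" "l' \<in> carrier N"
      "z = frag_of (x, l \<oplus>\<^bsub>N\<^esub> l') - frag_of (x, l) - frag_of (x, l')"
    | (balanced) r x l where "l \<in> carrier N"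
      "z = frag_of (r \<odot>\<^bsub>Icosa_R\<^esub> x, l) - frag_of (x, r \<odot>\<^bsub>N\<^esub> l)"
  using assms unfolding tensor_relations_def
  by (elim UnE CollectE exE conjE) (rule that; assumption)+

lemma smult_in_N: "l \<in> carrier N \<Longrightarrow> r \<odot>\<^bsub>N\<^esub> l \<in> carrier N"
  by (simp add: N.smult_closed Zphi_simps(1))

lemma relations_in_F: "tensor_relations Zphi Icosa_R N \<subseteq> carrier F"
proof
  fix z assume "z \<in> tensor_relations Zphi Icosa_R N"
  then show "z \<in> carrier F"
    by (cases rule: tensor_relations_cases)
      (simp_all only: F_diff frag_in_F smult_in_N N.M.a_closed)
qed

lemma K_subgroup: "subgroup K F"
  unfolding tensor_kernel_def by (rule group.generate_is_subgroup[OF group_free_Abelian_group relations_in_F])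

lemma K_in_F: "x \<in> K \<Longrightarrow> x \<in> carrier F"
  by (rule subgroup.mem_carrier[OF K_subgroup])

lemma K_zero: "0 \<in> K"
  using subgroup.one_closed[OF K_subgroup] by simp

lemma K_add: "\<lbrakk>x \<in> K; y \<in> K\<rbrakk> \<Longrightarrow> x + y \<in> K"
  using subgroup.m_closed[OF K_subgroup, of x y] by (simp only: mult_free_Abelian_group)

lemma K_minus: "x \<in> K \<Longrightarrow> - x \<in> K"
  using subgroup.m_inv_closed[OF K_subgroup, of x] K_in_F[of x] by simp

lemma K_diff: "\<lbrakk>x \<in> K; y \<in> K\<rbrakk> \<Longrightarrow> x - y \<in> K"
  using K_add[of x "- y"] K_minus[of y] by simp

lemma relation_in_K: "x \<in> tensor_relations Zphi Icosa_R N \<Longrightarrow> x \<in> K"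
  unfolding tensor_kernel_def by (rule generate.incl)

lemma K_add_left:
  assumes "l \<in> carrier N"
  shows "frag_of (x \<oplus>\<^bsub>Icosa_R\<^esub> y, l) - frag_of (x, l) - frag_of (y, l) \<in> K"
  by (rule relation_in_K, unfold tensor_relations_def, rule UnI1, rule UnI1, rule CollectI)
    (use assms vec_in_Icosa_R in blast)

lemma K_add_right:
  assumes "l \<in> carrier N" "l' \<in> carrier N"
  shows "frag_of (x, l \<oplus>\<^bsub>N\<^esub> l') - frag_of (x, l) - frag_of (x, l') \<in> K"
  by (rule relation_in_K, unfold tensor_relations_def, rule UnI1, rule UnI2, rule CollectI)
    (use assms vec_in_Icosa_R in blast)

lemma K_balanced:
  assumes "l \<in> carrier N"
  shows "frag_of (r \<odot>\<^bsub>Icosa_R\<^esub> x, l) - frag_of (x, r \<odot>\<^bsub>N\<^esub> l) \<in> K"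
  by (rule relation_in_K, unfold tensor_relations_def, rule UnI2, rule CollectI)
    (use assms vec_in_Icosa_R Zphi_simps(1) in blast)

lemma K_null: "frag_of (x, \<zero>\<^bsub>N\<^esub>) \<in> K"
  using K_minus[OF K_add_right[of "\<zero>\<^bsub>N\<^esub>" "\<zero>\<^bsub>N\<^esub>" x]] by simp

lemma K_diff_right:
  assumes "l \<in> carrier N" "l' \<in> carrier N"
  shows "frag_of (x, l \<oplus>\<^bsub>N\<^esub> \<ominus>\<^bsub>N\<^esub> l') - (frag_of (x, l) - frag_of (x, l')) \<in> K"
proof -
  have "(l \<oplus>\<^bsub>N\<^esub> \<ominus>\<^bsub>N\<^esub> l') \<oplus>\<^bsub>N\<^esub> l' = l"
    using assms by (simp add: N.M.a_assoc N.M.l_neg)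
  then show ?thesis
    using K_minus[OF K_add_right[of "l \<oplus>\<^bsub>N\<^esub> \<ominus>\<^bsub>N\<^esub> l'" l' x]] assms by (simp add: algebra_simps)
qed

text \<open>
  Modulo the tensor relations, the generator \<open>x \<otimes> l\<close> with \<open>x = x\<^sub>1e\<^sub>1 + x\<^sub>2e\<^sub>2 + x\<^sub>3e\<^sub>3\<close> becomes
  \<open>e\<^sub>1 \<otimes> x\<^sub>1l + e\<^sub>2 \<otimes> x\<^sub>2l + e\<^sub>3 \<otimes> x\<^sub>3l\<close>, and such sums form a subgroup.
\<close>

lemma normal_form:
  assumes "x \<in> carrier F"
  shows "\<exists>l1 \<in> carrier N. \<exists>l2 \<in> carrier N. \<exists>l3 \<in> carrier N.
    x - (frag_of (e1, l1) + frag_of (e2, l2) + frag_of (e3, l3)) \<in> K"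
  using assms unfolding F_carrier
proof (induction x rule: free_Abelian_group_induct[consumes 1, case_names zero diff frag])
  case zero
  have "0 - (frag_of (e1, \<zero>\<^bsub>N\<^esub>) + frag_of (e2, \<zero>\<^bsub>N\<^esub>) + frag_of (e3, \<zero>\<^bsub>N\<^esub>)) \<in> K"
    by (intro K_diff K_zero K_add K_null)
  then show ?case
    using N.M.zero_closed by blast
next
  case (diff x y)
  from diff(3) obtain l1 l2 l3 where l: "l1 \<in> carrier N" "l2 \<in> carrier N" "l3 \<in> carrier N"
    and x: "x - (frag_of (e1, l1) + frag_of (e2, l2) + frag_of (e3, l3)) \<in> K"
    by blast
  from diff(4) obtain l1' l2' l3' where l': "l1' \<in> carrier N" "l2' \<in> carrier N" "l3' \<in> carrier N"
    and y: "y - (frag_of (e1, l1') + frag_of (e2, l2') + frag_of (e3, l3')) \<in> K"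
    by blast
  let ?d1 = "frag_of (e1, l1 \<oplus>\<^bsub>N\<^esub> \<ominus>\<^bsub>N\<^esub> l1') - (frag_of (e1, l1) - frag_of (e1, l1'))"
  let ?d2 = "frag_of (e2, l2 \<oplus>\<^bsub>N\<^esub> \<ominus>\<^bsub>N\<^esub> l2') - (frag_of (e2, l2) - frag_of (e2, l2'))"
  let ?d3 = "frag_of (e3, l3 \<oplus>\<^bsub>N\<^esub> \<ominus>\<^bsub>N\<^esub> l3') - (frag_of (e3, l3) - frag_of (e3, l3'))"
  have d: "?d1 \<in> K" "?d2 \<in> K" "?d3 \<in> K"
    using l l' by (auto intro: K_diff_right)
  have "(x - (frag_of (e1, l1) + frag_of (e2, l2) + frag_of (e3, l3)))
      - (y - (frag_of (e1, l1') + frag_of (e2, l2') + frag_of (e3, l3'))) - (?d1 + ?d2 + ?d3) \<in> K"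
    by (rule K_diff[OF K_diff[OF x y] K_add[OF K_add[OF d(1,2)] d(3)]])
  then have "x - y - (frag_of (e1, l1 \<oplus>\<^bsub>N\<^esub> \<ominus>\<^bsub>N\<^esub> l1') + frag_of (e2, l2 \<oplus>\<^bsub>N\<^esub> \<ominus>\<^bsub>N\<^esub> l2')
      + frag_of (e3, l3 \<oplus>\<^bsub>N\<^esub> \<ominus>\<^bsub>N\<^esub> l3')) \<in> K"
    by (simp add: algebra_simps)
  then show ?case
    using l l' N.M.a_closed N.M.a_inv_closed by blast
next
  case (frag a)
  then obtain x l where a: "a = (x, l)" "l \<in> carrier N"
    by blast
  define x1 x2 x3 where "x1 = fst x" and "x2 = fst (snd x)" and "x3 = snd (snd x)"
  have x: "x = x1 \<odot>\<^bsub>Icosa_R\<^esub> e1 \<oplus>\<^bsub>Icosa_R\<^esub> x2 \<odot>\<^bsub>Icosa_R\<^esub> e2 \<oplus>\<^bsub>Icosa_R\<^esub> x3 \<odot>\<^bsub>Icosa_R\<^esub> e3"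
    unfolding x1_def x2_def x3_def by (rule icosa_basis)
  have l: "x1 \<odot>\<^bsub>N\<^esub> l \<in> carrier N" "x2 \<odot>\<^bsub>N\<^esub> l \<in> carrier N" "x3 \<odot>\<^bsub>N\<^esub> l \<in> carrier N"
    using a(2) by (simp_all add: smult_in_N)
  have "frag_of (x, l) - (frag_of (e1, x1 \<odot>\<^bsub>N\<^esub> l) + frag_of (e2, x2 \<odot>\<^bsub>N\<^esub> l) + frag_of (e3, x3 \<odot>\<^bsub>N\<^esub> l)) =
      (frag_of (x, l) - frag_of (x1 \<odot>\<^bsub>Icosa_R\<^esub> e1 \<oplus>\<^bsub>Icosa_R\<^esub> x2 \<odot>\<^bsub>Icosa_R\<^esub> e2, l) - frag_of (x3 \<odot>\<^bsub>Icosa_R\<^esub> e3, l))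
      + (frag_of (x1 \<odot>\<^bsub>Icosa_R\<^esub> e1 \<oplus>\<^bsub>Icosa_R\<^esub> x2 \<odot>\<^bsub>Icosa_R\<^esub> e2, l)
          - frag_of (x1 \<odot>\<^bsub>Icosa_R\<^esub> e1, l) - frag_of (x2 \<odot>\<^bsub>Icosa_R\<^esub> e2, l))
      + (frag_of (x1 \<odot>\<^bsub>Icosa_R\<^esub> e1, l) - frag_of (e1, x1 \<odot>\<^bsub>N\<^esub> l))
      + (frag_of (x2 \<odot>\<^bsub>Icosa_R\<^esub> e2, l) - frag_of (e2, x2 \<odot>\<^bsub>N\<^esub> l))
      + (frag_of (x3 \<odot>\<^bsub>Icosa_R\<^esub> e3, l) - frag_of (e3, x3 \<odot>\<^bsub>N\<^esub> l))"
    by (simp add: algebra_simps)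
  also have "\<dots> \<in> K"
    using a(2) by (subst (1) x) (intro K_add K_add_left K_balanced)
  finally show ?case
    unfolding a(1) using l by blast
qed

text \<open>
  The extension of \<open>b\<close> to the free abelian group on pairs, chosen by its universal property.
\<close>

definition evaluation :: "(icosa_vec \<times> 'l \<Rightarrow>\<^sub>0 int) \<Rightarrow> 'v"
  where "evaluation = (SOME h. h \<in> hom F (add_monoid V) \<and>
    (\<forall>x. \<forall>l \<in> carrier N. h (frag_of (x, l)) = b x l))"

lemma evaluation:
  "evaluation \<in> hom F (add_monoid V)" "l \<in> carrier N \<Longrightarrow> evaluation (frag_of (x, l)) = b x l"
proof -
  have "case_prod b ` (carrier Icosa_R \<times> carrier N) \<subseteq> carrier V"
    using b_closed by auto
  then obtain h where "h \<in> hom F (add_monoid V)"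
      "\<And>x. x \<in> carrier Icosa_R \<times> carrier N \<Longrightarrow> h (frag_of x) = case_prod b x"
    by (rule comm_group.free_Abelian_group_universal[OF V.a_comm_group, simplified]) (rule that)
  then have "h \<in> hom F (add_monoid V) \<and> (\<forall>x. \<forall>l \<in> carrier N. h (frag_of (x, l)) = b x l)"
    using vec_in_Icosa_R by simp
  then have "\<exists>h. h \<in> hom F (add_monoid V) \<and> (\<forall>x. \<forall>l \<in> carrier N. h (frag_of (x, l)) = b x l)"
    by blast
  from someI_ex[OF this, folded evaluation_def] have "evaluation \<in> hom F (add_monoid V) \<and>
      (\<forall>x. \<forall>l \<in> carrier N. evaluation (frag_of (x, l)) = b x l)" .
  then show "evaluation \<in> hom F (add_monoid V)" "l \<in> carrier N \<Longrightarrow> evaluation (frag_of (x, l)) = b x l"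
    by blast+
qed

lemma evaluation_closed: "x \<in> carrier F \<Longrightarrow> evaluation x \<in> carrier V"
  using hom_in_carrier[OF evaluation(1)] by simp

lemma evaluation_add:
  "\<lbrakk>x \<in> carrier F; y \<in> carrier F\<rbrakk> \<Longrightarrow> evaluation (x + y) = evaluation x \<oplus>\<^bsub>V\<^esub> evaluation y"
  using hom_mult[OF evaluation(1), of x y] by simp

lemma evaluation_group_hom: "group_hom F (add_monoid V) evaluation"
  by (intro group_hom.intro group_hom_axioms.intro group_free_Abelian_group V.a_group evaluation(1))

lemma evaluation_zero: "evaluation 0 = \<zero>\<^bsub>V\<^esub>"
  using group_hom.hom_one[OF evaluation_group_hom] by simp

lemma evaluation_diff:
  assumes "x \<in> carrier F" "y \<in> carrier F"
  shows "evaluation (x - y) = evaluation x \<oplus>\<^bsub>V\<^esub> \<ominus>\<^bsub>V\<^esub> evaluation y"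
proof -
  have "evaluation (x - y) \<oplus>\<^bsub>V\<^esub> evaluation y = evaluation x"
    using evaluation_add[OF F_diff[OF assms] assms(2)] by simp
  then show ?thesis
    using assms F_diff[OF assms] evaluation_closed
    by (metis V.a_assoc V.a_inv_closed V.r_neg V.r_zero)
qed

text \<open>
  The tensor relations hold in \<open>V\<close>.  Conversely, an element of the kernel has a normal form that is
  also in the kernel, and by the injectivity assumption all three of its coordinates vanish.
\<close>

lemma kernel_evaluation: "kernel F (add_monoid V) evaluation = K"
proof
  have cancel: "u \<oplus>\<^bsub>V\<^esub> (v \<oplus>\<^bsub>V\<^esub> (\<ominus>\<^bsub>V\<^esub> u \<oplus>\<^bsub>V\<^esub> \<ominus>\<^bsub>V\<^esub> v)) = \<zero>\<^bsub>V\<^esub>"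
    if "u \<in> carrier V" "v \<in> carrier V" for u v
    using V.r_neg[of "u \<oplus>\<^bsub>V\<^esub> v"] that by (simp add: V.minus_add V.a_assoc)
  have "x \<in> kernel F (add_monoid V) evaluation" if "x \<in> tensor_relations Zphi Icosa_R N" for x
  proof -
    have "evaluation x = \<zero>\<^bsub>V\<^esub>"
      using that
      by (cases rule: tensor_relations_cases)
        (simp_all add: evaluation_diff F_diff frag_in_F evaluation(2) smult_in_N b_closed
          b_add_left b_add_right b_balanced V.minus_add V.r_neg V.a_ac cancel
          del: carrier_free_Abelian_group_iff frag_of_in_free_Abelian_group)
    moreover have "x \<in> carrier F"
      using that relations_in_F by blast
    ultimately show ?thesis
      by (simp add: kernel_def)
  qed
  then show "K \<subseteq> kernel F (add_monoid V) evaluation"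
    unfolding tensor_kernel_def
    by (intro group.generate_subgroup_incl[OF group_free_Abelian_group]
        group_hom.subgroup_kernel[OF evaluation_group_hom]) blast
  show "kernel F (add_monoid V) evaluation \<subseteq> K"
  proof
    fix x assume "x \<in> kernel F (add_monoid V) evaluation"
    then have x: "x \<in> carrier F" "evaluation x = \<zero>\<^bsub>V\<^esub>"
      by (auto simp: kernel_def)
    obtain l1 l2 l3 where l: "l1 \<in> carrier N" "l2 \<in> carrier N" "l3 \<in> carrier N"
      and nf: "x - (frag_of (e1, l1) + frag_of (e2, l2) + frag_of (e3, l3)) \<in> K" (is "x - ?n \<in> K")
      using normal_form[OF x(1)] by blast
    have n: "?n \<in> carrier F" "evaluation ?n = b e1 l1 \<oplus>\<^bsub>V\<^esub> b e2 l2 \<oplus>\<^bsub>V\<^esub> b e3 l3"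
      using l by (simp_all add: F_add frag_in_F evaluation_add evaluation(2) del: carrier_free_Abelian_group_iff frag_of_in_free_Abelian_group)
    have "evaluation (x - ?n) = \<zero>\<^bsub>V\<^esub>"
      using \<open>K \<subseteq> kernel F (add_monoid V) evaluation\<close> nf by (auto simp: kernel_def)
    then have "evaluation ?n = \<zero>\<^bsub>V\<^esub>"
      using evaluation_add[OF F_diff[OF x(1) n(1)] n(1)] evaluation_closed[OF n(1)] x(2) by simp
    then have "l1 = \<zero>\<^bsub>N\<^esub>" "l2 = \<zero>\<^bsub>N\<^esub>" "l3 = \<zero>\<^bsub>N\<^esub>"
      using b_inj[OF l] n(2) by simp_all
    then have "?n \<in> K"
      using K_add K_null by simp
    from K_add[OF nf this] show "x \<in> K"
      by simp
  qed
qed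

lemma evaluation_surj: "evaluation ` carrier F = carrier V"
proof
  show "evaluation ` carrier F \<subseteq> carrier V"
    using evaluation_closed by blast
  show "carrier V \<subseteq> evaluation ` carrier F"
  proof
    fix v assume "v \<in> carrier V"
    then obtain l1 l2 l3 where l: "l1 \<in> carrier N" "l2 \<in> carrier N" "l3 \<in> carrier N"
      and v: "v = b e1 l1 \<oplus>\<^bsub>V\<^esub> b e2 l2 \<oplus>\<^bsub>V\<^esub> b e3 l3"
      using b_surj by blast
    let ?n = "frag_of (e1, l1) + frag_of (e2, l2) + frag_of (e3, l3)"
    have "?n \<in> carrier F" "evaluation ?n = v"
      using l by (simp_all add: v F_add frag_in_F evaluation_add evaluation(2) del: carrier_free_Abelian_group_iff frag_of_in_free_Abelian_group)
    then show "v \<in> evaluation ` carrier F"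
      by blast
  qed
qed

definition induced :: "(icosa_vec \<times> 'l \<Rightarrow>\<^sub>0 int) set \<Rightarrow> 'v"
  where "induced X = the_elem (evaluation ` X)"

lemma carrier_tensor: "carrier (tensor Zphi Icosa_R N) = {K #>\<^bsub>F\<^esub> x | x. x \<in> carrier F}"
  by (auto simp: tensor_def Let_def FactGroup_def RCOSETS_def)

lemma add_monoid_tensor: "add_monoid (tensor Zphi Icosa_R N) = F Mod K"
  by (simp add: tensor_def Let_def FactGroup_def)

lemma group_tensor: "group (add_monoid (tensor Zphi Icosa_R N))"
  unfolding add_monoid_tensor kernel_evaluation[symmetric]
  by (rule normal.factorgroup_is_group[OF group_hom.normal_kernel[OF evaluation_group_hom]])

lemma induced_iso: "induced \<in> iso (add_monoid (tensor Zphi Icosa_R N)) (add_monoid V)"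
  unfolding add_monoid_tensor
  using group_hom.FactGroup_iso_set[OF evaluation_group_hom] evaluation_surj
  unfolding kernel_evaluation induced_def[abs_def] by simp

lemma evaluation_K: "k \<in> K \<Longrightarrow> evaluation k = \<zero>\<^bsub>V\<^esub>"
  using kernel_evaluation by (auto simp: kernel_def)

lemma induced_coset:
  assumes "x \<in> carrier F"
  shows "induced (K #>\<^bsub>F\<^esub> x) = evaluation x"
proof -
  have "evaluation (k + x) = evaluation x" if "k \<in> K" for k
    using that evaluation_closed[OF assms] by (simp add: evaluation_add[OF K_in_F assms] evaluation_K)
  then have "evaluation ` (K #>\<^bsub>F\<^esub> x) = {evaluation x}"
    using K_zero by (auto simp: r_coset_def)
  then show ?thesis
    by (simp add: induced_def)
qed

text \<open>
  The map \<open>\<eta>\<close> that \<open>h\<close> induces on the free group is intertwined with \<open>s\<close> by evaluation.  So it preserves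
  the kernel of evaluation, and filling up the image of a coset by the kernel gives the coset of the
  image.
\<close>

lemma induced_tensor_map:
  assumes s: "s \<in> hom (add_monoid V) (add_monoid V)"
    and h: "\<And>x l. l \<in> carrier N \<Longrightarrow> b (h x) l = s (b x l)"
    and X: "X \<in> carrier (tensor Zphi Icosa_R N)"
  shows "tensor_map_left Zphi Icosa_R N h X \<in> carrier (tensor Zphi Icosa_R N)"
    and "induced (tensor_map_left Zphi Icosa_R N h X) = s (induced X)"
proof -
  let ?\<eta> = "frag_extend (\<lambda>(x, l). frag_of (h x, l)) :: (icosa_vec \<times> 'l \<Rightarrow>\<^sub>0 int) \<Rightarrow> _"
  have \<eta>: "?\<eta> x \<in> carrier F \<and> evaluation (?\<eta> x) = s (evaluation x)" if "x \<in> carrier F" for x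
    using that unfolding F_carrier[of x]
  proof (induction x rule: free_Abelian_group_induct[consumes 1, case_names zero diff frag])
    case zero
    have "s \<zero>\<^bsub>V\<^esub> = \<zero>\<^bsub>V\<^esub>"
      using hom_one[OF s V.a_group V.a_group] by simp
    then show ?case
      by (simp add: evaluation_zero)
  next
    case (diff x y)
    have "s (\<ominus>\<^bsub>V\<^esub> v) = \<ominus>\<^bsub>V\<^esub> s v" if "v \<in> carrier V" for v
      using group_hom.hom_inv[of "add_monoid V" "add_monoid V" s v] s that V.a_group
      by (simp add: group_hom_def group_hom_axioms_def a_inv_def)
    moreover have "s (v \<oplus>\<^bsub>V\<^esub> w) = s v \<oplus>\<^bsub>V\<^esub> s w" if "v \<in> carrier V" "w \<in> carrier V" for v w
      using hom_mult[OF s, of v w] that by simp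
    moreover have "x \<in> carrier F" "y \<in> carrier F"
      using diff by simp_all
    ultimately show ?case
      using diff F_diff evaluation_closed V.a_inv_closed by (simp only: frag_extend_diff evaluation_diff)
  next
    case (frag a)
    then obtain x l where "a = (x, l)" "l \<in> carrier N"
      by blast
    then show ?case
      using frag_in_F[of l "h x"] by (simp add: evaluation(2) h)
  qed
  obtain y where y: "y \<in> carrier F" "X = K #>\<^bsub>F\<^esub> y"
    using X by (auto simp: carrier_tensor)
  have \<eta>K: "?\<eta> k \<in> K" if "k \<in> K" for k
  proof -
    have "s \<zero>\<^bsub>V\<^esub> = \<zero>\<^bsub>V\<^esub>"
      using hom_one[OF s V.a_group V.a_group] by simp
    then have "?\<eta> k \<in> kernel F (add_monoid V) evaluation"
      using \<eta>[OF K_in_F[OF that]] evaluation_K[OF that] by (simp add: kernel_def)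
    then show ?thesis
      by (simp add: kernel_evaluation)
  qed
  have "tensor_map_left Zphi Icosa_R N h X = K <#>\<^bsub>F\<^esub> ?\<eta> ` (K #>\<^bsub>F\<^esub> y)"
    using X y by (simp add: tensor_map_left_def)
  also have "\<dots> = K #>\<^bsub>F\<^esub> ?\<eta> y"
  proof
    show "K <#>\<^bsub>F\<^esub> ?\<eta> ` (K #>\<^bsub>F\<^esub> y) \<subseteq> K #>\<^bsub>F\<^esub> ?\<eta> y"
    proof
      fix z assume "z \<in> K <#>\<^bsub>F\<^esub> ?\<eta> ` (K #>\<^bsub>F\<^esub> y)"
      then obtain k k' where k: "k \<in> K" "k' \<in> K" "z = k + ?\<eta> (k' + y)"
        by (auto simp: set_mult_def r_coset_def)
      then have "z = (k + ?\<eta> k') + ?\<eta> y"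
        by (simp add: frag_extend_add add.assoc)
      then show "z \<in> K #>\<^bsub>F\<^esub> ?\<eta> y"
        using K_add[OF k(1) \<eta>K[OF k(2)]] by (auto simp: r_coset_def)
    qed
    show "K #>\<^bsub>F\<^esub> ?\<eta> y \<subseteq> K <#>\<^bsub>F\<^esub> ?\<eta> ` (K #>\<^bsub>F\<^esub> y)"
    proof
      fix z assume "z \<in> K #>\<^bsub>F\<^esub> ?\<eta> y"
      then obtain k where k: "k \<in> K" "z = k + ?\<eta> y"
        by (auto simp: r_coset_def)
      have "y \<in> K #>\<^bsub>F\<^esub> y"
        using K_zero by (force simp: r_coset_def)
      then show "z \<in> K <#>\<^bsub>F\<^esub> ?\<eta> ` (K #>\<^bsub>F\<^esub> y)"
        using k by (auto simp: set_mult_def)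
    qed
  qed
  finally have eq: "tensor_map_left Zphi Icosa_R N h X = K #>\<^bsub>F\<^esub> ?\<eta> y" .
  show "tensor_map_left Zphi Icosa_R N h X \<in> carrier (tensor Zphi Icosa_R N)"
    unfolding eq carrier_tensor using \<eta>[OF y(1)] by blast
  show "induced (tensor_map_left Zphi Icosa_R N h X) = s (induced X)"
    unfolding eq using \<eta>[OF y(1)] by (simp only: y(2) induced_coset y(1))
qed

end

section \<open>The fixed points of the involution as a \<open>\<int>[\<phi>]\<close>-module\<close>

context abelian_group begin

lemma int_zero_times: "[(0::int)] \<cdot> v = \<zero>"
  by (simp add: add_pow_def)

lemma additive_int_pow:
  assumes closed: "\<And>l. l \<in> L \<Longrightarrow> f l \<in> L" and L: "L \<subseteq> carrier G" "\<zero> \<in> L"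
    and minus: "\<And>l. l \<in> L \<Longrightarrow> \<ominus> l \<in> L"
    and add: "\<And>l l'. \<lbrakk>l \<in> L; l' \<in> L\<rbrakk> \<Longrightarrow> l \<oplus> l' \<in> L"
    and f_add: "\<And>l l'. \<lbrakk>l \<in> L; l' \<in> L\<rbrakk> \<Longrightarrow> f (l \<oplus> l') = f l \<oplus> f l'"
    and l: "l \<in> L"
  shows "[(a::int)] \<cdot> l \<in> L \<and> f ([a] \<cdot> l) = [a] \<cdot> f l"
proof -
  have f_zero: "f \<zero> = \<zero>"
    using f_add[of \<zero> \<zero>] L closed[of \<zero>] add.r_cancel_one'[of "f \<zero>" "f \<zero>"] by auto
  have f_minus: "f (\<ominus> l') = \<ominus> f l'" if "l' \<in> L" for l'
  proof -
    have "f (\<ominus> l') \<oplus> f l' = \<zero>"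
      using f_add[OF minus[OF that] that] f_zero that L(1) by (simp add: l_neg subset_iff)
    then show ?thesis
      using minus_equality[of "f (\<ominus> l')" "f l'"] closed minus that L(1) by (simp add: subset_iff)
  qed
  have V: "l \<in> carrier G" "f l \<in> carrier G"
    using l closed L(1) by auto
  have step: "[(a + 1)] \<cdot> v = [a] \<cdot> v \<oplus> v" "[(a - 1)] \<cdot> v = [a] \<cdot> v \<oplus> \<ominus> v" if "v \<in> carrier G" for a :: int and v
    using add.int_pow_mult[OF that, of a 1] add.int_pow_mult[OF that, of a "- 1"] that
    by (simp_all add: add.int_pow_neg)
  show ?thesis
  proof (induction a rule: int_induct[of _ 0])
    case base
    show ?case
      using L(2) f_zero by (simp add: int_zero_times)
  next
    case (step1 a)
    then show ?case
      using add[of "[a] \<cdot> l" l] f_add[of "[a] \<cdot> l" l] l V by (simp add: step)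
  next
    case (step2 a)
    then show ?case
      using add[of "[a] \<cdot> l" "\<ominus> l"] f_add[of "[a] \<cdot> l" "\<ominus> l"] minus[OF l] f_minus[OF l] V
      by (simp add: step)
  qed
qed

text \<open>
  The relation \<open>f\<^sup>2 = f + 1\<close> is what makes the action of \<open>\<int>[\<phi>]\<close> associative.
\<close>

lemma Zphi_module:
  assumes closed: "\<And>l. l \<in> L \<Longrightarrow> f l \<in> L" and L: "L \<subseteq> carrier G" "\<zero> \<in> L"
    and minus: "\<And>l. l \<in> L \<Longrightarrow> \<ominus> l \<in> L"
    and add: "\<And>l l'. \<lbrakk>l \<in> L; l' \<in> L\<rbrakk> \<Longrightarrow> l \<oplus> l' \<in> L"
    and f_add: "\<And>l l'. \<lbrakk>l \<in> L; l' \<in> L\<rbrakk> \<Longrightarrow> f (l \<oplus> l') = f l \<oplus> f l'"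
    and f_squared: "\<And>l. l \<in> L \<Longrightarrow> f (f l) = f l \<oplus> l"
  shows "module Zphi (Zphi_module G L f)"
proof (rule moduleI)
  have pow: "[a] \<cdot> l \<in> L \<and> f ([a] \<cdot> l) = [a] \<cdot> f l" if "l \<in> L" for a :: int and l
    using L that by (intro additive_int_pow closed minus add f_add)
  have V: "l \<in> carrier G" if "l \<in> L" for l
    using that L(1) by auto
  have smult: "(a, b) \<odot>\<^bsub>Zphi_module G L f\<^esub> l = [a] \<cdot> l \<oplus> [b] \<cdot> f l" for a b l
    by (simp add: Zphi_module_def)
  have smult_closed: "[a] \<cdot> l \<oplus> [b] \<cdot> f l \<in> L" if "l \<in> L" for a b :: int and l
    using that pow closed add by blast
  show "cring Zphi"
    by (rule cring_Zphi)
  show "abelian_group (Zphi_module G L f)"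
  proof (rule abelian_groupI)
    fix x assume "x \<in> carrier (Zphi_module G L f)"
    then show "\<exists>y \<in> carrier (Zphi_module G L f). y \<oplus>\<^bsub>Zphi_module G L f\<^esub> x = \<zero>\<^bsub>Zphi_module G L f\<^esub>"
      using minus[of x] V[of x] l_neg[of x] by (auto simp: Zphi_module_def)
  qed (simp_all add: Zphi_module_def V L(2) add a_ac)
  fix r s :: "int \<times> int" and l l'
  assume l: "l \<in> carrier (Zphi_module G L f)" "l' \<in> carrier (Zphi_module G L f)"
  obtain a b c d where rs: "r = (a, b)" "s = (c, d)"
    by fastforce
  have lL: "l \<in> L" "l' \<in> L"
    using l by (simp_all add: Zphi_module_def)
  note c = V[OF lL(1)] V[OF lL(2)] V[OF closed[OF lL(1)]] V[OF closed[OF lL(2)]]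
  note int_laws = add.int_pow_mult add.int_pow_mult_distrib[OF a_comm] add.int_pow_pow
  show "r \<odot>\<^bsub>Zphi_module G L f\<^esub> l \<in> carrier (Zphi_module G L f)"
    using smult_closed[OF lL(1)] by (simp add: rs smult) (simp add: Zphi_module_def)
  show "(r \<oplus>\<^bsub>Zphi\<^esub> s) \<odot>\<^bsub>Zphi_module G L f\<^esub> l =
      r \<odot>\<^bsub>Zphi_module G L f\<^esub> l \<oplus>\<^bsub>Zphi_module G L f\<^esub> s \<odot>\<^bsub>Zphi_module G L f\<^esub> l"
    using c by (simp add: rs smult Zphi_simps int_laws a_ac) (simp add: Zphi_module_def a_ac)
  show "r \<odot>\<^bsub>Zphi_module G L f\<^esub> (l \<oplus>\<^bsub>Zphi_module G L f\<^esub> l') =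
      r \<odot>\<^bsub>Zphi_module G L f\<^esub> l \<oplus>\<^bsub>Zphi_module G L f\<^esub> r \<odot>\<^bsub>Zphi_module G L f\<^esub> l'"
    using c f_add[OF lL] by (simp add: rs smult) (simp add: Zphi_module_def int_laws a_ac)
  show "(r \<otimes>\<^bsub>Zphi\<^esub> s) \<odot>\<^bsub>Zphi_module G L f\<^esub> l =
      r \<odot>\<^bsub>Zphi_module G L f\<^esub> (s \<odot>\<^bsub>Zphi_module G L f\<^esub> l)"
  proof -
    have "f ([c] \<cdot> l \<oplus> [d] \<cdot> f l) = [c] \<cdot> f l \<oplus> [d] \<cdot> (f l \<oplus> l)"
      using f_add pow[OF lL(1)] pow[OF closed[OF lL(1)]] f_squared[OF lL(1)] by metis
    then show ?thesis
      using c by (simp add: rs smult Zphi_simps int_laws a_ac mult.commute)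
  qed
  show "\<one>\<^bsub>Zphi\<^esub> \<odot>\<^bsub>Zphi_module G L f\<^esub> l = l"
    using c by (simp add: Zphi_simps smult int_zero_times)
qed

end

context icosahedral_module begin

text \<open>
  The class sum is \<open>4\<psi>\<close>, and division by 4 is unambiguous.
\<close>

lemma phi_op_eq_\<psi>:
  assumes "l \<in> L"
  shows "phi_op V act (set five_cycle_words) l = \<psi> l"
proof -
  have l: "l \<in> carrier V" "A l = l"
    using assms by (simp_all add: L_iff)
  have four: "[(4::nat)] \<cdot> w = (w \<oplus> w) \<oplus> (w \<oplus> w)" if "w \<in> carrier V" for w
    using that by (simp add: eval_nat_numeral a_assoc)
  have "w = \<psi> l" if "w \<in> carrier V" "[(4::nat)] \<cdot> \<psi> l = [(4::nat)] \<cdot> w" for w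
  proof -
    have "(\<psi> l \<oplus> \<psi> l) \<oplus> (\<psi> l \<oplus> \<psi> l) = (w \<oplus> w) \<oplus> (w \<oplus> w)"
      using that l four by simp
    then have "w \<oplus> w = \<psi> l \<oplus> \<psi> l"
      using that(1) l(1) by (intro double_inject[of "w \<oplus> w" "\<psi> l \<oplus> \<psi> l"]) simp_all
    then show ?thesis
      using that(1) l(1) by (intro double_inject[of w "\<psi> l"]) simp_all
  qed
  then show ?thesis
    using l unfolding phi_op_def divide_by_def sum_over_five_cycles[OF l]
    by (intro the_equality) auto
qed

abbreviation N :: "(int \<times> int, 'v) module"
  where "N \<equiv> L_module V act alpha (set five_cycle_words)"

lemma N_simps:
  "carrier N = L" "l \<oplus>\<^bsub>N\<^esub> l' = l \<oplus> l'" "\<zero>\<^bsub>N\<^esub> = \<zero>"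
  by (simp_all add: L_module_def Zphi_module_def trace_image_alpha)

lemma N_smult: "l \<in> L \<Longrightarrow> (a, b) \<odot>\<^bsub>N\<^esub> l = [a] \<cdot> l \<oplus> [b] \<cdot> \<psi> l"
  by (simp add: L_module_def Zphi_module_def phi_op_eq_\<psi>)

lemma L_closed:
  "\<zero> \<in> L" "l \<in> L \<Longrightarrow> \<ominus> l \<in> L" "\<lbrakk>l \<in> L; l' \<in> L\<rbrakk> \<Longrightarrow> l \<oplus> l' \<in> L" "l \<in> L \<Longrightarrow> \<psi> l \<in> L"
  by (simp_all add: L_iff)

lemma module_N: "module Zphi N"
  unfolding L_module_def trace_image_alpha
  by (rule Zphi_module) (auto simp: phi_op_eq_\<psi> L_closed, auto simp: L_iff \<psi>_squared)

lemma phi_op_squared: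
  "l \<in> L \<Longrightarrow> phi_op V act (set five_cycle_words) (phi_op V act (set five_cycle_words) l) =
     phi_op V act (set five_cycle_words) l \<oplus> l"
  by (simp add: phi_op_eq_\<psi> L_closed \<psi>_squared L_iff)

text \<open>
  The value at \<open>x \<otimes> l\<close> of the map from \<open>Icosa(L)\<close> to \<open>V\<close> that sends \<open>e\<^sub>3 \<otimes> l\<close> to \<open>l\<close>.
\<close>

definition pairing :: "icosa_vec \<Rightarrow> 'v \<Rightarrow> 'v"
  where "pairing x l = combine (fst x \<odot>\<^bsub>N\<^esub> l) (fst (snd x) \<odot>\<^bsub>N\<^esub> l) (snd (snd x) \<odot>\<^bsub>N\<^esub> l)"

interpretation N: module Zphi N
  by (rule module_N)

lemma smult_L: "l \<in> L \<Longrightarrow> r \<odot>\<^bsub>N\<^esub> l \<in> L"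
  using N.smult_closed[of r l] by (simp add: N_simps Zphi_simps)

lemma smult_V: "l \<in> L \<Longrightarrow> r \<odot>\<^bsub>N\<^esub> l \<in> carrier V"
  using smult_L by (simp add: L_iff)

lemma combine_add:
  assumes "u1 \<in> carrier V" "u2 \<in> carrier V" "u3 \<in> carrier V" "w1 \<in> carrier V" "w2 \<in> carrier V" "w3 \<in> carrier V"
  shows "combine (u1 \<oplus> w1) (u2 \<oplus> w2) (u3 \<oplus> w3) = combine u1 u2 u3 \<oplus> combine w1 w2 w3"
  using assms by (simp add: combine_def a_ac)

lemma smult_basis: "l \<in> L \<Longrightarrow> (1, 0) \<odot>\<^bsub>N\<^esub> l = l" "l \<in> L \<Longrightarrow> (0, 0) \<odot>\<^bsub>N\<^esub> l = \<zero>"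
  by (simp_all add: N_smult L_iff int_zero_times)

lemma pairing_basis:
  assumes "l1 \<in> L" "l2 \<in> L" "l3 \<in> L"
  shows "pairing e1 l1 \<oplus> pairing e2 l2 \<oplus> pairing e3 l3 = combine l1 l2 l3"
  using assms
  by (simp add: pairing_def e1_def e2_def e3_def Zphi_simps smult_basis combine_def L_iff)

lemma icosa_bilinear_pairing: "icosa_bilinear N V pairing"
proof (intro icosa_bilinear.intro icosa_bilinear_axioms.intro module_N abelian_group_axioms)
  show "pairing x l \<in> carrier V" if "l \<in> carrier N" for x l
    using that by (simp add: pairing_def N_simps smult_V)
  show "pairing (x \<oplus>\<^bsub>Icosa_R\<^esub> y) l = pairing x l \<oplus> pairing y l" if "l \<in> carrier N" for x y l
  proof -
    have distr: "(r \<oplus>\<^bsub>Zphi\<^esub> s) \<odot>\<^bsub>N\<^esub> l = r \<odot>\<^bsub>N\<^esub> l \<oplus> s \<odot>\<^bsub>N\<^esub> l" for r s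
      using N.smult_l_distr[of r s l] that by (simp add: Zphi_simps(1) N_simps(2))
    have "x \<oplus>\<^bsub>Icosa_R\<^esub> y = (fst x \<oplus>\<^bsub>Zphi\<^esub> fst y, fst (snd x) \<oplus>\<^bsub>Zphi\<^esub> fst (snd y), snd (snd x) \<oplus>\<^bsub>Zphi\<^esub> snd (snd y))"
      by (simp add: free3_def split_beta)
    then show ?thesis
      using that unfolding pairing_def
      by (simp only: fst_conv snd_conv distr N_simps(1) combine_add smult_V)
  qed
  show "pairing x (l \<oplus>\<^bsub>N\<^esub> l') = pairing x l \<oplus> pairing x l'" if "l \<in> carrier N" "l' \<in> carrier N" for x l l'
  proof -
    have "r \<odot>\<^bsub>N\<^esub> (l \<oplus>\<^bsub>N\<^esub> l') = r \<odot>\<^bsub>N\<^esub> l \<oplus> r \<odot>\<^bsub>N\<^esub> l'" for r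
      using N.smult_r_distr[of r l l'] that by (simp add: Zphi_simps(1) N_simps(2))
    then show ?thesis
      using that unfolding pairing_def by (simp only: N_simps(1) combine_add smult_V)
  qed
  show "pairing (r \<odot>\<^bsub>Icosa_R\<^esub> x) l = pairing x (r \<odot>\<^bsub>N\<^esub> l)" if "l \<in> carrier N" for r x l
  proof -
    have "(r \<otimes>\<^bsub>Zphi\<^esub> s) \<odot>\<^bsub>N\<^esub> l = s \<odot>\<^bsub>N\<^esub> (r \<odot>\<^bsub>N\<^esub> l)" for s
      using N.smult_assoc1[of s r l] N.R.m_comm[of s r] that by (simp add: Zphi_simps(1))
    moreover have "r \<odot>\<^bsub>Icosa_R\<^esub> x = (r \<otimes>\<^bsub>Zphi\<^esub> fst x, r \<otimes>\<^bsub>Zphi\<^esub> fst (snd x), r \<otimes>\<^bsub>Zphi\<^esub> snd (snd x))"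
      by (simp add: free3_def split_beta)
    ultimately show ?thesis
      unfolding pairing_def by (simp only: fst_conv snd_conv)
  qed
  show "\<exists>l1 \<in> carrier N. \<exists>l2 \<in> carrier N. \<exists>l3 \<in> carrier N.
      v = pairing e1 l1 \<oplus> pairing e2 l2 \<oplus> pairing e3 l3" if v: "v \<in> carrier V" for v
  proof -
    obtain l1 l2 l3 where "l1 \<in> L" "l2 \<in> L" "l3 \<in> L" "v = combine l1 l2 l3"
      by (rule combine_surj[OF v])
    then show ?thesis
      unfolding N_simps using pairing_basis by metis
  qed
  show "l1 = \<zero>\<^bsub>N\<^esub> \<and> l2 = \<zero>\<^bsub>N\<^esub> \<and> l3 = \<zero>\<^bsub>N\<^esub>"
    if "l1 \<in> carrier N" "l2 \<in> carrier N" "l3 \<in> carrier N"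
      "pairing e1 l1 \<oplus> pairing e2 l2 \<oplus> pairing e3 l3 = \<zero>" for l1 l2 l3
    using that combine_eq_zero[of l1 l2 l3] by (simp add: N_simps pairing_basis L_iff)
qed

text \<open>
  On generators: for \<open>\<gamma>\<close> both sides permute the coordinates cyclically, and for \<open>\<alpha>\<close> this is the pair of
  formulas \<open>\<alpha>\<gamma>l = -\<gamma>l + \<psi>l\<close> and \<open>\<alpha>\<gamma>\<^sup>2l = -\<gamma>\<^sup>2l + \<psi>l\<close>.
\<close>

lemma pairing_equivariant:
  assumes l: "l \<in> L" and g: "g \<in> carrier A5"
  shows "pairing (icosa_rep g x) l = act g (pairing x l)"
proof -
  have alpha: "pairing (alpha_matrix x) l = A (pairing x l)" for x
  proof (cases x rule: icosa_vec_cases)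
    case (1 p1 q1 p2 q2 p3 q3)
    have distr: "(r \<oplus>\<^bsub>Zphi\<^esub> s) \<odot>\<^bsub>N\<^esub> l = r \<odot>\<^bsub>N\<^esub> l \<oplus> s \<odot>\<^bsub>N\<^esub> l" for r s
      using N.smult_l_distr[of r s l] l by (simp add: Zphi_simps(1) N_simps)
    have neg: "(- p, - q) \<odot>\<^bsub>N\<^esub> l = \<ominus> ((p, q) \<odot>\<^bsub>N\<^esub> l)" for p q
    proof -
      have "(- p, - q) \<odot>\<^bsub>N\<^esub> l \<oplus> (p, q) \<odot>\<^bsub>N\<^esub> l = \<zero>"
        using distr[of "(- p, - q)" "(p, q)"] smult_basis(2)[OF l] by (simp add: Zphi_simps)
      then show ?thesis
        using minus_equality smult_V[OF l] by metis
    qed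
    have times_phi: "(q, p + q) \<odot>\<^bsub>N\<^esub> l = \<psi> ((p, q) \<odot>\<^bsub>N\<^esub> l)" for p q
    proof -
      have "(0, 1) \<odot>\<^bsub>N\<^esub> ((p, q) \<odot>\<^bsub>N\<^esub> l) = \<psi> ((p, q) \<odot>\<^bsub>N\<^esub> l)"
        using N_smult[OF smult_L[OF l], of 0 1 "(p, q)"] smult_V[OF l] by (simp add: int_zero_times)
      then show ?thesis
        using N.smult_assoc1[of "(0, 1)" "(p, q)" l] l by (simp add: Zphi_simps N_simps)
    qed
    have sum: "(q1 + q2 + p3, p1 + q1 + p2 + q2 + q3) = (q1, p1 + q1) \<oplus>\<^bsub>Zphi\<^esub> (q2, p2 + q2) \<oplus>\<^bsub>Zphi\<^esub> (p3, q3)"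
      by (simp add: Zphi_simps)
    have u: "r \<odot>\<^bsub>N\<^esub> l \<in> carrier V" "A (r \<odot>\<^bsub>N\<^esub> l) = r \<odot>\<^bsub>N\<^esub> l" for r
      using smult_L[OF l] by (simp_all add: L_iff)
    show ?thesis
      unfolding pairing_def 1 alpha_matrix_def prod.case fst_conv snd_conv sum distr neg times_phi
      using u by (simp add: combine_def A_\<Gamma> A_\<Gamma>\<Gamma> a_ac)
  qed
  have gamma: "pairing (gamma_matrix x) l = \<Gamma> (pairing x l)" for x
    using smult_V[OF l]
    by (cases x rule: icosa_vec_cases) (simp add: pairing_def gamma_matrix_def combine_def a_ac)
  have closed: "pairing x l \<in> carrier V" for x
    using icosa_bilinear.b_closed[OF icosa_bilinear_pairing] l by (simp add: N_simps)
  show ?thesis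
    using g
  proof (induction rule: A5_induct)
    case id
    show ?case
      using closed by (simp only: icosa_rep_id act_id)
  next
    case (alpha p)
    show "pairing (icosa_rep (alpha \<circ> p) x) l = act (alpha \<circ> p) (pairing x l)"
      using alpha closed
      by (simp only: icosa_rep_comp act_comp alpha_closed icosa_rep_alpha \<open>\<And>x. pairing (alpha_matrix x) l = A (pairing x l)\<close>)
  next
    case (gamma p)
    show "pairing (icosa_rep (gamma \<circ> p) x) l = act (gamma \<circ> p) (pairing x l)"
      using gamma closed
      by (simp only: icosa_rep_comp act_comp gamma_closed icosa_rep_gamma \<open>\<And>x. pairing (gamma_matrix x) l = \<Gamma> (pairing x l)\<close>)
  qed
qed

theorem isomorphic_to_Icosa: "group_module_iso A5 V act (Icosa N) (Icosa_act alpha gamma N)"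
proof -
  interpret icosa_bilinear N V pairing
    by (rule icosa_bilinear_pairing)
  define f where "f = inv_into (carrier (Icosa N)) induced"
  have iso: "induced \<in> iso (add_monoid (Icosa N)) (add_monoid V)"
    using induced_iso by (simp add: Icosa_def)
  then have bij: "bij_betw induced (carrier (Icosa N)) (carrier V)"
    by (simp add: iso_def)
  have f_in: "f v \<in> carrier (Icosa N)" "induced (f v) = v" if "v \<in> carrier V" for v
    using bij that unfolding f_def bij_betw_def by (auto intro: inv_into_into f_inv_into_f)
  have f_eqI: "f v = X" if "X \<in> carrier (Icosa N)" "induced X = v" for v X
    using bij that unfolding f_def bij_betw_def by (auto intro: inv_into_f_f)
  have "f \<in> iso (add_monoid V) (add_monoid (Icosa N))"
    using group.iso_set_sym[OF group_tensor induced_iso] by (simp add: f_def Icosa_def)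
  moreover have "f (act g v) = Icosa_act alpha gamma N g (f v)" if g: "g \<in> carrier A5" and v: "v \<in> carrier V" for g v
  proof (rule f_eqI)
    have s: "act g \<in> hom (add_monoid V) (add_monoid V)"
      using g by (simp add: hom_def act_add)
    have h: "pairing (icosa_rep g x) l = act g (pairing x l)" if "l \<in> carrier N" for x l
      using pairing_equivariant[OF _ g] that by (simp add: N_simps)
    have X: "f v \<in> carrier (tensor Zphi Icosa_R N)"
      using f_in(1)[OF v] by (simp add: Icosa_def)
    have "tensor_map_left Zphi Icosa_R N (icosa_rep g) (f v) \<in> carrier (tensor Zphi Icosa_R N)"
      by (rule induced_tensor_map(1)[OF s _ X]) (rule h)
    moreover have "induced (tensor_map_left Zphi Icosa_R N (icosa_rep g) (f v)) = act g (induced (f v))"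
      by (rule induced_tensor_map(2)[OF s _ X]) (rule h)
    ultimately show "Icosa_act alpha gamma N g (f v) \<in> carrier (Icosa N)"
        "induced (Icosa_act alpha gamma N g (f v)) = act g v"
      using f_in(2)[OF v] by (simp_all add: Icosa_act_def Icosa_def icosa_action_eq[OF g])
  qed
  ultimately show ?thesis
    unfolding group_module_iso_def by blast
qed

end

section \<open>The isomorphism with \<open>Icosa(L)\<close>\<close>

lemma five_cycle_in_A5:
  assumes "c \<in> five_cycles"
  shows "c \<in> carrier A5"
proof -
  obtain cs where cs: "c = cycle_of_list cs" "distinct cs" "length cs = 5" "set cs \<subseteq> {1..5}"
    using assms by (auto simp: five_cycles_def)
  have "swapidseq_ext (set cs) 4 c"
    using swapidseq_ext_of_cycles[OF cs(2)] cs(1,3) by simp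
  then have "swapidseq 4 c"
    by (rule swapidseq_ext_imp_swapidseq)
  then have "evenperm c"
    using evenperm_unique[of 4 c True] by simp
  moreover have "c permutes {1..5}"
    unfolding cs(1) by (rule permutes_subset[OF cycle_permutes cs(4)])
  ultimately show ?thesis
    by (simp add: alt_group_carrier)
qed

lemma (in five_points) five_cycle_class_eq:
  assumes "five_cycle_class C" "alpha \<circ> gamma \<in> C"
  shows "C = set five_cycle_words"
proof -
  obtain c where c: "c \<in> five_cycles" "C = conjugacy_class A5 c"
    using assms(1) by (auto simp: five_cycle_class_def)
  show ?thesis
    using A5.conjugacy_class_eq[OF five_cycle_in_A5[OF c(1)], of "alpha \<circ> gamma"] assms(2) c(2)
      conjugacy_class_alpha_gamma by simp
qed

text \<open>
  So \<open>\<beta>\<close> is an element to which the inversion hypothesis for \<open>\<alpha>\<close> applies.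
\<close>

lemma (in five_points) beta_in_normalizer:
  "beta \<in> normalizer A5 (generate A5 {alpha}) - generate A5 {alpha}"
proof -
  have gen: "generate A5 {alpha} = {id, alpha}"
  proof
    have "x \<in> {id, alpha}" if "x \<in> generate A5 {alpha}" for x
      using that
    proof induction
      case (eng x y)
      then show ?case
        unfolding alt_group_mult using alpha_squared by (metis empty_iff id_o insert_iff o_id)
    qed (simp_all add: alt_group_one inv_alpha)
    then show "generate A5 {alpha} \<subseteq> {id, alpha}"
      by blast
    show "{id, alpha} \<subseteq> generate A5 {alpha}"
      using generate.one[of A5 "{alpha}"] generate.incl[of alpha "{alpha}" A5] by (simp add: alt_group_one)
  qed
  have "beta \<circ> alpha \<circ> beta = alpha"
    by (simp only: comp_assoc alpha_beta_commute) (simp only: o_assoc beta_squared id_o)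
  then have "beta <#\<^bsub>A5\<^esub> {id, alpha} #>\<^bsub>A5\<^esub> inv\<^bsub>A5\<^esub> beta = {id, alpha}"
    using beta_squared by (simp add: l_coset_def r_coset_def alt_group_mult inv_beta)
  moreover have "{id, alpha} \<subseteq> carrier A5"
    using A5.one_closed by (simp add: alt_group_one)
  ultimately have "beta \<in> normalizer A5 {id, alpha}"
    by (simp add: normalizer_def stabilizer_def)
  moreover have "beta m \<noteq> id m" "beta m \<noteq> alpha m"
    using distinctness by simp_all
  then have "beta \<noteq> id" "beta \<noteq> alpha"
    by metis+
  ultimately show ?thesis
    by (simp add: gen)
qed

theorem theorem2:
  fixes V :: "('v, 'm) ring_scheme"
    and act :: "(nat \<Rightarrow> nat) \<Rightarrow> 'v \<Rightarrow> 'v"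
    and \<alpha> :: "nat \<Rightarrow> nat"
    and C :: "(nat \<Rightarrow> nat) set"
  assumes "group_module (alt_group 5) V act"
    and "uniquely_n_divisible 2 V"
    and "prime_characteristic V \<or> divisible V"
    and "\<And>g h. \<lbrakk>g \<in> carrier (alt_group 5); g \<noteq> \<one>\<^bsub>alt_group 5\<^esub>;
           n_divisible (group.ord (alt_group 5) g) V;
           h \<in> normalizer (alt_group 5) (generate (alt_group 5) {g})
                 - generate (alt_group 5) {g}\<rbrakk>
         \<Longrightarrow> inverts V act h (trace_image (alt_group 5) V act g)"
    and "\<alpha> \<in> carrier (alt_group 5)"
    and "group.ord (alt_group 5) \<alpha> = 2"
    and "five_cycle_class C"
  shows "module Zphi (L_module V act \<alpha> C) \<and>
    (\<forall>l \<in> trace_image (alt_group 5) V act \<alpha>.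
       phi_op V act C (phi_op V act C l) = phi_op V act C l \<oplus>\<^bsub>V\<^esub> l) \<and>
    (\<exists>\<gamma>. icosa_generators \<alpha> \<gamma> \<and> \<alpha> \<otimes>\<^bsub>alt_group 5\<^esub> \<gamma> \<in> C) \<and>
    (\<forall>\<gamma>. icosa_generators \<alpha> \<gamma> \<and> \<alpha> \<otimes>\<^bsub>alt_group 5\<^esub> \<gamma> \<in> C \<longrightarrow>
       group_module_iso (alt_group 5) V act
         (Icosa (L_module V act \<alpha> C)) (Icosa_act \<alpha> \<gamma> (L_module V act \<alpha> C)))"
proof -
  have V: "abelian_group V"
    using assms(1) by (simp add: group_module_def)
  have two: "n_divisible 2 V"
    using assms(2) unfolding n_divisible_def uniquely_n_divisible_def by blast
  have icosahedral: "icosahedral_module i j k m n V act"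
    if points: "five_points i j k m n" and \<alpha>: "\<alpha> = five_points.alpha i j m n" for i j k m n
  proof -
    interpret A5_module i j k m n V act
      by (intro A5_module.intro A5_module_axioms.intro points V assms(1,2))
    show ?thesis
    proof (intro icosahedral_module.intro icosahedral_module_axioms.intro A5_module_axioms)
      fix v assume v: "v \<in> carrier V" "act alpha v = v"
      have "alpha \<noteq> \<one>\<^bsub>A5\<^esub>"
        using ord_alpha A5.ord_eq_1[OF alpha_closed] by auto
      then have "inverts V act beta (trace_image A5 V act alpha)"
        by (rule assms(4)[OF alpha_closed _ _ beta_in_normalizer]) (simp only: ord_alpha two)
      then show "act beta v = \<ominus>\<^bsub>V\<^esub> v"
        using v by (simp add: inverts_def trace_image_alpha L_iff)
    qed
  qed
  have main: "module Zphi (L_module V act \<alpha> C)"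
      "\<forall>l \<in> trace_image A5 V act \<alpha>. phi_op V act C (phi_op V act C l) = phi_op V act C l \<oplus>\<^bsub>V\<^esub> l"
      "group_module_iso A5 V act (Icosa (L_module V act \<alpha> C)) (Icosa_act \<alpha> \<gamma> (L_module V act \<alpha> C))"
    if gen: "icosa_generators \<alpha> \<gamma>" and C: "\<alpha> \<otimes>\<^bsub>A5\<^esub> \<gamma> \<in> C" for \<gamma>
  proof -
    obtain i j k m n where points: "five_points i j k m n"
      and \<alpha>: "\<alpha> = five_points.alpha i j m n" and \<gamma>: "\<gamma> = five_points.gamma i j k"
      by (rule icosa_generators_labels[OF gen])
    interpret icosahedral_module i j k m n V act
      by (rule icosahedral[OF points \<alpha>])
    have C': "C = set five_cycle_words"
      using five_cycle_class_eq assms(7) C by (simp add: \<alpha> \<gamma> alt_group_mult)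
    show "module Zphi (L_module V act \<alpha> C)"
      unfolding \<alpha> C' by (rule module_N)
    show "\<forall>l \<in> trace_image A5 V act \<alpha>. phi_op V act C (phi_op V act C l) = phi_op V act C l \<oplus>\<^bsub>V\<^esub> l"
      unfolding \<alpha> C' trace_image_alpha using phi_op_squared by blast
    show "group_module_iso A5 V act (Icosa (L_module V act \<alpha> C)) (Icosa_act \<alpha> \<gamma> (L_module V act \<alpha> C))"
      unfolding \<alpha> \<gamma> C' by (rule isomorphic_to_Icosa)
  qed
  have ex: "\<exists>\<gamma>. icosa_generators \<alpha> \<gamma> \<and> \<alpha> \<otimes>\<^bsub>A5\<^esub> \<gamma> \<in> C"
  proof -
    obtain i j k m n where points: "five_points i j k m n" and \<alpha>: "\<alpha> = five_points.alpha i j m n"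
      by (rule involution_labels[OF assms(5,6)])
    interpret five_points i j k m n
      by (fact points)
    interpret other: five_points i n k m j
      using distinctness points by unfold_locales auto
    have "other.alpha = alpha"
      by (simp add: alpha_def other.alpha_def transpose_commute)
    then show ?thesis
      using five_cycle_class_cases[OF assms(7)] icosa_generators_alpha_gamma other.icosa_generators_alpha_gamma
      by (auto simp: \<alpha> alt_group_mult)
  qed
  then show ?thesis
    using main by blast
qed

end
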